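(* Let $\alpha\in(0,1)$, $\alpha>\frac14$, $\alpha\neq\frac12$, and $q>\frac1\alpha$. Let $\boldsymbol\Gamma(\varepsilon)=(\Gamma(\varepsilon)^{(1)},\Gamma(\varepsilon)^{(2)},\Gamma(\varepsilon)^{(3)})$, $\varepsilon>0$, be the analytic approximation of three-dimensional fractional Brownian motion with Hurst exponent $\alpha$ described in the context. Then, as $\varepsilon\to0$, almost surely, the third iterated integrals $\mathrm{Vol}_{s,t}(\boldsymbol\Gamma(\varepsilon))$ converge with respect to the distance $d_3$.
   Context: Powers $z^\beta$ ($z\in\mathbb{C}\setminus\mathbb{R}_-$) use the principal logarithm. Let $\Gamma'^{+}$ be the complex centered Gaussian process on the open upper half-plane $\Pi^+$, a.s. analytic, with $\Gamma'^-_{\bar z}:=\overline{\Gamma'^+_z}$ and covariances $\mathbb{E}[\Gamma'^+_z\Gamma'^+_w]=\mathbb{E}[\Gamma'^-_{\bar z}\Gamma'^-_{\bar w}]=0$, $\mathbb{E}[\Gamma'^+_z\Gamma'^-_{\bar w}]=\frac{\alpha(1-2\alpha)}{2\cos\pi\alpha}(-i(z-\bar w))^{2\alpha-2}$. (Explicitly $\Gamma'^+_z=\sum_{k\ge0}f_k(z)\xi_k^+$ with $f_k(z)=2^{\alpha-1}\sqrt{\frac{\alpha(1-2\alpha)}{2\cos\pi\alpha}}\sqrt{\frac{(2-2\alpha)_k}{k!}}(\frac{z+i}{2i})^{2\alpha-2}(\frac{z-i}{z+i})^k$, $(x)_k=x(x+1)\cdots(x+k-1)$, and $\xi_k^+$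 independent standard complex Gaussians with $\mathbb{E}|\xi_k^+|^2=1$, $\mathbb{E}[(\xi_k^+)^2]=0$.) Let $\Gamma^+_z=\int_0^z\Gamma'^+_u\,du$ (along any path in $\Pi^+$ from $0$ to $z$) and $\Gamma(\varepsilon)_x=2\operatorname{Re}\Gamma^+_{x+i\varepsilon}$ for $\varepsilon>0$, $x\in\mathbb{R}$; $\Gamma(\varepsilon)^{(1)},\Gamma(\varepsilon)^{(2)},\Gamma(\varepsilon)^{(3)}$ are built from three independent copies of $\Gamma'^+$ (each used for all $\varepsilon$); $\Gamma'(\varepsilon)_x=\frac{d}{dx}\Gamma(\varepsilon)_x$. The volume functional is $$\mathrm{Vol}_{s,t}(\boldsymbol\Gamma(\varepsilon))=\int_s^t\Gamma'(\varepsilon)^{(1)}_{x_1}dx_1\int_s^{x_1}\Gamma'(\varepsilon)^{(2)}_{x_2}dx_2\int_s^{x_2}\Gamma'(\varepsilon)^{(3)}_{x_3}dx_3.$$ For a fixed bounded interval $[s,t]$ and two real functionals $A=(A_{u,v})$, $A'=(A'_{u,v})$, $s\le u\le v\le t$, set $$d_3(A,A')_{s,t}=\left(\sup_{s=t_0<\cdots<t_n=t}\sum_{l=1}^n|A_{t_{l-1},t_l}-A'_{t_{l-1},t_l}|^{q/3}\right)^{3/q},$$ the supremum being over all finite partitions of $[s,t]$. Convergence with respect to $d_3$ means convergence of the functional $(u,v)\mapsto\mathrm{Vol}_{u,v}(\boldsymbol\Gamma(\varepsilon))$ to some limit functional in $d_3$ on every such interval. *)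

theory Defs
  imports "HOL-Probability.Probability" "HOL-Complex_Analysis.Complex_Analysis"
begin

definition upper_half_plane :: "complex set" where
  "upper_half_plane = {z. Im z > 0}"

(* Degenerate (almost surely zero) variables are Gaussian with variance 0. *)
definition centered_gaussian_rv :: "'w measure \<Rightarrow> ('w \<Rightarrow> real) \<Rightarrow> bool" where
  "centered_gaussian_rv M Y \<longleftrightarrow>
     Y \<in> borel_measurable M \<and>
     ((AE \<omega> in M. Y \<omega> = 0) \<or>
      (\<exists>\<sigma>>0. distributed M lborel Y (normal_density 0 \<sigma>)))"

(* The real parts of complex-linear combinations are exactly the real-linear combinations
   of the real and imaginary parts, so this is joint Gaussianity of the real and imaginary
   parts of the whole family. *)
definition complex_centered_gaussian_process ::
    "'w measure \<Rightarrow> complex set \<Rightarrow> (complex \<Rightarrow> 'w \<Rightarrow> complex) \<Rightarrow> bool" where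
  "complex_centered_gaussian_process M D X \<longleftrightarrow>
     (\<forall>z\<in>D. X z \<in> borel_measurable M) \<and>
     (\<forall>F c. finite F \<longrightarrow> F \<subseteq> D \<longrightarrow>
        centered_gaussian_rv M (\<lambda>\<omega>. Re (\<Sum>z\<in>F. c z * X z \<omega>)))"

definition reflected_process :: "(complex \<Rightarrow> 'w \<Rightarrow> complex) \<Rightarrow> complex \<Rightarrow> 'w \<Rightarrow> complex" where
  "reflected_process X z \<omega> = cnj (X (cnj z) \<omega>)"

definition analytic_fbm_derivative ::
    "real \<Rightarrow> 'w measure \<Rightarrow> (complex \<Rightarrow> 'w \<Rightarrow> complex) \<Rightarrow> bool" where
  "analytic_fbm_derivative \<alpha> M X \<longleftrightarrow>
     complex_centered_gaussian_process M upper_half_plane X \<and>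
     (AE \<omega> in M. (\<lambda>z. X z \<omega>) analytic_on upper_half_plane) \<and>
     (\<forall>z\<in>upper_half_plane. \<forall>w\<in>upper_half_plane.
        prob_space.expectation M (\<lambda>\<omega>. X z \<omega> * X w \<omega>) = 0 \<and>
        prob_space.expectation M
          (\<lambda>\<omega>. reflected_process X (cnj z) \<omega> * reflected_process X (cnj w) \<omega>) = 0 \<and>
        prob_space.expectation M (\<lambda>\<omega>. X z \<omega> * reflected_process X (cnj w) \<omega>) =
          complex_of_real (\<alpha> * (1 - 2 * \<alpha>) / (2 * cos (pi * \<alpha>))) *
          (- \<i> * (z - cnj w)) powr complex_of_real (2 * \<alpha> - 2))"

(* Independent as processes: the family of the restrictions to the upper half-plane,
   valued in the product sigma-algebra, is independent. *)
definition independent_copies ::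
    "real \<Rightarrow> 'w measure \<Rightarrow> nat set \<Rightarrow> (nat \<Rightarrow> complex \<Rightarrow> 'w \<Rightarrow> complex) \<Rightarrow> bool" where
  "independent_copies \<alpha> M J X \<longleftrightarrow>
     (\<forall>j\<in>J. analytic_fbm_derivative \<alpha> M (X j)) \<and>
     prob_space.indep_vars M (\<lambda>_. PiM upper_half_plane (\<lambda>_. borel))
       (\<lambda>j \<omega>. \<lambda>z\<in>upper_half_plane. X j z \<omega>) J"

(* The integral from 0 to z is taken along the segment, whose only point outside the
   open half-plane is the (negligible) initial point 0. *)
definition Gamma_plus :: "(complex \<Rightarrow> 'w \<Rightarrow> complex) \<Rightarrow> complex \<Rightarrow> 'w \<Rightarrow> complex" where
  "Gamma_plus X z \<omega> = contour_integral (linepath 0 z) (\<lambda>u. X u \<omega>)"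

definition Gamma_eps ::
    "(complex \<Rightarrow> 'w \<Rightarrow> complex) \<Rightarrow> real \<Rightarrow> 'w \<Rightarrow> real \<Rightarrow> real" where
  "Gamma_eps X \<epsilon> \<omega> x = 2 * Re (Gamma_plus X (Complex x \<epsilon>) \<omega>)"

definition Gamma_eps_deriv ::
    "(complex \<Rightarrow> 'w \<Rightarrow> complex) \<Rightarrow> real \<Rightarrow> 'w \<Rightarrow> real \<Rightarrow> real" where
  "Gamma_eps_deriv X \<epsilon> \<omega> = deriv (Gamma_eps X \<epsilon> \<omega>)"

definition Vol ::
    "(nat \<Rightarrow> complex \<Rightarrow> 'w \<Rightarrow> complex) \<Rightarrow> real \<Rightarrow> 'w \<Rightarrow> real \<Rightarrow> real \<Rightarrow> real" where
  "Vol X \<epsilon> \<omega> s t =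
     integral {s..t} (\<lambda>x1. Gamma_eps_deriv (X 1) \<epsilon> \<omega> x1 *
       integral {s..x1} (\<lambda>x2. Gamma_eps_deriv (X 2) \<epsilon> \<omega> x2 *
         integral {s..x2} (\<lambda>x3. Gamma_eps_deriv (X 3) \<epsilon> \<omega> x3)))"

(* The pairs (n, p) with s = p 0 < p 1 < ... < p n = t. *)
definition partitions :: "real \<Rightarrow> real \<Rightarrow> (nat \<times> (nat \<Rightarrow> real)) set" where
  "partitions s t = {(n, p). p 0 = s \<and> p n = t \<and> (\<forall>l<n. p l < p (Suc l))}"

definition ennreal_powr :: "ennreal \<Rightarrow> real \<Rightarrow> ennreal" where
  "ennreal_powr v r = (if v = \<top> then \<top> else ennreal (enn2real v powr r))"

(* Values in the extended nonnegative reals, since the supremum may be infinite. *)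
definition d3 ::
    "real \<Rightarrow> (real \<Rightarrow> real \<Rightarrow> real) \<Rightarrow> (real \<Rightarrow> real \<Rightarrow> real) \<Rightarrow> real \<Rightarrow> real \<Rightarrow> ennreal" where
  "d3 q A A' s t =
     ennreal_powr
       (SUP (n, p) \<in> partitions s t.
          ennreal (\<Sum>l=1..n. \<bar>A (p (l - 1)) (p l) - A' (p (l - 1)) (p l)\<bar> powr (q / 3)))
       (3 / q)"

end

theory Submission
  imports Defs
begin

text \<open>Let \<open>f\<^sub>i\<close> be the \<open>i\<close>-th sample path, an analytic function on the upper half-plane, and let \<open>F\<^sub>i\<close> be a
primitive of it.  At height \<open>\<epsilon>\<close> put \<open>h\<^sub>i = 2 Re f\<^sub>i\<close> and \<open>k\<^sub>i = - 2 Im f\<^sub>i\<close>.  These are the horizontal and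
the vertical derivative of the harmonic function \<open>\<Gamma>\<^sub>i = 2 Re F\<^sub>i\<close>, whose restriction to the line of
height \<open>\<epsilon>\<close> is the approximation of the fractional Brownian motion, up to a constant.  The height \<open>\<epsilon>\<close>
is treated as a time, and the theorem follows from an estimate of the \<open>\<epsilon>\<close>-derivative of \<open>Vol\<close> that is
integrable at \<open>0\<close>.

The deterministic part rests on two integrations by parts.  The first, in the outer variable, gives
\<open>Vol\<^sub>s\<^sub>t = \<integral>\<^sub>s\<^sup>t h\<^sub>2(x) (\<Gamma>\<^sub>1(t) - \<Gamma>\<^sub>1(x)) (\<Gamma>\<^sub>3(x) - \<Gamma>\<^sub>3(s)) dx\<close>.  For the second, differentiate in \<open>\<epsilon>\<close>
and use that the \<open>\<epsilon>\<close>-derivative of \<open>h\<^sub>2\<close> is the \<open>x\<close>-derivative of \<open>k\<^sub>2\<close>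
(\<open>deformation_derivative\<close>).  Up to signs this leaves (\<open>vol_derivative\<close>)

  \<^item> terms \<open>k\<^sub>i \<cdot> Area\<close>, where \<open>k\<^sub>i\<close> is taken at an end point and \<open>Area\<close> is a second iterated integral,
    and

  \<^item> integrals of \<open>w\<^sub>1\<^sub>2(x) (\<Gamma>\<^sub>3(x) - \<Gamma>\<^sub>3(s))\<close> and of \<open>w\<^sub>2\<^sub>3(x) (\<Gamma>\<^sub>1(x) - \<Gamma>\<^sub>1(t))\<close>, where
    \<open>w\<^sub>i\<^sub>j = h\<^sub>i k\<^sub>j - k\<^sub>i h\<^sub>j\<close> is a multiple of the imaginary part of \<open>cnj f\<^sub>i \<cdot> f\<^sub>j\<close>.

The analytic products \<open>f\<^sub>i f\<^sub>j\<close> have cancelled.  They are harmless, because contours may be moved away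
from the real axis.  What remains is the interaction of an analytic with an antianalytic field.

Let \<open>1/4 < \<beta> < \<alpha>\<close>.  The probabilistic part supplies three almost sure bounds on bounded regions, the
last two for \<open>\<epsilon> \<le> \<eta>\<close> and \<open>\<epsilon> \<le> T = t - s\<close>:

  \<^item> \<open>f\<^sub>i\<close> grows at most like \<open>\<epsilon>\<close> to the power \<open>\<beta> - 1\<close> (\<open>field_sup_bound\<close>);

  \<^item> the integral of \<open>w\<^sub>i\<^sub>j\<close> over \<open>[s, t]\<close> is at most a multiple of \<open>T\<close> to the power \<open>\<beta> + 1/4\<close> times
    \<open>\<epsilon>\<close> to the power \<open>\<beta> - 5/4\<close> (\<open>pair_sup_bound\<close>);

  \<^item> the integral of \<open>w\<^sub>i\<^sub>j k\<^sub>l\<close>, with \<open>k\<^sub>l\<close> taken at height \<open>\<eta>\<close>, gains the further factor \<open>\<eta>\<close> to the power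
    \<open>\<beta> - 1\<close> (\<open>triple_sup_bound\<close>).

The field \<open>w\<^sub>i\<^sub>j\<close> itself has size \<open>\<epsilon>\<close> to the power \<open>2 \<beta> - 2\<close>, which is not integrable at \<open>0\<close> when
\<open>\<beta> \<le> 1/2\<close>.  The gain in the integral comes from independence: given the other fields, the integral is
Gaussian in the sample path of \<open>f\<^sub>i\<close>, and its variance is a double integral against a covariance that
decays away from the diagonal at the scale \<open>\<epsilon>\<close> (\<open>decoupled_moment\<close>, \<open>kernel_sum_le\<close>).  The exponent
\<open>\<beta> - 5/4\<close> is larger than \<open>-1\<close> exactly when \<open>\<beta> > 1/4\<close>, which is where the threshold on \<open>\<alpha>\<close> comes from.

With these bounds the \<open>\<epsilon>\<close>-derivative of \<open>Vol\<^sub>s\<^sub>t\<close> is at most a multiple of \<open>T\<close> to the power \<open>2 \<beta> + 1/4\<close>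
times \<open>\<epsilon>\<close> to the power \<open>\<beta> - 5/4\<close>, for \<open>\<epsilon> \<le> T\<close> (\<open>vol_growth\<close>).  Hence \<open>Vol\<close> has a limit, and together
with a crude estimate for \<open>\<epsilon> > T\<close> the distance to the limit is at most a multiple of \<open>\<epsilon>\<close> to the power
\<open>\<kappa>\<close> times \<open>T\<close> to the power \<open>3 \<beta> - \<kappa>\<close>, with a small \<open>\<kappa> > 0\<close> (\<open>vol_holder\<close>).  If \<open>\<beta> > 1/q\<close> the latter
exponent can be kept at least \<open>3/q\<close>, and summing the powers \<open>q/3\<close> over a partition then gives a
multiple of the length of the interval (\<open>d3_le\<close>).\<close>

section \<open>Fields on the upper half-plane and their primitives\<close>

text \<open>If \<open>f\<close> is the derivative of \<open>F\<close>, then \<open>re2 f\<close> and \<open>im2 f\<close> are the partial derivatives of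
\<open>re2 F\<close> in the horizontal and in the vertical direction.  The pair \<open>(re2, im2)\<close> is closed under
differentiation, since \<open>im2 f\<close> is \<open>re2\<close> of \<open>\<i> f\<close>.\<close>

definition re2 :: "(complex \<Rightarrow> complex) \<Rightarrow> real \<Rightarrow> real \<Rightarrow> real" where
  "re2 f x y = 2 * Re (f (Complex x y))"

definition im2 :: "(complex \<Rightarrow> complex) \<Rightarrow> real \<Rightarrow> real \<Rightarrow> real" where
  "im2 f x y = - 2 * Im (f (Complex x y))"

lemma open_upper_half_plane: "open upper_half_plane"
  unfolding upper_half_plane_def by (rule open_halfspace_Im_gt)

lemma convex_upper_half_plane: "convex upper_half_plane"
  unfolding upper_half_plane_def by (rule convex_halfspace_Im_gt)

lemma Complex_in_upper_half_plane [simp]: "Complex x y \<in> upper_half_plane \<longleftrightarrow> y > 0"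
  by (simp add: upper_half_plane_def)

lemma Complex_x_has_derivative: "((\<lambda>x. Complex x y) has_vector_derivative 1) (at x within S)"
proof -
  have "((\<lambda>x. of_real x + \<i> * of_real y) has_vector_derivative 1) (at x within S)"
    by (auto intro!: derivative_eq_intros)
  then show ?thesis by (simp add: Complex_eq)
qed

lemma Complex_y_has_derivative: "((\<lambda>y. Complex x y) has_vector_derivative \<i>) (at y within S)"
proof -
  have "((\<lambda>y. of_real x + \<i> * of_real y) has_vector_derivative \<i>) (at y within S)"
    by (auto intro!: derivative_eq_intros)
  then show ?thesis by (simp add: Complex_eq)
qed

lemma re2_x_derivative:
  assumes "(F has_field_derivative f (Complex x y)) (at (Complex x y))"
  shows "((\<lambda>x. re2 F x y) has_real_derivative re2 f x y) (at x within S)"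
proof -
  have "((F \<circ> (\<lambda>x. Complex x y)) has_vector_derivative 1 * f (Complex x y)) (at x within S)"
    using assms by (intro field_vector_diff_chain_within Complex_x_has_derivative)
      (auto intro: has_field_derivative_at_within)
  then have "((\<lambda>x. Re (F (Complex x y))) has_real_derivative Re (f (Complex x y))) (at x within S)"
    by (simp add: o_def has_vector_derivative_complex_iff)
  from DERIV_cmult[OF this, of "2"] show ?thesis
    by (simp add: re2_def im2_def)
qed

lemma im2_x_derivative:
  assumes "(F has_field_derivative f (Complex x y)) (at (Complex x y))"
  shows "((\<lambda>x. im2 F x y) has_real_derivative im2 f x y) (at x within S)"
proof -
  have "((F \<circ> (\<lambda>x. Complex x y)) has_vector_derivative 1 * f (Complex x y)) (at x within S)"
    using assms by (intro field_vector_diff_chain_within Complex_x_has_derivative)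
      (auto intro: has_field_derivative_at_within)
  then have "((\<lambda>x. Im (F (Complex x y))) has_real_derivative Im (f (Complex x y))) (at x within S)"
    by (simp add: o_def has_vector_derivative_complex_iff)
  from DERIV_cmult[OF this, of "- 2"] show ?thesis
    by (simp add: re2_def im2_def)
qed

lemma re2_y_derivative:
  assumes "(F has_field_derivative f (Complex x y)) (at (Complex x y))"
  shows "((\<lambda>y. re2 F x y) has_real_derivative im2 f x y) (at y within S)"
proof -
  have "((F \<circ> (\<lambda>y. Complex x y)) has_vector_derivative \<i> * f (Complex x y)) (at y within S)"
    using assms by (intro field_vector_diff_chain_within Complex_y_has_derivative)
      (auto intro: has_field_derivative_at_within)
  then have "((\<lambda>y. Re (F (Complex x y))) has_real_derivative - Im (f (Complex x y))) (at y within S)"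
    by (simp add: o_def has_vector_derivative_complex_iff)
  from DERIV_cmult[OF this, of "2"] show ?thesis
    by (simp add: re2_def im2_def)
qed

lemma continuous_on_re2:
  assumes "continuous_on upper_half_plane f" "continuous_on S u" "continuous_on S v"
    and "\<And>p. p \<in> S \<Longrightarrow> v p > 0"
  shows "continuous_on S (\<lambda>p. re2 f (u p) (v p))"
  unfolding re2_def
  by (intro continuous_intros continuous_on_compose2[OF assms(1)] assms) (auto simp: assms)

lemma continuous_on_im2:
  assumes "continuous_on upper_half_plane f" "continuous_on S u" "continuous_on S v"
    and "\<And>p. p \<in> S \<Longrightarrow> v p > 0"
  shows "continuous_on S (\<lambda>p. im2 f (u p) (v p))"
  unfolding im2_def
  by (intro continuous_intros continuous_on_compose2[OF assms(1)] assms) (auto simp: assms)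

lemma abs_re2_le: "\<bar>re2 f x y\<bar> \<le> 2 * norm (f (Complex x y))"
  unfolding re2_def using abs_Re_le_cmod[of "f (Complex x y)"] by simp

lemma abs_re2_diff_le:
  "\<bar>re2 f x y - re2 f x' y'\<bar> \<le> 2 * norm (f (Complex x y) - f (Complex x' y'))"
  using abs_Re_le_cmod[of "f (Complex x y) - f (Complex x' y')"] by (simp add: re2_def)

lemma abs_im2_le: "\<bar>im2 f x y\<bar> \<le> 2 * norm (f (Complex x y))"
  unfolding im2_def using abs_Im_le_cmod[of "f (Complex x y)"] by simp

lemma holomorphic_continuous_deriv:
  assumes "f holomorphic_on upper_half_plane"
  shows "continuous_on upper_half_plane (deriv f)"
  using assms holomorphic_deriv holomorphic_on_imp_continuous_on open_upper_half_plane by blast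

text \<open>The form in which all derivative bounds are integrated: a derivative of size \<open>y powr (p - 1)\<close> is
integrable at \<open>0\<close> for every \<open>p > 0\<close>, so bounds by a power that is larger than \<open>-1\<close> survive the limit.\<close>

lemma power_growth_vector:
  fixes g g' :: "real \<Rightarrow> 'a::real_normed_vector"
  assumes "0 < a" "a \<le> b" "0 < p"
    and g: "\<And>y. a \<le> y \<Longrightarrow> y \<le> b \<Longrightarrow> (g has_vector_derivative g' y) (at y)"
    and g': "\<And>y. a \<le> y \<Longrightarrow> y \<le> b \<Longrightarrow> norm (g' y) \<le> D * y powr (p - 1)"
  shows "norm (g b - g a) \<le> D / p * (b powr p - a powr p)"
proof (cases "a = b")
  case False
  then have "a < b" using assms by simp
  have cont: "continuous_on {a..b} g"
    using g by (intro continuous_at_imp_continuous_on)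
      (meson has_vector_derivative_continuous atLeastAtMost_iff)
  have "norm (g b - g a) \<le> D / p * b powr p - D / p * a powr p"
  proof (rule differentiable_bound_general[OF \<open>a < b\<close> cont])
    show "continuous_on {a..b} (\<lambda>y. D / p * y powr p)"
      using assms by (intro continuous_intros) auto
    show "(g has_vector_derivative g' x) (at x)" if "a < x" "x < b" for x
      using g[of x] that by simp
    show "((\<lambda>y. D / p * y powr p) has_vector_derivative D * x powr (p - 1)) (at x)"
      if "a < x" "x < b" for x
      unfolding has_real_derivative_iff_has_vector_derivative[symmetric]
      using assms that by (auto intro!: derivative_eq_intros)
    show "norm (g' x) \<le> D * x powr (p - 1)" if "a < x" "x < b" for x
      using g'[of x] that by simp
  qed
  then show ?thesis by (simp add: algebra_simps)
qed simp

lemma power_growth: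
  fixes g g' :: "real \<Rightarrow> real"
  assumes "0 < a" "a \<le> b" "0 < p"
    and "\<And>y. a \<le> y \<Longrightarrow> y \<le> b \<Longrightarrow> (g has_real_derivative g' y) (at y)"
    and "\<And>y. a \<le> y \<Longrightarrow> y \<le> b \<Longrightarrow> \<bar>g' y\<bar> \<le> D * y powr (p - 1)"
  shows "\<bar>g b - g a\<bar> \<le> D / p * (b powr p - a powr p)"
  using power_growth_vector[of a b p g g' D] assms
  by (simp add: has_real_derivative_iff_has_vector_derivative)

lemma primitive_vertical:
  assumes "0 < a" "a \<le> b" "0 < \<beta>"
    and "\<And>z. z \<in> upper_half_plane \<Longrightarrow> (F has_field_derivative f z) (at z)"
    and "\<And>y. a \<le> y \<Longrightarrow> y \<le> b \<Longrightarrow> norm (f (Complex x y)) \<le> C * y powr (\<beta> - 1)"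
  shows "norm (F (Complex x b) - F (Complex x a)) \<le> C / \<beta> * (b powr \<beta> - a powr \<beta>)"
proof (rule power_growth_vector)
  fix y assume y: "a \<le> y" "y \<le> b"
  have "((F \<circ> Complex x) has_vector_derivative \<i> * f (Complex x y)) (at y)"
    using assms(4)[of "Complex x y"] y assms(1)
    by (intro field_vector_diff_chain_within Complex_y_has_derivative)
       (auto intro: has_field_derivative_at_within)
  then show "((\<lambda>y. F (Complex x y)) has_vector_derivative \<i> * f (Complex x y)) (at y)"
    by (simp add: o_def)
qed (use assms in \<open>auto simp: norm_mult\<close>)

lemma primitive_horizontal:
  assumes "0 < y" "x \<in> {a..b}" "x' \<in> {a..b}"
    and "\<And>z. z \<in> upper_half_plane \<Longrightarrow> (F has_field_derivative f z) (at z)"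
    and "\<And>u. u \<in> {a..b} \<Longrightarrow> norm (f (Complex u y)) \<le> B"
  shows "norm (F (Complex x y) - F (Complex x' y)) \<le> B * \<bar>x - x'\<bar>"
proof -
  have "norm (F (Complex x y) - F (Complex x' y)) \<le> B * norm (Complex x y - Complex x' y)"
  proof (rule field_differentiable_bound[where f' = f])
    show "convex ((\<lambda>u. Complex u y) ` {a..b})"
    proof -
      have "(\<lambda>u. Complex u y) ` {a..b} = {z. Re z \<ge> a} \<inter> {z. Re z \<le> b} \<inter> {z. Im z \<ge> y} \<inter> {z. Im z \<le> y}"
        by (force simp: image_iff complex_eq_iff)
      then show ?thesis
        by (simp add: convex_Int convex_halfspace_Re_ge convex_halfspace_Re_le convex_halfspace_Im_ge convex_halfspace_Im_le)
    qed
  qed (use assms in \<open>auto intro: has_field_derivative_at_within\<close>)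
  also have "norm (Complex x y - Complex x' y) = \<bar>x - x'\<bar>"
    by (simp add: cmod_def)
  finally show ?thesis .
qed

text \<open>A primitive of a field of size \<open>y powr (\<beta> - 1)\<close> is Hoelder continuous of exponent \<open>\<beta>\<close> up to the real
axis.  Compare two points through the detour that goes up to height \<open>T\<close>, across, and down again:
the vertical parts are integrable, and on the horizontal part the field has size \<open>T powr (\<beta> - 1)\<close>.\<close>

lemma primitive_increment:
  assumes "0 < \<beta>" "0 \<le> C"
    and F: "\<And>z. z \<in> upper_half_plane \<Longrightarrow> (F has_field_derivative f z) (at z)"
    and f: "\<And>x y. x \<in> {a..b} \<Longrightarrow> 0 < y \<Longrightarrow> y \<le> T \<Longrightarrow> norm (f (Complex x y)) \<le> C * y powr (\<beta> - 1)"
    and x: "x \<in> {a..b}" "x' \<in> {a..b}" "\<bar>x - x'\<bar> \<le> T" and y: "0 < y" "y \<le> T" "0 < y'" "y' \<le> T"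
  shows "norm (F (Complex x y) - F (Complex x' y')) \<le> (2 * C / \<beta> + C) * T powr \<beta>"
proof -
  have v: "norm (F (Complex u T) - F (Complex u v)) \<le> C / \<beta> * T powr \<beta>"
    if "u \<in> {a..b}" "0 < v" "v \<le> T" for u v
  proof -
    have "norm (F (Complex u T) - F (Complex u v)) \<le> C / \<beta> * (T powr \<beta> - v powr \<beta>)"
      using that assms by (intro primitive_vertical[of _ _ _ F f]) auto
    also have "\<dots> \<le> C / \<beta> * T powr \<beta>"
      using assms by (intro mult_left_mono) auto
    finally show ?thesis .
  qed
  have "norm (F (Complex x T) - F (Complex x' T)) \<le> (C * T powr (\<beta> - 1)) * \<bar>x - x'\<bar>"
    using y by (intro primitive_horizontal[OF _ x(1,2) F f]) auto
  also have "\<dots> \<le> (C * T powr (\<beta> - 1)) * T"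
    using assms by (intro mult_left_mono) auto
  also have "\<dots> = C * T powr \<beta>"
    using y by (simp add: powr_diff)
  finally have h: "norm (F (Complex x T) - F (Complex x' T)) \<le> C * T powr \<beta>" .
  have "norm (F (Complex x y) - F (Complex x' y')) \<le> norm (F (Complex x T) - F (Complex x y))
      + norm (F (Complex x T) - F (Complex x' T)) + norm (F (Complex x' T) - F (Complex x' y'))"
    by norm
  also have "\<dots> \<le> C / \<beta> * T powr \<beta> + C * T powr \<beta> + C / \<beta> * T powr \<beta>"
    using v[OF x(1) y(1,2)] h v[OF x(2) y(3,4)] by linarith
  also have "\<dots> = (2 * C / \<beta> + C) * T powr \<beta>"
    by (simp add: algebra_simps)
  finally show ?thesis .
qed

text \<open>The Hoelder estimate makes the primitive a Cauchy sequence along the imaginary axis, and any other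
approach to \<open>0\<close> inside the half-plane has the same limit.\<close>

lemma primitive_boundary_value:
  assumes \<beta>: "0 < \<beta>" and F: "\<And>z. z \<in> upper_half_plane \<Longrightarrow> (F has_field_derivative f z) (at z)"
    and C: "0 \<le> C" "\<And>x y. \<bar>x\<bar> \<le> 1 \<Longrightarrow> 0 < y \<Longrightarrow> y \<le> 1 \<Longrightarrow> norm (f (Complex x y)) \<le> C * y powr (\<beta> - 1)"
  obtains l K where "\<And>z T. z \<in> upper_half_plane \<Longrightarrow> norm z \<le> T \<Longrightarrow> T \<le> 1 \<Longrightarrow> norm (F z - l) \<le> K * T powr \<beta>"
proof -
  define K where "K = 2 * C / \<beta> + C"
  have inc: "norm (F z - F w) \<le> K * T powr \<beta>"
    if "z \<in> upper_half_plane" "w \<in> upper_half_plane" "norm z \<le> T" "T \<le> 1" "Re w = 0" "Im w \<le> T" for z w T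
  proof -
    have "\<bar>Re z\<bar> \<le> T" "\<bar>Im z\<bar> \<le> T" using that abs_Re_le_cmod[of z] abs_Im_le_cmod[of z] by auto
    then have "norm (F (Complex (Re z) (Im z)) - F (Complex (Re w) (Im w))) \<le> K * T powr \<beta>"
      unfolding K_def using that \<beta> C by (intro primitive_increment[of \<beta> C F f "-1" 1] F) (auto simp: upper_half_plane_def)
    then show ?thesis by simp
  qed
  let ?e = "\<lambda>n. inverse (real (Suc n))"
  let ?w = "\<lambda>n. Complex 0 (?e n)"
  have elim: "?e \<longlonglongrightarrow> 0" by (rule LIMSEQ_inverse_real_of_nat)
  have e1: "0 < ?e n" "?e n \<le> 1" for n by (auto simp: inverse_le_1_iff)
  have blim: "(\<lambda>n. K * ?e n powr \<beta>) \<longlonglongrightarrow> 0"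
  proof -
    have "(\<lambda>n. K * ?e n powr \<beta>) \<longlonglongrightarrow> K * 0 powr \<beta>"
      using \<beta> e1 by (intro tendsto_mult tendsto_const tendsto_powr' elim) (auto simp: less_imp_le)
    then show ?thesis by simp
  qed
  have wz: "?w n \<in> upper_half_plane" "norm (?w n) = ?e n" for n using e1[of n] by (auto simp: cmod_def)
  have "Cauchy (\<lambda>n. F (?w n))"
  proof (rule CauchyI')
    fix e :: real assume "0 < e"
    then obtain N where N: "\<And>n. n \<ge> N \<Longrightarrow> \<bar>K * ?e n powr \<beta>\<bar> < e" using LIMSEQ_D[OF blim] by auto
    have "dist (F (?w m)) (F (?w n)) < e" if "m \<ge> N" "n > m" for m n
    proof -
      have "?e n \<le> ?e m" using that by (intro le_imp_inverse_le) auto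
      then have "norm (F (?w m) - F (?w n)) \<le> K * ?e m powr \<beta>"
        using wz e1 by (intro inc) auto
      then show ?thesis using N[OF that(1)] unfolding dist_norm by linarith
    qed
    then show "\<exists>N. \<forall>m\<ge>N. \<forall>n>m. dist (F (?w m)) (F (?w n)) < e" by blast
  qed
  then obtain l where l: "(\<lambda>n. F (?w n)) \<longlonglongrightarrow> l" using Cauchy_convergent_iff convergent_def by blast
  have "norm (F z - l) \<le> K * T powr \<beta>" if "z \<in> upper_half_plane" "norm z \<le> T" "T \<le> 1" for z T
  proof -
    have "0 < norm z" using that(1) by (auto simp: upper_half_plane_def)
    then have "eventually (\<lambda>n. ?e n < T) sequentially" using order_tendstoD(2)[OF elim, of T] that by linarith
    then have "eventually (\<lambda>n. norm (F z - F (?w n)) \<le> K * T powr \<beta>) sequentially"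
      by eventually_elim (use that wz in \<open>auto intro!: inc\<close>)
    moreover have "(\<lambda>n. norm (F z - F (?w n))) \<longlonglongrightarrow> norm (F z - l)" by (intro tendsto_intros l)
    ultimately show ?thesis by (intro tendsto_upperbound[of _ _ sequentially]) auto
  qed
  then show ?thesis using that by blast
qed

text \<open>The integrand may be unbounded near the initial point \<open>0\<close>.  The fundamental theorem of calculus only
asks for a primitive that is continuous on the closed segment, and the boundary value provides it.\<close>

lemma contour_integral_from_boundary:
  assumes \<beta>: "0 < \<beta>" and F: "\<And>z. z \<in> upper_half_plane \<Longrightarrow> (F has_field_derivative f z) (at z)"
    and l: "\<And>z T. z \<in> upper_half_plane \<Longrightarrow> norm z \<le> T \<Longrightarrow> T \<le> 1 \<Longrightarrow> norm (F z - l) \<le> K * T powr \<beta>"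
    and z: "z \<in> upper_half_plane"
  shows "contour_integral (linepath 0 z) f = F z - l"
proof -
  define G where "G r = (if r = 0 then l else F (r *\<^sub>R z))" for r :: real
  have rz: "r *\<^sub>R z \<in> upper_half_plane" if "0 < r" for r using that z by (simp add: upper_half_plane_def)
  have nz: "0 < norm z" using z by (auto simp: upper_half_plane_def)
  have dF: "((\<lambda>r. F (r *\<^sub>R z)) has_vector_derivative z * f (r *\<^sub>R z)) (at r)" if "0 < r" for r
  proof -
    have "((\<lambda>r. r *\<^sub>R z) has_vector_derivative z) (at r)" by (auto intro!: derivative_eq_intros)
    then have "((F \<circ> (\<lambda>r. r *\<^sub>R z)) has_vector_derivative z * f (r *\<^sub>R z)) (at r)"
      using F[OF rz[OF that]] by (intro field_vector_diff_chain_at)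
    then show ?thesis by (simp add: o_def)
  qed
  have dG: "(G has_vector_derivative z * f (r *\<^sub>R z)) (at r)" if "0 < r" for r
    using that by (intro has_vector_derivative_transform_within_open[OF dF[OF that], of "{0<..}"]) (auto simp: G_def)
  have "continuous (at r within {0..1}) G" if "r \<in> {0..1}" for r
  proof (cases "r = 0")
    case False
    then show ?thesis using dG[of r] that has_vector_derivative_continuous continuous_at_imp_continuous_at_within by fastforce
  next
    case True
    have "((\<lambda>r. G r - l) \<longlongrightarrow> 0) (at 0 within {0..1})"
    proof (rule Lim_null_comparison)
      have "eventually (\<lambda>r. r < 1 / norm z) (at 0 within {0..1})"
        using nz by (intro order_tendstoD(2)[of _ 0] tendsto_ident_at) auto
      moreover have "eventually (\<lambda>r. r \<in> {0..1} \<and> r \<noteq> 0) (at (0::real) within {0..1})"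
        unfolding eventually_at_filter by simp
      ultimately show "eventually (\<lambda>r. norm (G r - l) \<le> K * (r * norm z) powr \<beta>) (at 0 within {0..1})"
      proof eventually_elim
        case (elim r)
        then have "r * norm z \<le> 1" using nz by (simp add: field_simps)
        then show ?case using elim l[OF rz, of r "r * norm z"] by (auto simp: G_def)
      qed
      have "((\<lambda>r. K * (r * norm z) powr \<beta>) \<longlongrightarrow> K * (0 * norm z) powr \<beta>) (at 0 within {0..1})"
        using \<beta> by (intro tendsto_mult tendsto_const tendsto_powr' tendsto_ident_at)
          (auto simp: eventually_at_filter)
      then show "((\<lambda>r. K * (r * norm z) powr \<beta>) \<longlongrightarrow> 0) (at 0 within {0..1})" by simp
    qed
    then have "(G \<longlongrightarrow> l) (at 0 within {0..1})" by (rule LIM_zero_cancel)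
    moreover have "G 0 = l" by (simp add: G_def)
    ultimately show ?thesis using True by (simp add: continuous_within)
  qed
  then have cG: "continuous_on {0..1} G" by (simp add: continuous_on_eq_continuous_within)
  have "((\<lambda>r. z * f (r *\<^sub>R z)) has_integral (G 1 - G 0)) {0..1}"
    by (rule fundamental_theorem_of_calculus_interior[OF _ cG]) (use dG in auto)
  then have "(f has_contour_integral (F z - l)) (linepath 0 z)"
    unfolding has_contour_integral_linepath by (simp add: G_def linepath_def mult.commute)
  then show ?thesis by (rule contour_integral_unique)
qed

text \<open>Only the constant \<open>l\<close> depends on the behaviour at the origin, and it disappears in the derivative.\<close>

lemma Gamma_eps_deriv_eq:
  assumes \<beta>: "0 < \<beta>" and F: "\<And>z. z \<in> upper_half_plane \<Longrightarrow> (F has_field_derivative X z \<omega>) (at z)"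
    and C: "0 \<le> C" "\<And>x y. \<bar>x\<bar> \<le> 1 \<Longrightarrow> 0 < y \<Longrightarrow> y \<le> 1 \<Longrightarrow> norm (X (Complex x y) \<omega>) \<le> C * y powr (\<beta> - 1)"
    and \<epsilon>: "0 < \<epsilon>"
  shows "Gamma_eps_deriv X \<epsilon> \<omega> x = re2 (\<lambda>z. X z \<omega>) x \<epsilon>"
proof -
  obtain l K where l: "\<And>z T. z \<in> upper_half_plane \<Longrightarrow> norm z \<le> T \<Longrightarrow> T \<le> 1 \<Longrightarrow> norm (F z - l) \<le> K * T powr \<beta>"
    using primitive_boundary_value[OF \<beta> F C] by blast
  have "Gamma_eps X \<epsilon> \<omega> = (\<lambda>x. re2 F x \<epsilon> - 2 * Re l)"
    unfolding Gamma_eps_def Gamma_plus_def re2_def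
    using contour_integral_from_boundary[OF \<beta> F l] \<epsilon> by auto
  moreover have "((\<lambda>x. re2 F x \<epsilon> - 2 * Re l) has_real_derivative re2 (\<lambda>z. X z \<omega>) x \<epsilon>) (at x)"
    using DERIV_diff[OF re2_x_derivative DERIV_const, of F "\<lambda>z. X z \<omega>" x \<epsilon> "2 * Re l"] F \<epsilon> by auto
  ultimately show ?thesis unfolding Gamma_eps_deriv_def by (simp add: DERIV_imp_deriv)
qed

lemma primitives_exist:
  assumes "\<And>i. i \<in> I \<Longrightarrow> f i holomorphic_on upper_half_plane"
  obtains F where "\<And>i z. i \<in> I \<Longrightarrow> z \<in> upper_half_plane \<Longrightarrow> (F i has_field_derivative f i z) (at z)"
proof -
  have "\<exists>G. \<forall>z\<in>upper_half_plane. (G has_field_derivative f i z) (at z)" if i: "i \<in> I" for i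
  proof -
    obtain G where G: "\<And>z. z \<in> upper_half_plane \<Longrightarrow> (G has_field_derivative f i z) (at z within upper_half_plane)"
      using holomorphic_convex_primitive'[OF convex_upper_half_plane open_upper_half_plane assms[OF i]] by blast
    have "(G has_field_derivative f i z) (at z)" if z: "z \<in> upper_half_plane" for z
      using G[OF z] at_within_open[OF z open_upper_half_plane] by simp
    then show ?thesis by blast
  qed
  then have "\<forall>i\<in>I. \<exists>G. \<forall>z\<in>upper_half_plane. (G has_field_derivative f i z) (at z)" by blast
  from bchoice[OF this] obtain F where "\<forall>i\<in>I. \<forall>z\<in>upper_half_plane. (F i has_field_derivative f i z) (at z)"
    by blast
  then show ?thesis using that by blast
qed

section \<open>Integration by parts along the deformation\<close>

text \<open>Both \<open>re2 f\<close> and \<open>im2 f\<close> come from one analytic function, so the vertical derivative of \<open>re2 f\<close> equals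
the horizontal derivative of \<open>im2 f\<close>.  Integrating by parts moves the latter to \<open>B\<close>: no derivative
of the rough field \<open>f\<close> is left.\<close>

lemma deformation_derivative:
  fixes B Bx Be :: "real \<Rightarrow> real \<Rightarrow> real"
  assumes f: "f holomorphic_on upper_half_plane" and st: "s \<le> t" and y: "0 < y"
    and Bx: "\<And>x y. x \<in> {s..t} \<Longrightarrow> y > 0 \<Longrightarrow> ((\<lambda>x. B x y) has_real_derivative Bx x y) (at x)"
    and Be: "\<And>x y. x \<in> {s..t} \<Longrightarrow> y > 0 \<Longrightarrow> ((\<lambda>y. B x y) has_real_derivative Be x y) (at y)"
    and cB: "continuous_on ({0<..} \<times> {s..t}) (\<lambda>(y, x). B x y)"
    and cBx: "continuous_on ({0<..} \<times> {s..t}) (\<lambda>(y, x). Bx x y)"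
    and cBe: "continuous_on ({0<..} \<times> {s..t}) (\<lambda>(y, x). Be x y)"
  shows "((\<lambda>y. integral {s..t} (\<lambda>x. re2 f x y * B x y)) has_real_derivative
     (im2 f t y * B t y - im2 f s y * B s y
       + integral {s..t} (\<lambda>x. re2 f x y * Be x y - im2 f x y * Bx x y))) (at y)"
proof -
  have df: "(f has_field_derivative deriv f z) (at z)" if "z \<in> upper_half_plane" for z
    using f that open_upper_half_plane by (metis holomorphic_derivI)
  have cf: "continuous_on upper_half_plane f" using f by (rule holomorphic_on_imp_continuous_on)
  have cdf: "continuous_on upper_half_plane (deriv f)" using f by (rule holomorphic_continuous_deriv)
  note c = continuous_on_re2 continuous_on_im2
  have pair: "continuous_on {s..t} (Pair y)" for y :: real
    by (intro continuous_intros)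
  have slice: "continuous_on {s..t} (\<lambda>x. g x y)"
    if "continuous_on ({0<..} \<times> {s..t}) (\<lambda>(y, x). g x y)" "y > 0" for g :: "real \<Rightarrow> real \<Rightarrow> real" and y
    using continuous_on_compose2[OF that(1) pair[of y]] that(2) by auto
  have L: "((\<lambda>y. integral (cbox s t) (\<lambda>x. re2 f x y * B x y)) has_field_derivative
       integral (cbox s t) (\<lambda>x. im2 (deriv f) x y * B x y + re2 f x y * Be x y)) (at y within {0<..})"
  proof (rule leibniz_rule_field_derivative)
    fix y' x :: real assume "y' \<in> {0<..}" "x \<in> cbox s t"
    then show "((\<lambda>y. re2 f x y * B x y) has_real_derivative
         (im2 (deriv f) x y' * B x y' + re2 f x y' * Be x y')) (at y' within {0<..})"
      by (auto intro!: derivative_eq_intros re2_y_derivative df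
         has_field_derivative_at_within[OF Be] simp: algebra_simps)
  next
    fix y' :: real assume "y' \<in> {0<..}"
    then have "continuous_on {s..t} (\<lambda>x. re2 f x y' * B x y')"
      by (intro continuous_intros c[OF cf] slice[OF cB]) auto
    then show "(\<lambda>x. re2 f x y' * B x y') integrable_on cbox s t"
      using integrable_continuous_interval by simp
  next
    show "continuous_on ({0<..} \<times> cbox s t)
        (\<lambda>(y, x). im2 (deriv f) x y * B x y + re2 f x y * Be x y)"
      using cB cBe unfolding split_beta by (intro continuous_intros c[OF cf] c[OF cdf]) auto
  qed (use y in auto)
  have I1: "((\<lambda>x. im2 (deriv f) x y * B x y + im2 f x y * Bx x y) has_integral
       (im2 f t y * B t y - im2 f s y * B s y)) {s..t}"
    using st
  proof (rule fundamental_theorem_of_calculus)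
    fix x assume "x \<in> {s..t}"
    then show "((\<lambda>x. im2 f x y * B x y) has_vector_derivative
         im2 (deriv f) x y * B x y + im2 f x y * Bx x y) (at x within {s..t})"
      unfolding has_real_derivative_iff_has_vector_derivative[symmetric] using y
      by (auto intro!: derivative_eq_intros im2_x_derivative df
         has_field_derivative_at_within[OF Bx] simp: algebra_simps)
  qed
  have I2: "((\<lambda>x. re2 f x y * Be x y - im2 f x y * Bx x y) has_integral
      integral {s..t} (\<lambda>x. re2 f x y * Be x y - im2 f x y * Bx x y)) {s..t}"
    using y by (intro integrable_integral integrable_continuous_interval continuous_intros
       c[OF cf] slice[OF cBe] slice[OF cBx]) auto
  have "((\<lambda>x. im2 (deriv f) x y * B x y + re2 f x y * Be x y) has_integral
     (im2 f t y * B t y - im2 f s y * B s y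
       + integral {s..t} (\<lambda>x. re2 f x y * Be x y - im2 f x y * Bx x y))) {s..t}"
    using has_integral_add[OF I1 I2] by (simp add: algebra_simps)
  then show ?thesis
    using L y by (simp add: integral_unique at_within_open[of y "{0<..}"])
qed

text \<open>This is \<open>- 4 Im (cnj f \<cdot> g)\<close>, the part of the product of two fields that cannot be removed by moving
contours.\<close>

definition area_density :: "(complex \<Rightarrow> complex) \<Rightarrow> (complex \<Rightarrow> complex) \<Rightarrow> real \<Rightarrow> real \<Rightarrow> real" where
  "area_density f g x y = re2 f x y * im2 g x y - im2 f x y * re2 g x y"

definition indices :: "nat set" where "indices = {1, 2, 3}"

text \<open>The last index belongs to the field whose increment multiplies the area density of the first two;
only these two combinations occur in the derivative of the volume.\<close>

definition triples :: "(nat \<times> nat \<times> nat) set" where "triples = {(1, 2, 3), (2, 3, 1)}"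

lemma triples_indices: "(i, j, l) \<in> triples \<Longrightarrow> i \<in> indices \<and> j \<in> indices \<and> l \<in> indices"
  by (auto simp: triples_def indices_def)

text \<open>A highly oscillating weight \<open>w\<close> is only known through its integrals.  Integration by parts uses these
at the price of a derivative of the smooth factor.\<close>

lemma abs_integral_mult_le:
  fixes w g :: "real \<Rightarrow> real"
  assumes "s \<le> t" and w: "continuous_on {s..t} w"
    and g: "\<And>x. x \<in> {s..t} \<Longrightarrow> (g has_real_derivative g' x) (at x within {s..t})"
    and cg': "continuous_on {s..t} g'"
    and W: "\<And>x. x \<in> {s..t} \<Longrightarrow> \<bar>integral {s..x} w\<bar> \<le> B"
    and G: "\<And>x. x \<in> {s..t} \<Longrightarrow> \<bar>g' x\<bar> \<le> G" and g0: "\<bar>g t\<bar> \<le> g0"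
  shows "\<bar>integral {s..t} (\<lambda>x. w x * g x)\<bar> \<le> B * (g0 + G * (t - s))"
proof -
  let ?W = "\<lambda>x. integral {s..x} w"
  have B: "0 \<le> B" using W[of s] assms(1) by auto
  have dW: "(?W has_real_derivative w x) (at x within {s..t})" if "x \<in> {s..t}" for x
    using integral_has_real_derivative[OF w that] .
  have cW: "continuous_on {s..t} ?W"
    using dW by (meson DERIV_continuous continuous_on_eq_continuous_within)
  have cg: "continuous_on {s..t} g"
    using g by (meson DERIV_continuous continuous_on_eq_continuous_within)
  have I1: "((\<lambda>x. w x * g x + ?W x * g' x) has_integral (?W t * g t - ?W s * g s)) {s..t}"
    using assms(1)
    by (rule fundamental_theorem_of_calculus)
      (auto intro!: derivative_eq_intros dW g simp: has_real_derivative_iff_has_vector_derivative[symmetric])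
  have I2: "((\<lambda>x. ?W x * g' x) has_integral integral {s..t} (\<lambda>x. ?W x * g' x)) {s..t}"
    by (intro integrable_integral integrable_continuous_interval continuous_intros cW cg')
  have "((\<lambda>x. w x * g x) has_integral (?W t * g t - integral {s..t} (\<lambda>x. ?W x * g' x))) {s..t}"
    using has_integral_diff[OF I1 I2] by simp
  then have eq: "integral {s..t} (\<lambda>x. w x * g x) = ?W t * g t - integral {s..t} (\<lambda>x. ?W x * g' x)"
    by (rule integral_unique)
  have "norm (integral {s..t} (\<lambda>x. ?W x * g' x)) \<le> (B * G) * (t - s)"
    by (rule integral_bound) (auto simp: abs_mult assms(1) B intro!: mult_mono W G continuous_intros cW cg')
  moreover have "\<bar>?W t * g t\<bar> \<le> B * g0"
    using assms(1) B by (auto simp: abs_mult intro!: mult_mono W g0)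
  ultimately show ?thesis unfolding eq by (simp add: algebra_simps)
qed

text \<open>The last two assumptions are the bounds that independence provides.  The growth of the fields alone
bounds the area density by a multiple of \<open>\<epsilon> powr (2 * \<beta> - 2)\<close>; for \<open>\<beta> < 3/4\<close>, over an interval of
length \<open>T \<ge> \<epsilon>\<close>, the assumption improves on the resulting bound for the integral by the factor
\<open>(\<epsilon> / T) powr (3/4 - \<beta>)\<close>, up to a constant.\<close>

locale half_plane_fields =
  fixes f F :: "nat \<Rightarrow> complex \<Rightarrow> complex" and C \<beta> R :: real
  assumes \<beta>: "1/4 < \<beta>" "\<beta> < 1" and C: "0 \<le> C" and R: "0 < R"
    and hol: "i \<in> indices \<Longrightarrow> f i holomorphic_on upper_half_plane"
    and prim: "i \<in> indices \<Longrightarrow> z \<in> upper_half_plane \<Longrightarrow> (F i has_field_derivative f i z) (at z)"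
    and field_bound: "i \<in> indices \<Longrightarrow> \<bar>x\<bar> \<le> R \<Longrightarrow> 0 < y \<Longrightarrow> y \<le> 2 * R \<Longrightarrow>
        norm (f i (Complex x y)) \<le> C * y powr (\<beta> - 1)"
    and density_bound: "(i, j, l) \<in> triples \<Longrightarrow> - R \<le> s \<Longrightarrow> s \<le> t \<Longrightarrow> t \<le> R \<Longrightarrow>
        0 < \<epsilon> \<Longrightarrow> \<epsilon> \<le> 2 * R \<Longrightarrow>
        \<bar>integral {s..t} (\<lambda>x. area_density (f i) (f j) x \<epsilon>)\<bar>
          \<le> C * ((t - s + \<epsilon>) powr (\<beta> + 1/4) * \<epsilon> powr (\<beta> - 5/4))"
    and density_field_bound: "(i, j, l) \<in> triples \<Longrightarrow> - R \<le> s \<Longrightarrow> s \<le> t \<Longrightarrow> t \<le> R \<Longrightarrow>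
        0 < \<epsilon> \<Longrightarrow> \<epsilon> \<le> \<eta> \<Longrightarrow> \<eta> \<le> 2 * R \<Longrightarrow>
        \<bar>integral {s..t} (\<lambda>x. area_density (f i) (f j) x \<epsilon> * im2 (f l) x \<eta>)\<bar>
          \<le> C * ((t - s + \<epsilon>) powr (\<beta> + 1/4) * \<epsilon> powr (\<beta> - 5/4)) * \<eta> powr (\<beta> - 1)"
begin

lemma continuous_field: "i \<in> indices \<Longrightarrow> continuous_on upper_half_plane (f i)"
  using hol holomorphic_on_imp_continuous_on by blast

lemma continuous_primitive: "i \<in> indices \<Longrightarrow> continuous_on upper_half_plane (F i)"
  using prim by (meson DERIV_isCont continuous_at_imp_continuous_on)

lemmas continuous_rules = continuous_on_re2[OF continuous_field] continuous_on_im2[OF continuous_field] continuous_on_re2[OF continuous_primitive]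

lemma re2_bound:
  assumes "i \<in> indices" "\<bar>x\<bar> \<le> R" "0 < y" "y \<le> 2 * R"
  shows "\<bar>re2 (f i) x y\<bar> \<le> 2 * C * y powr (\<beta> - 1)"
  using abs_re2_le[of "f i" x y] field_bound[OF assms] by simp

lemma im2_bound:
  assumes "i \<in> indices" "\<bar>x\<bar> \<le> R" "0 < y" "y \<le> 2 * R"
  shows "\<bar>im2 (f i) x y\<bar> \<le> 2 * C * y powr (\<beta> - 1)"
  using abs_im2_le[of "f i" x y] field_bound[OF assms] by simp

lemma Gamma_horizontal:
  assumes "i \<in> indices" "\<bar>x\<bar> \<le> R" "\<bar>x'\<bar> \<le> R" "0 < y" "y \<le> 2 * R"
  shows "\<bar>re2 (F i) x y - re2 (F i) x' y\<bar> \<le> 2 * C * y powr (\<beta> - 1) * \<bar>x - x'\<bar>"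
proof -
  have "norm (F i (Complex x y) - F i (Complex x' y)) \<le> (C * y powr (\<beta> - 1)) * \<bar>x - x'\<bar>"
    using assms by (intro primitive_horizontal[of y x "-R" R x' "F i" "f i"] prim field_bound) auto
  then show ?thesis
    using abs_re2_diff_le[of "F i" x y x' y] by simp
qed

definition increment_const :: real where "increment_const = 4 * C / \<beta> + 2 * C"

lemma increment_const_nonneg: "0 \<le> increment_const"
  unfolding increment_const_def using C \<beta> by simp

lemma Gamma_increment:
  assumes "i \<in> indices" "\<bar>x\<bar> \<le> R" "\<bar>x'\<bar> \<le> R" "0 < \<epsilon>" "\<epsilon> \<le> T" "T \<le> 2 * R" "\<bar>x - x'\<bar> \<le> T"
  shows "\<bar>re2 (F i) x \<epsilon> - re2 (F i) x' \<epsilon>\<bar> \<le> increment_const * T powr \<beta>"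
proof -
  have "norm (F i (Complex x \<epsilon>) - F i (Complex x' \<epsilon>)) \<le> (2 * C / \<beta> + C) * T powr \<beta>"
    using assms \<beta> C by (intro primitive_increment[of \<beta> C "F i" "f i" "-R" R] prim field_bound) auto
  moreover have "increment_const * T powr \<beta> = 2 * ((2 * C / \<beta> + C) * T powr \<beta>)"
    by (simp add: increment_const_def algebra_simps)
  ultimately show ?thesis
    using abs_re2_diff_le[of "F i" x \<epsilon> x' \<epsilon>] by linarith
qed

lemma length_plus_height_powr_le:
  assumes "0 \<le> u" "u \<le> T" "0 < \<epsilon>" "\<epsilon> \<le> T"
  shows "(u + \<epsilon>) powr (\<beta> + 1/4) \<le> 4 * T powr (\<beta> + 1/4)"
proof -
  have "(u + \<epsilon>) powr (\<beta> + 1/4) \<le> (2 * T) powr (\<beta> + 1/4)"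
    using assms \<beta> by (intro powr_mono2) auto
  also have "\<dots> = 2 powr (\<beta> + 1/4) * T powr (\<beta> + 1/4)"
    using assms by (simp add: powr_mult)
  also have "2 powr (\<beta> + 1/4) \<le> 2 powr (2::real)"
    using \<beta> by (intro powr_mono) auto
  finally show ?thesis by (simp add: mult_right_mono)
qed

lemma density_bound_scale:
  assumes "(i, j, l) \<in> triples" "- R \<le> s" "s \<le> x" "x \<le> R" "0 < \<epsilon>" "\<epsilon> \<le> T" "x - s \<le> T" "T \<le> 2 * R"
  shows "\<bar>integral {s..x} (\<lambda>x. area_density (f i) (f j) x \<epsilon>)\<bar>
    \<le> 4 * C * (T powr (\<beta> + 1/4) * \<epsilon> powr (\<beta> - 5/4))"
proof -
  have "\<bar>integral {s..x} (\<lambda>x. area_density (f i) (f j) x \<epsilon>)\<bar>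
      \<le> C * ((x - s + \<epsilon>) powr (\<beta> + 1/4) * \<epsilon> powr (\<beta> - 5/4))"
    using assms by (intro density_bound[where l=l]) auto
  also have "\<dots> \<le> C * ((4 * T powr (\<beta> + 1/4)) * \<epsilon> powr (\<beta> - 5/4))"
    using assms C by (intro mult_left_mono mult_right_mono length_plus_height_powr_le) auto
  finally show ?thesis by (simp add: algebra_simps)
qed

lemma density_field_bound_scale:
  assumes "(i, j, l) \<in> triples" "- R \<le> s" "s \<le> t" "t \<le> R" "0 < \<epsilon>" "\<epsilon> \<le> \<eta>" "\<eta> \<le> T"
    "t - s \<le> T" "T \<le> 2 * R"
  shows "\<bar>integral {s..t} (\<lambda>x. area_density (f i) (f j) x \<epsilon> * im2 (f l) x \<eta>)\<bar>
    \<le> 4 * C * (T powr (\<beta> + 1/4) * \<epsilon> powr (\<beta> - 5/4)) * \<eta> powr (\<beta> - 1)"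
proof -
  have "\<bar>integral {s..t} (\<lambda>x. area_density (f i) (f j) x \<epsilon> * im2 (f l) x \<eta>)\<bar>
      \<le> C * ((t - s + \<epsilon>) powr (\<beta> + 1/4) * \<epsilon> powr (\<beta> - 5/4)) * \<eta> powr (\<beta> - 1)"
    using assms by (intro density_field_bound) auto
  also have "\<dots> \<le> C * ((4 * T powr (\<beta> + 1/4)) * \<epsilon> powr (\<beta> - 5/4)) * \<eta> powr (\<beta> - 1)"
    using assms C by (intro mult_left_mono mult_right_mono length_plus_height_powr_le) auto
  finally show ?thesis by (simp add: algebra_simps)
qed

lemma continuous_area_density: "i \<in> indices \<Longrightarrow> j \<in> indices \<Longrightarrow> continuous_on S u \<Longrightarrow> continuous_on S v \<Longrightarrow>
    (\<And>p. p \<in> S \<Longrightarrow> v p > 0) \<Longrightarrow> continuous_on S (\<lambda>p. area_density (f i) (f j) (u p) (v p))"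
  unfolding area_density_def by (intro continuous_intros continuous_rules) auto

definition density_const :: real where "density_const = (4 * C + 8 * C\<^sup>2) / \<beta> + 4 * C * (increment_const + 2 * C)"

text \<open>Young integration of the increment against the area density needs Hoelder exponents whose sum exceeds
\<open>1\<close>, which fails for \<open>\<beta>\<close> near \<open>1/4\<close>.  Instead the increment is deformed to height \<open>T\<close> while the area density stays at height \<open>\<epsilon>\<close>.  The
derivative in the height \<open>\<eta>\<close> of the increment is a triple product, controlled by assumption, and at
height \<open>T\<close> the increment is smooth enough for an integration by parts.\<close>

lemma density_increment_bound:
  assumes ijl: "(i, j, l) \<in> triples" and st: "- R \<le> s" "s < t" "t \<le> R"
    and T: "T = t - s" and \<epsilon>: "0 < \<epsilon>" "\<epsilon> \<le> T" and r: "r \<in> {s..t}"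
  shows "\<bar>integral {s..t} (\<lambda>x. area_density (f i) (f j) x \<epsilon> * (re2 (F l) x \<epsilon> - re2 (F l) r \<epsilon>))\<bar>
    \<le> density_const * (T powr (2 * \<beta> + 1/4) * \<epsilon> powr (\<beta> - 5/4))"
proof -
  have idx: "i \<in> indices" "j \<in> indices" "l \<in> indices" using triples_indices[OF ijl] by auto
  let ?w = "\<lambda>x. area_density (f i) (f j) x \<epsilon>"
  let ?\<psi> = "\<lambda>\<eta>. integral {s..t} (\<lambda>x. ?w x * (re2 (F l) x \<eta> - re2 (F l) r \<eta>))"
  define Q where "Q = T powr (\<beta> + 1/4) * \<epsilon> powr (\<beta> - 5/4)"
  have Q: "0 \<le> Q" unfolding Q_def by simp
  have T0: "0 < T" "T \<le> 2 * R" using st T by auto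
  have rR: "\<bar>r\<bar> \<le> R" using r st by auto
  let ?\<psi>' = "\<lambda>\<eta>. integral {s..t} (\<lambda>x. ?w x * im2 (f l) x \<eta>) - im2 (f l) r \<eta> * integral {s..t} ?w"
  have cw: "continuous_on {s..t} ?w"
    using idx \<epsilon> by (intro continuous_area_density continuous_intros) auto
  have deriv: "(?\<psi> has_real_derivative ?\<psi>' \<eta>) (at \<eta>)" if "0 < \<eta>" for \<eta>
  proof -
    have "((\<lambda>y. integral (cbox s t) (\<lambda>x. ?w x * (re2 (F l) x y - re2 (F l) r y))) has_field_derivative
       integral (cbox s t) (\<lambda>x. ?w x * (im2 (f l) x \<eta> - im2 (f l) r \<eta>))) (at \<eta> within {0<..})"
    proof (rule leibniz_rule_field_derivative)
      fix y x :: real assume "y \<in> {0<..}" "x \<in> cbox s t"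
      then show "((\<lambda>y. ?w x * (re2 (F l) x y - re2 (F l) r y)) has_real_derivative
          ?w x * (im2 (f l) x y - im2 (f l) r y)) (at y within {0<..})"
        using idx by (intro DERIV_cmult DERIV_diff re2_y_derivative prim) auto
    next
      fix y :: real assume "y \<in> {0<..}"
      then have "continuous_on {s..t} (\<lambda>x. ?w x * (re2 (F l) x y - re2 (F l) r y))"
        using idx by (intro continuous_intros cw continuous_rules) auto
      then show "(\<lambda>x. ?w x * (re2 (F l) x y - re2 (F l) r y)) integrable_on cbox s t"
        using integrable_continuous_interval by simp
    next
      show "continuous_on ({0<..} \<times> cbox s t) (\<lambda>(y, x). ?w x * (im2 (f l) x y - im2 (f l) r y))"
        unfolding split_beta using idx \<epsilon> by (intro continuous_intros continuous_area_density continuous_rules) auto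
    qed (use that in auto)
    moreover have "integral {s..t} (\<lambda>x. ?w x * (im2 (f l) x \<eta> - im2 (f l) r \<eta>)) = ?\<psi>' \<eta>"
    proof -
      have "integral {s..t} (\<lambda>x. ?w x * im2 (f l) x \<eta> - im2 (f l) r \<eta> * ?w x)
          = integral {s..t} (\<lambda>x. ?w x * im2 (f l) x \<eta>) - integral {s..t} (\<lambda>x. im2 (f l) r \<eta> * ?w x)"
        using idx that \<epsilon>
        by (intro integral_diff integrable_continuous_interval continuous_intros continuous_area_density continuous_rules) auto
      then show ?thesis by (simp add: algebra_simps)
    qed
    ultimately show ?thesis
      using that by (simp add: at_within_open[of \<eta> "{0<..}"])
  qed
  have bound: "\<bar>?\<psi>' \<eta>\<bar> \<le> ((4 * C + 8 * C\<^sup>2) * Q) * \<eta> powr (\<beta> - 1)" if "\<epsilon> \<le> \<eta>" "\<eta> \<le> T" for \<eta>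
  proof -
    have "\<bar>integral {s..t} (\<lambda>x. ?w x * im2 (f l) x \<eta>)\<bar> \<le> 4 * C * Q * \<eta> powr (\<beta> - 1)"
      unfolding Q_def using ijl st \<epsilon> that T T0 by (intro density_field_bound_scale) auto
    moreover have "\<bar>im2 (f l) r \<eta> * integral {s..t} ?w\<bar> \<le> (2 * C * \<eta> powr (\<beta> - 1)) * (4 * C * Q)"
      unfolding abs_mult Q_def using ijl idx st \<epsilon> that T T0 rR C
      by (intro mult_mono im2_bound density_bound_scale[where l=l]) auto
    ultimately show ?thesis
      by (simp add: algebra_simps power2_eq_square)
  qed
  have "\<bar>?\<psi> T - ?\<psi> \<epsilon>\<bar> \<le> ((4 * C + 8 * C\<^sup>2) * Q) / \<beta> * (T powr \<beta> - \<epsilon> powr \<beta>)"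
    using \<epsilon> \<beta> by (intro power_growth[where g' = ?\<psi>'] deriv bound) auto
  also have "\<dots> \<le> ((4 * C + 8 * C\<^sup>2) * Q) / \<beta> * T powr \<beta>"
    using C \<beta> Q by (intro mult_left_mono) auto
  finally have 1: "\<bar>?\<psi> T - ?\<psi> \<epsilon>\<bar> \<le> (4 * C + 8 * C\<^sup>2) / \<beta> * (Q * T powr \<beta>)"
    by (simp add: algebra_simps)
  have "\<bar>?\<psi> T\<bar> \<le> (4 * C * Q) * (increment_const * T powr \<beta> + (2 * C * T powr (\<beta> - 1)) * (t - s))"
  proof (rule abs_integral_mult_le)
    show "((\<lambda>x. re2 (F l) x T - re2 (F l) r T) has_real_derivative re2 (f l) x T) (at x within {s..t})"
      if "x \<in> {s..t}" for x
      using DERIV_diff[OF re2_x_derivative DERIV_const, of "F l" "f l" x T "re2 (F l) r T"] prim idx T0 by auto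
    show "continuous_on {s..t} (\<lambda>x. re2 (f l) x T)"
      using idx T0 by (intro continuous_rules continuous_intros) auto
    show "\<bar>integral {s..x} ?w\<bar> \<le> 4 * C * Q" if "x \<in> {s..t}" for x
      unfolding Q_def using ijl st \<epsilon> that T T0 by (intro density_bound_scale[where l=l]) auto
    show "\<bar>re2 (f l) x T\<bar> \<le> 2 * C * T powr (\<beta> - 1)" if "x \<in> {s..t}" for x
      using idx st that T0 by (intro re2_bound) auto
    show "\<bar>re2 (F l) t T - re2 (F l) r T\<bar> \<le> increment_const * T powr \<beta>"
      using idx st r rR T T0 by (intro Gamma_increment) auto
  qed (use st cw in auto)
  also have "(2 * C * T powr (\<beta> - 1)) * (t - s) = 2 * C * T powr \<beta>"
    using T T0 by (simp add: powr_diff)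
  finally have 2: "\<bar>?\<psi> T\<bar> \<le> (4 * C * (increment_const + 2 * C)) * (Q * T powr \<beta>)"
    by (simp add: algebra_simps)
  have "\<bar>?\<psi> \<epsilon>\<bar> \<le> (4 * C + 8 * C\<^sup>2) / \<beta> * (Q * T powr \<beta>) + (4 * C * (increment_const + 2 * C)) * (Q * T powr \<beta>)"
    using 1 2 by linarith
  also have "\<dots> = density_const * (Q * T powr \<beta>)"
    unfolding density_const_def by (simp add: algebra_simps)
  also have "Q * T powr \<beta> = T powr (2 * \<beta> + 1/4) * \<epsilon> powr (\<beta> - 5/4)"
    unfolding Q_def using powr_add[of T "\<beta> + 1/4" \<beta>] by (simp add: algebra_simps)
  finally show ?thesis .
qed

text \<open>A factor \<open>\<epsilon> powr (1/4)\<close> is replaced by \<open>T powr (1/4)\<close>, which brings all terms to the same form.\<close>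

lemma trade_height_for_length:
  assumes "0 < \<epsilon>" "\<epsilon> \<le> T"
  shows "T powr a * \<epsilon> powr (\<beta> - 1) \<le> T powr (a + 1/4) * \<epsilon> powr (\<beta> - 5/4)"
proof -
  have "\<epsilon> powr (\<beta> - 1) = \<epsilon> powr (1/4) * \<epsilon> powr (\<beta> - 5/4)"
    by (simp add: powr_add[symmetric])
  also have "\<dots> \<le> T powr (1/4) * \<epsilon> powr (\<beta> - 5/4)"
    using assms by (intro mult_right_mono powr_mono2) auto
  finally have "T powr a * \<epsilon> powr (\<beta> - 1) \<le> T powr a * (T powr (1/4) * \<epsilon> powr (\<beta> - 5/4))"
    by (rule mult_left_mono) simp
  then show ?thesis by (simp add: powr_add)
qed

text \<open>The second iterated integral of the components \<open>2\<close> and \<open>l\<close>; it is anchored at \<open>s\<close> when component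
\<open>l\<close> is the inner one, and, up to sign, at \<open>t\<close> when it is the outer one.\<close>

definition area :: "nat \<Rightarrow> real \<Rightarrow> real \<Rightarrow> real \<Rightarrow> real \<Rightarrow> real" where
  "area l r s t y = integral {s..t} (\<lambda>x. re2 (f 2) x y * (re2 (F l) x y - re2 (F l) r y))"

text \<open>The volume after integration by parts in the outer variable: a single integral, in which the outer
and the inner component enter only through their increments.\<close>

definition vol :: "real \<Rightarrow> real \<Rightarrow> real \<Rightarrow> real" where
  "vol y s t = integral {s..t} (\<lambda>x. re2 (f 2) x y *
     ((re2 (F 1) t y - re2 (F 1) x y) * (re2 (F 3) x y - re2 (F 3) s y)))"

definition area_const :: real where "area_const = (6 * C * increment_const + 4 * C) / (\<beta> - 1/4) + 2 * C * increment_const"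

lemma indices_members: "1 \<in> indices" "Suc 0 \<in> indices" "2 \<in> indices" "3 \<in> indices"
  by (auto simp: indices_def)

lemma area_derivative:
  assumes l: "l \<in> indices" and "s \<le> t" "0 < y"
  shows "(area l r s t has_real_derivative
     (im2 (f 2) t y * (re2 (F l) t y - re2 (F l) r y) - im2 (f 2) s y * (re2 (F l) s y - re2 (F l) r y)
       + (integral {s..t} (\<lambda>x. area_density (f 2) (f l) x y)
            - im2 (f l) r y * (re2 (F 2) t y - re2 (F 2) s y)))) (at y)"
proof -
  have D: "((\<lambda>y. integral {s..t} (\<lambda>x. re2 (f 2) x y * (re2 (F l) x y - re2 (F l) r y))) has_real_derivative
     (im2 (f 2) t y * (re2 (F l) t y - re2 (F l) r y) - im2 (f 2) s y * (re2 (F l) s y - re2 (F l) r y)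
       + integral {s..t} (\<lambda>x. re2 (f 2) x y * (im2 (f l) x y - im2 (f l) r y) - im2 (f 2) x y * re2 (f l) x y))) (at y)"
  proof (rule deformation_derivative)
    show "((\<lambda>x. re2 (F l) x y - re2 (F l) r y) has_real_derivative re2 (f l) x y) (at x)" if "0 < y" for x y
      using DERIV_diff[OF re2_x_derivative DERIV_const, of "F l" "f l" x y "re2 (F l) r y"] prim l that by auto
    show "((\<lambda>y. re2 (F l) x y - re2 (F l) r y) has_real_derivative im2 (f l) x y - im2 (f l) r y) (at y)"
      if "0 < y" for x y
      using prim l that by (intro DERIV_diff re2_y_derivative) auto
  qed (use assms indices_members in \<open>auto simp: split_beta intro!: hol continuous_intros continuous_rules\<close>)
  have h2: "((\<lambda>x. re2 (f 2) x y) has_integral (re2 (F 2) t y - re2 (F 2) s y)) {s..t}"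
    using assms indices_members
    by (intro fundamental_theorem_of_calculus)
      (auto simp: has_real_derivative_iff_has_vector_derivative[symmetric] intro!: re2_x_derivative prim)
  have ar: "((\<lambda>x. area_density (f 2) (f l) x y) has_integral integral {s..t} (\<lambda>x. area_density (f 2) (f l) x y)) {s..t}"
    using assms indices_members by (intro integrable_integral integrable_continuous_interval continuous_area_density continuous_intros) auto
  have "integral {s..t} (\<lambda>x. re2 (f 2) x y * (im2 (f l) x y - im2 (f l) r y) - im2 (f 2) x y * re2 (f l) x y)
     = integral {s..t} (\<lambda>x. area_density (f 2) (f l) x y) - im2 (f l) r y * (re2 (F 2) t y - re2 (F 2) s y)"
    using integral_unique[OF has_integral_diff[OF ar has_integral_mult_right[OF h2, of "im2 (f l) r y"]]]
    by (simp add: area_density_def algebra_simps)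
  then show ?thesis using D unfolding area_def[abs_def] by simp
qed

text \<open>At height \<open>T\<close> the bound is trivial; going down to height \<open>\<epsilon>\<close> costs an integrable derivative.\<close>

lemma area_bound:
  assumes l: "l \<in> {1, 3}" and st: "- R \<le> s" "s < t" "t \<le> R"
    and T: "T = t - s" and \<epsilon>: "0 < \<epsilon>" "\<epsilon> \<le> T" and r: "r \<in> {s..t}"
  shows "\<bar>area l r s t \<epsilon>\<bar> \<le> area_const * T powr (2 * \<beta>)"
proof -
  have l': "l \<in> indices" using l by (auto simp: indices_def)
  have T0: "0 < T" "T \<le> 2 * R" using st T by auto
  have rR: "\<bar>r\<bar> \<le> R" using r st by auto
  define g' where "g' y = im2 (f 2) t y * (re2 (F l) t y - re2 (F l) r y)
      - im2 (f 2) s y * (re2 (F l) s y - re2 (F l) r y)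
      + (integral {s..t} (\<lambda>x. area_density (f 2) (f l) x y)
            - im2 (f l) r y * (re2 (F 2) t y - re2 (F 2) s y))" for y
  have bound: "\<bar>g' y\<bar> \<le> ((6 * C * increment_const + 4 * C) * T powr (\<beta> + 1/4)) * y powr (\<beta> - 1/4 - 1)"
    if y: "\<epsilon> \<le> y" "y \<le> T" for y
  proof -
    have y0: "0 < y" "y \<le> 2 * R" using \<epsilon> y T0 by auto
    have prod: "\<bar>im2 (f i) p y * (re2 (F j) u y - re2 (F j) v y)\<bar>
        \<le> 2 * C * increment_const * (T powr (\<beta> + 1/4) * y powr (\<beta> - 5/4))"
      if "i \<in> indices" "j \<in> indices" "p \<in> {s..t}" "u \<in> {s..t}" "v \<in> {s..t}" for i j p u v
    proof -
      have "\<bar>im2 (f i) p y * (re2 (F j) u y - re2 (F j) v y)\<bar> \<le> (2 * C * y powr (\<beta> - 1)) * (increment_const * T powr \<beta>)"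
        unfolding abs_mult using that st y y0 T0 T C increment_const_nonneg by (intro mult_mono im2_bound Gamma_increment) auto
      also have "\<dots> = 2 * C * increment_const * (T powr \<beta> * y powr (\<beta> - 1))" by simp
      also have "\<dots> \<le> 2 * C * increment_const * (T powr (\<beta> + 1/4) * y powr (\<beta> - 5/4))"
        using C increment_const_nonneg y0 y by (intro mult_left_mono trade_height_for_length) auto
      finally show ?thesis .
    qed
    have "\<bar>integral {s..t} (\<lambda>x. area_density (f 2) (f l) x y)\<bar> \<le> 4 * C * (T powr (\<beta> + 1/4) * y powr (\<beta> - 5/4))"
    proof (cases "l = 3")
      case True
      then show ?thesis
        using st y y0 T T0 by (intro density_bound_scale[where l = 1]) (auto simp: triples_def)
    next
      case False
      then have l1: "l = 1" using l by auto
      have "\<bar>integral {s..t} (\<lambda>x. area_density (f 1) (f 2) x y)\<bar> \<le> 4 * C * (T powr (\<beta> + 1/4) * y powr (\<beta> - 5/4))"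
        using st y y0 T T0 by (intro density_bound_scale[where l = 3]) (auto simp: triples_def)
      moreover have "(\<lambda>x. area_density (f 2) (f l) x y) = (\<lambda>x. - area_density (f 1) (f 2) x y)"
        unfolding l1 by (simp add: area_density_def algebra_simps)
      ultimately show ?thesis by simp
    qed
    moreover have "\<bar>im2 (f 2) t y * (re2 (F l) t y - re2 (F l) r y)\<bar> \<le> 2 * C * increment_const * (T powr (\<beta> + 1/4) * y powr (\<beta> - 5/4))"
      "\<bar>im2 (f 2) s y * (re2 (F l) s y - re2 (F l) r y)\<bar> \<le> 2 * C * increment_const * (T powr (\<beta> + 1/4) * y powr (\<beta> - 5/4))"
      "\<bar>im2 (f l) r y * (re2 (F 2) t y - re2 (F 2) s y)\<bar> \<le> 2 * C * increment_const * (T powr (\<beta> + 1/4) * y powr (\<beta> - 5/4))"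
      using st r l' indices_members by (auto intro!: prod)
    ultimately have "\<bar>g' y\<bar> \<le> 3 * (2 * C * increment_const * (T powr (\<beta> + 1/4) * y powr (\<beta> - 5/4)))
        + 4 * C * (T powr (\<beta> + 1/4) * y powr (\<beta> - 5/4))"
      unfolding g'_def by linarith
    then show ?thesis by (simp add: algebra_simps)
  qed
  have "\<bar>area l r s t T - area l r s t \<epsilon>\<bar>
     \<le> ((6 * C * increment_const + 4 * C) * T powr (\<beta> + 1/4)) / (\<beta> - 1/4) * (T powr (\<beta> - 1/4) - \<epsilon> powr (\<beta> - 1/4))"
    using \<epsilon> \<beta> st l' unfolding g'_def[abs_def]
    by (intro power_growth[where g' = g'] bound) (auto simp: g'_def intro!: area_derivative)
  also have "\<dots> \<le> ((6 * C * increment_const + 4 * C) * T powr (\<beta> + 1/4)) / (\<beta> - 1/4) * T powr (\<beta> - 1/4)"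
    using C \<beta> increment_const_nonneg by (intro mult_left_mono) auto
  also have "\<dots> = (6 * C * increment_const + 4 * C) / (\<beta> - 1/4) * (T powr (\<beta> + 1/4) * T powr (\<beta> - 1/4))"
    by simp
  also have "T powr (\<beta> + 1/4) * T powr (\<beta> - 1/4) = T powr (2 * \<beta>)"
    by (simp add: powr_add[symmetric])
  finally have 1: "\<bar>area l r s t T - area l r s t \<epsilon>\<bar> \<le> (6 * C * increment_const + 4 * C) / (\<beta> - 1/4) * T powr (2 * \<beta>)" .
  have "norm (integral {s..t} (\<lambda>x. re2 (f 2) x T * (re2 (F l) x T - re2 (F l) r T)))
      \<le> ((2 * C * T powr (\<beta> - 1)) * (increment_const * T powr \<beta>)) * (t - s)"
    using st T0 T indices_members l' rR r C
    by (intro integral_bound) (auto simp: abs_mult intro!: mult_mono re2_bound Gamma_increment continuous_intros continuous_rules)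
  also have "\<dots> = 2 * C * increment_const * (T powr (\<beta> - 1) * T powr \<beta> * T powr 1)"
    using T T0 by simp
  also have "T powr (\<beta> - 1) * T powr \<beta> * T powr 1 = T powr (2 * \<beta>)"
    by (simp only: powr_add[symmetric]) simp
  finally have 2: "\<bar>area l r s t T\<bar> \<le> 2 * C * increment_const * T powr (2 * \<beta>)" by (simp add: area_def)
  show ?thesis using 1 2 unfolding area_const_def by (simp add: algebra_simps)
qed

lemma area_const_nonneg: "0 \<le> area_const"
  unfolding area_const_def using C increment_const_nonneg \<beta> by simp

text \<open>The product of the two increments vanishes at both ends, so there are no boundary terms.  In the
remaining integrand the increments at \<open>x\<close> are multiplied by area densities, while the vertical
derivatives at the fixed points \<open>t\<close> and \<open>s\<close> come out of the integral and leave areas behind.\<close>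

lemma vol_derivative:
  assumes "s \<le> t" "0 < y"
  shows "((\<lambda>y. vol y s t) has_real_derivative
     (im2 (f 1) t y * area 3 s s t y + im2 (f 3) s y * area 1 t s t y
       + integral {s..t} (\<lambda>x. area_density (f 1) (f 2) x y * (re2 (F 3) x y - re2 (F 3) s y))
       - integral {s..t} (\<lambda>x. area_density (f 2) (f 3) x y * (re2 (F 1) x y - re2 (F 1) t y)))) (at y)"
proof -
  let ?G1 = "\<lambda>x y. re2 (F 1) t y - re2 (F 1) x y" and ?G3 = "\<lambda>x y. re2 (F 3) x y - re2 (F 3) s y"
  let ?Bx = "\<lambda>x y. - re2 (f 1) x y * ?G3 x y + ?G1 x y * re2 (f 3) x y"
  let ?Be = "\<lambda>x y. (im2 (f 1) t y - im2 (f 1) x y) * ?G3 x y + ?G1 x y * (im2 (f 3) x y - im2 (f 3) s y)"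
  have D: "((\<lambda>y. integral {s..t} (\<lambda>x. re2 (f 2) x y * (?G1 x y * ?G3 x y))) has_real_derivative
     (im2 (f 2) t y * (?G1 t y * ?G3 t y) - im2 (f 2) s y * (?G1 s y * ?G3 s y)
       + integral {s..t} (\<lambda>x. re2 (f 2) x y * ?Be x y - im2 (f 2) x y * ?Bx x y))) (at y)"
  proof (rule deformation_derivative)
    fix x y :: real assume "0 < y"
    have G1: "((\<lambda>x. ?G1 x y) has_real_derivative - re2 (f 1) x y) (at x)"
      using DERIV_diff[OF DERIV_const re2_x_derivative, of "F 1" "f 1" x y "re2 (F 1) t y"] prim indices_members \<open>0 < y\<close> by auto
    have G3: "((\<lambda>x. ?G3 x y) has_real_derivative re2 (f 3) x y) (at x)"
      using DERIV_diff[OF re2_x_derivative DERIV_const, of "F 3" "f 3" x y "re2 (F 3) s y"] prim indices_members \<open>0 < y\<close> by auto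
    show "((\<lambda>x. ?G1 x y * ?G3 x y) has_real_derivative ?Bx x y) (at x)"
      using DERIV_mult[OF G1 G3] by (simp add: algebra_simps)
    have E1: "((\<lambda>y. ?G1 x y) has_real_derivative (im2 (f 1) t y - im2 (f 1) x y)) (at y)"
      and E3: "((\<lambda>y. ?G3 x y) has_real_derivative (im2 (f 3) x y - im2 (f 3) s y)) (at y)"
      using prim indices_members \<open>0 < y\<close> by (auto intro!: DERIV_diff re2_y_derivative)
    show "((\<lambda>y. ?G1 x y * ?G3 x y) has_real_derivative ?Be x y) (at y)"
      using DERIV_mult[OF E1 E3] by (simp add: algebra_simps)
  qed (use assms indices_members in \<open>auto simp: split_beta intro!: hol continuous_intros continuous_rules\<close>)
  have I: "(\<lambda>x. re2 (f 2) x y * (re2 (F l) x y - re2 (F l) r y)) integrable_on {s..t}" if "l \<in> indices" for l r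
    using assms indices_members that by (intro integrable_continuous_interval continuous_intros continuous_rules) auto
  have J: "(\<lambda>x. area_density (f i) (f j) x y * (re2 (F l) x y - re2 (F l) r y)) integrable_on {s..t}"
    if "i \<in> indices" "j \<in> indices" "l \<in> indices" for i j l r
    using assms that by (intro integrable_continuous_interval continuous_intros continuous_area_density continuous_rules) auto
  note H = has_integral_diff[OF has_integral_add[OF has_integral_add[OF
      has_integral_mult_right[OF integrable_integral[OF I[OF indices_members(4)], of s], of "im2 (f 1) t y"]
      has_integral_mult_right[OF integrable_integral[OF I[OF indices_members(1)], of t], of "im2 (f 3) s y"]]
      integrable_integral[OF J[OF indices_members(1,3,4)], of s]]
      integrable_integral[OF J[OF indices_members(3,4,1)], of t]]
  have "integral {s..t} (\<lambda>x. re2 (f 2) x y * ?Be x y - im2 (f 2) x y * ?Bx x y) =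
     im2 (f 1) t y * area 3 s s t y + im2 (f 3) s y * area 1 t s t y
       + integral {s..t} (\<lambda>x. area_density (f 1) (f 2) x y * (re2 (F 3) x y - re2 (F 3) s y))
       - integral {s..t} (\<lambda>x. area_density (f 2) (f 3) x y * (re2 (F 1) x y - re2 (F 1) t y))"
    unfolding area_def by (subst integral_unique[OF H, symmetric]) (simp add: area_density_def algebra_simps)
  then show ?thesis using D unfolding vol_def by simp
qed

definition vol_deriv_const :: real where "vol_deriv_const = 4 * C * area_const + 2 * density_const"

text \<open>All four terms of the derivative have the same order: the first two because the areas are of
order \<open>T powr (2 * \<beta>)\<close>, the other two by the preceding estimate for increments.\<close>

lemma vol_growth:
  assumes st: "- R \<le> s" "s < t" "t \<le> R" and ab: "0 < a" "a \<le> b" "b \<le> t - s"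
  shows "\<bar>vol b s t - vol a s t\<bar>
    \<le> vol_deriv_const * (t - s) powr (2 * \<beta> + 1/4) / (\<beta> - 1/4) * (b powr (\<beta> - 1/4) - a powr (\<beta> - 1/4))"
proof (rule power_growth)
  fix y assume y: "a \<le> y" "y \<le> b"
  define T where "T = t - s"
  define Q where "Q = T powr (2 * \<beta> + 1/4) * y powr (\<beta> - 5/4)"
  have y0: "0 < y" "y \<le> T" "y \<le> 2 * R" using y ab st T_def by auto
  show "((\<lambda>y. vol y s t) has_real_derivative
     (im2 (f 1) t y * area 3 s s t y + im2 (f 3) s y * area 1 t s t y
       + integral {s..t} (\<lambda>x. area_density (f 1) (f 2) x y * (re2 (F 3) x y - re2 (F 3) s y))
       - integral {s..t} (\<lambda>x. area_density (f 2) (f 3) x y * (re2 (F 1) x y - re2 (F 1) t y)))) (at y)"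
    using st y0 by (intro vol_derivative) auto
  have prod: "\<bar>im2 (f i) p y * area l r s t y\<bar> \<le> 2 * C * area_const * Q"
    if "i \<in> indices" "l \<in> {1, 3}" "p \<in> {s..t}" "r \<in> {s..t}" for i l p r
  proof -
    have "\<bar>im2 (f i) p y * area l r s t y\<bar> \<le> (2 * C * y powr (\<beta> - 1)) * (area_const * T powr (2 * \<beta>))"
      unfolding abs_mult using that st y0 C by (intro mult_mono im2_bound area_bound T_def) auto
    also have "\<dots> = 2 * C * area_const * (T powr (2 * \<beta>) * y powr (\<beta> - 1))" by simp
    also have "\<dots> \<le> 2 * C * area_const * Q"
      unfolding Q_def using C area_const_nonneg y0 by (intro mult_left_mono trade_height_for_length) auto
    finally show ?thesis .
  qed
  have "\<bar>im2 (f 1) t y * area 3 s s t y\<bar> \<le> 2 * C * area_const * Q" "\<bar>im2 (f 3) s y * area 1 t s t y\<bar> \<le> 2 * C * area_const * Q"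
    using st indices_members by (auto intro!: prod)
  moreover have "\<bar>integral {s..t} (\<lambda>x. area_density (f 1) (f 2) x y * (re2 (F 3) x y - re2 (F 3) s y))\<bar> \<le> density_const * Q"
    unfolding Q_def using st y0 by (intro density_increment_bound T_def) (auto simp: triples_def)
  moreover have "\<bar>integral {s..t} (\<lambda>x. area_density (f 2) (f 3) x y * (re2 (F 1) x y - re2 (F 1) t y))\<bar> \<le> density_const * Q"
    unfolding Q_def using st y0 by (intro density_increment_bound T_def) (auto simp: triples_def)
  ultimately have "\<bar>im2 (f 1) t y * area 3 s s t y + im2 (f 3) s y * area 1 t s t y
       + integral {s..t} (\<lambda>x. area_density (f 1) (f 2) x y * (re2 (F 3) x y - re2 (F 3) s y))
       - integral {s..t} (\<lambda>x. area_density (f 2) (f 3) x y * (re2 (F 1) x y - re2 (F 1) t y))\<bar> \<le> vol_deriv_const * Q"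
    unfolding vol_deriv_const_def by (simp add: algebra_simps)
  then show "\<bar>im2 (f 1) t y * area 3 s s t y + im2 (f 3) s y * area 1 t s t y
       + integral {s..t} (\<lambda>x. area_density (f 1) (f 2) x y * (re2 (F 3) x y - re2 (F 3) s y))
       - integral {s..t} (\<lambda>x. area_density (f 2) (f 3) x y * (re2 (F 1) x y - re2 (F 1) t y))\<bar>
      \<le> (vol_deriv_const * (t - s) powr (2 * \<beta> + 1/4)) * y powr (\<beta> - 1/4 - 1)"
    unfolding Q_def T_def by (simp add: algebra_simps)
qed (use ab \<beta> in auto)

text \<open>For heights above the length of the interval no cancellation is needed.\<close>

lemma vol_crude_bound:
  assumes st: "- R \<le> s" "s < t" "t \<le> R" and y: "0 < y" "y \<le> 2 * R"
  shows "\<bar>vol y s t\<bar> \<le> (2 * C) ^ 3 * ((t - s) ^ 3 * y powr (3 * \<beta> - 3))"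
proof -
  define h where "h = 2 * C * y powr (\<beta> - 1)"
  have h: "0 \<le> h" using C h_def by simp
  have inc: "\<bar>re2 (F i) u y - re2 (F i) v y\<bar> \<le> h * (t - s)"
    if "i \<in> indices" "u \<in> {s..t}" "v \<in> {s..t}" for i u v
  proof -
    have "\<bar>re2 (F i) u y - re2 (F i) v y\<bar> \<le> 2 * C * y powr (\<beta> - 1) * \<bar>u - v\<bar>"
      using that st y by (intro Gamma_horizontal) auto
    also have "\<dots> \<le> h * (t - s)"
      unfolding h_def using that C by (intro mult_left_mono) auto
    finally show ?thesis .
  qed
  have h2: "\<bar>re2 (f 2) u y\<bar> \<le> h" if "u \<in> {s..t}" for u
    unfolding h_def using that st y indices_members by (intro re2_bound) auto
  have "norm (vol y s t) \<le> (h * ((h * (t - s)) * (h * (t - s)))) * (t - s)"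
    unfolding vol_def using st y indices_members h
    by (intro integral_bound)
      (auto simp: abs_mult h_def[symmetric] intro!: mult_mono inc h2 continuous_intros continuous_rules)
  also have "\<dots> = (2 * C) ^ 3 * ((t - s) ^ 3 * (y powr (\<beta> - 1)) ^ 3)"
    by (simp add: h_def power3_eq_cube algebra_simps)
  also have "(y powr (\<beta> - 1)) ^ 3 = y powr (3 * \<beta> - 3)"
    using y by (simp add: powr_power algebra_simps)
  finally show ?thesis by simp
qed

text \<open>The limit is taken along an explicit sequence that does not depend on the bounded region under
consideration, so that the limits for different regions agree.\<close>

definition vol_lim :: "real \<Rightarrow> real \<Rightarrow> real" where
  "vol_lim s t = lim (\<lambda>n. vol ((t - s) / real (Suc n)) s t)"

definition rate_const :: real where "rate_const = vol_deriv_const / (\<beta> - 1/4)"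

lemma rate_const_nonneg: "0 \<le> rate_const"
proof -
  have "0 \<le> density_const" unfolding density_const_def using C \<beta> increment_const_nonneg by simp
  then show ?thesis unfolding rate_const_def vol_deriv_const_def using C \<beta> area_const_nonneg by simp
qed

lemma vol_growth_crude:
  assumes "- R \<le> s" "s < t" "t \<le> R" "0 < a" "a \<le> b" "b \<le> t - s"
  shows "\<bar>vol b s t - vol a s t\<bar> \<le> rate_const * (t - s) powr (2 * \<beta> + 1/4) * b powr (\<beta> - 1/4)"
proof -
  have "\<bar>vol b s t - vol a s t\<bar>
      \<le> rate_const * (t - s) powr (2 * \<beta> + 1/4) * (b powr (\<beta> - 1/4) - a powr (\<beta> - 1/4))"
    using vol_growth[OF assms] by (simp add: rate_const_def)
  also have "\<dots> \<le> rate_const * (t - s) powr (2 * \<beta> + 1/4) * b powr (\<beta> - 1/4)"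
    using rate_const_nonneg by (intro mult_left_mono) auto
  finally show ?thesis .
qed

lemma vol_lim_bound:
  assumes st: "- R \<le> s" "s < t" "t \<le> R" and y: "0 < y" "y \<le> t - s"
  shows "\<bar>vol y s t - vol_lim s t\<bar> \<le> rate_const * (t - s) powr (2 * \<beta> + 1/4) * y powr (\<beta> - 1/4)"
proof -
  let ?e = "\<lambda>n. (t - s) / real (Suc n)"
  let ?M = "rate_const * (t - s) powr (2 * \<beta> + 1/4)"
  have e0: "0 < ?e n" "?e n \<le> t - s" for n
    using st by (auto simp: divide_le_eq)
  have emono: "?e n \<le> ?e m" if "m \<le> n" for m n
    using that st by (intro divide_left_mono) auto
  have elim: "?e \<longlonglongrightarrow> 0"
    using tendsto_mult[OF tendsto_const LIMSEQ_inverse_real_of_nat, of "t - s"] by (simp add: divide_inverse)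
  have "(\<lambda>n. ?M * ?e n powr (\<beta> - 1/4)) \<longlonglongrightarrow> ?M * 0 powr (\<beta> - 1/4)"
    using \<beta> e0 by (intro tendsto_mult tendsto_const tendsto_powr' elim) (auto simp: less_imp_le)
  then have blim: "(\<lambda>n. ?M * ?e n powr (\<beta> - 1/4)) \<longlonglongrightarrow> 0" by simp
  have "Cauchy (\<lambda>n. vol (?e n) s t)"
  proof (rule CauchyI')
    fix e :: real assume "0 < e"
    then obtain N where N: "\<And>n. n \<ge> N \<Longrightarrow> \<bar>?M * ?e n powr (\<beta> - 1/4)\<bar> < e"
      using LIMSEQ_D[OF blim] by auto
    have "dist (vol (?e m) s t) (vol (?e n) s t) < e" if "m \<ge> N" "n > m" for m n
    proof -
      have "\<bar>vol (?e m) s t - vol (?e n) s t\<bar> \<le> ?M * ?e m powr (\<beta> - 1/4)"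
        using that st e0 by (intro vol_growth_crude emono) auto
      also have "\<dots> < e" using N[OF that(1)] by (simp add: abs_less_iff)
      finally show ?thesis by (simp add: dist_real_def)
    qed
    then show "\<exists>N. \<forall>m\<ge>N. \<forall>n>m. dist (vol (?e m) s t) (vol (?e n) s t) < e" by blast
  qed
  then have lim: "(\<lambda>n. vol (?e n) s t) \<longlonglongrightarrow> vol_lim s t"
    unfolding vol_lim_def using Cauchy_convergent_iff convergent_LIMSEQ_iff by blast
  have "eventually (\<lambda>n. ?e n < y) sequentially"
    using order_tendstoD(2)[OF elim y(1)] .
  then have "eventually (\<lambda>n. \<bar>vol y s t - vol (?e n) s t\<bar> \<le> ?M * y powr (\<beta> - 1/4)) sequentially"
    by eventually_elim (use st y e0 in \<open>auto intro!: vol_growth_crude\<close>)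
  moreover have "(\<lambda>n. \<bar>vol y s t - vol (?e n) s t\<bar>) \<longlonglongrightarrow> \<bar>vol y s t - vol_lim s t\<bar>"
    by (intro tendsto_intros lim)
  ultimately show ?thesis
    by (intro tendsto_upperbound[of _ _ sequentially]) auto
qed

text \<open>For \<open>y \<le> t - s\<close> the growth estimate applies down to the limit.  For larger \<open>y\<close> both terms are small
separately, and the limit is compared with the volume at height \<open>t - s\<close>.\<close>

lemma vol_holder:
  assumes st: "- R \<le> s" "s < t" "t \<le> R" and y: "0 < y" "y \<le> 2 * R" and \<kappa>: "0 < \<kappa>" "\<kappa> \<le> \<beta> - 1/4"
  shows "\<bar>vol y s t - vol_lim s t\<bar> \<le> (2 * (2 * C) ^ 3 + rate_const) * (y powr \<kappa> * (t - s) powr (3 * \<beta> - \<kappa>))"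
proof -
  define T where "T = t - s"
  have T: "0 < T" "T \<le> 2 * R" using st T_def by auto
  have K: "0 \<le> (2 * C) ^ 3" using C by simp
  let ?Q = "y powr \<kappa> * T powr (3 * \<beta> - \<kappa>)"
  show ?thesis
  proof (cases "y \<le> T")
    case True
    have "T powr (2 * \<beta> + 1/4) * y powr (\<beta> - 1/4) = T powr (2 * \<beta> + 1/4) * y powr (\<beta> - 1/4 - \<kappa>) * y powr \<kappa>"
      by (simp add: powr_add[symmetric])
    also have "\<dots> \<le> T powr (2 * \<beta> + 1/4) * T powr (\<beta> - 1/4 - \<kappa>) * y powr \<kappa>"
      using True y \<kappa> by (intro mult_right_mono mult_left_mono powr_mono2) auto
    also have "\<dots> = ?Q"
      by (simp add: powr_add[symmetric])
    finally have "rate_const * (T powr (2 * \<beta> + 1/4) * y powr (\<beta> - 1/4)) \<le> rate_const * ?Q"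
      by (rule mult_left_mono) (rule rate_const_nonneg)
    moreover have "rate_const * ?Q \<le> (2 * (2 * C) ^ 3 + rate_const) * ?Q"
      using K by (intro mult_right_mono) auto
    ultimately show ?thesis
      using vol_lim_bound[OF st y(1)] True unfolding T_def by (simp add: mult.assoc)
  next
    case False
    have "T ^ 3 * y powr (3 * \<beta> - 3) = T powr (3 * \<beta> - \<kappa>) * T powr (3 - 3 * \<beta> + \<kappa>) * y powr (3 * \<beta> - 3)"
      using T by (simp add: powr_add[symmetric])
    also have "\<dots> \<le> T powr (3 * \<beta> - \<kappa>) * y powr (3 - 3 * \<beta> + \<kappa>) * y powr (3 * \<beta> - 3)"
      using False T \<kappa> \<beta> by (intro mult_right_mono mult_left_mono powr_mono2) auto
    also have "\<dots> = ?Q"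
      using y by (simp add: powr_add[symmetric] mult.assoc)
    finally have "(2 * C) ^ 3 * (T ^ 3 * y powr (3 * \<beta> - 3)) \<le> (2 * C) ^ 3 * ?Q"
      by (rule mult_left_mono) (rule K)
    then have 1: "\<bar>vol y s t\<bar> \<le> (2 * C) ^ 3 * ?Q"
      using vol_crude_bound[OF st y] unfolding T_def by linarith
    have Tb: "T powr (3 * \<beta>) \<le> ?Q"
    proof -
      have "T powr (3 * \<beta>) = T powr \<kappa> * T powr (3 * \<beta> - \<kappa>)" by (simp add: powr_add[symmetric])
      also have "\<dots> \<le> ?Q" using False T \<kappa> by (intro mult_right_mono powr_mono2) auto
      finally show ?thesis .
    qed
    have "\<bar>vol T s t\<bar> \<le> (2 * C) ^ 3 * (T ^ 3 * T powr (3 * \<beta> - 3))"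
      using vol_crude_bound[OF st T] unfolding T_def .
    also have "T ^ 3 * T powr (3 * \<beta> - 3) = T powr (3 * \<beta>)"
      using T by (simp add: powr_diff)
    finally have 2: "\<bar>vol T s t\<bar> \<le> (2 * C) ^ 3 * T powr (3 * \<beta>)" .
    have "\<bar>vol T s t - vol_lim s t\<bar> \<le> rate_const * (T powr (2 * \<beta> + 1/4) * T powr (\<beta> - 1/4))"
      using vol_lim_bound[OF st T(1)] unfolding T_def by (simp add: mult.assoc)
    also have "T powr (2 * \<beta> + 1/4) * T powr (\<beta> - 1/4) = T powr (3 * \<beta>)"
      by (simp add: powr_add[symmetric])
    finally have 3: "\<bar>vol T s t - vol_lim s t\<bar> \<le> rate_const * T powr (3 * \<beta>)" .
    have "\<bar>vol y s t - vol_lim s t\<bar> \<le> (2 * C) ^ 3 * ?Q + ((2 * C) ^ 3 + rate_const) * T powr (3 * \<beta>)"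
      using 1 2 3 by (simp add: algebra_simps)
    also have "\<dots> \<le> (2 * C) ^ 3 * ?Q + ((2 * C) ^ 3 + rate_const) * ?Q"
      using K rate_const_nonneg Tb by (intro add_left_mono mult_left_mono) auto
    finally show ?thesis unfolding T_def by (simp add: algebra_simps)
  qed
qed

text \<open>The part of the exponent of \<open>t - s\<close> that exceeds \<open>p\<close> is absorbed by the size of the region.\<close>

lemma vol_convergence_rate:
  assumes p: "0 < p" "p < 3 * \<beta>"
  shows "\<exists>K \<kappa>. 0 \<le> K \<and> 0 < \<kappa> \<and> (\<forall>s t y. - R \<le> s \<longrightarrow> s < t \<longrightarrow> t \<le> R \<longrightarrow> 0 < y \<longrightarrow> y \<le> 2 * R \<longrightarrow>
    \<bar>vol y s t - vol_lim s t\<bar> \<le> K * y powr \<kappa> * (t - s) powr p)"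
proof -
  \<comment> \<open>The first entry is what the growth estimate allows, the second keeps the exponent of \<open>t - s\<close> above \<open>p\<close>.\<close>
  define \<kappa> where "\<kappa> = min (\<beta> - 1/4) (3 * \<beta> - p)"
  define K where "K = 2 * (2 * C) ^ 3 + rate_const"
  define c where "c = (2 * R) powr (3 * \<beta> - \<kappa> - p)"
  have \<kappa>: "0 < \<kappa>" "\<kappa> \<le> \<beta> - 1/4" "0 \<le> 3 * \<beta> - \<kappa> - p" using \<beta> p by (auto simp: \<kappa>_def)
  have K: "0 \<le> K" using C rate_const_nonneg by (simp add: K_def)
  have "\<bar>vol y s t - vol_lim s t\<bar> \<le> (K * c) * y powr \<kappa> * (t - s) powr p"
    if "- R \<le> s" "s < t" "t \<le> R" "0 < y" "y \<le> 2 * R" for s t y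
  proof -
    have "(t - s) powr (3 * \<beta> - \<kappa>) = (t - s) powr (3 * \<beta> - \<kappa> - p) * (t - s) powr p"
      by (simp add: powr_add[symmetric])
    also have "\<dots> \<le> c * (t - s) powr p"
      unfolding c_def using that \<kappa> by (intro mult_right_mono powr_mono2) auto
    finally have "K * (y powr \<kappa> * (t - s) powr (3 * \<beta> - \<kappa>)) \<le> K * (y powr \<kappa> * (c * (t - s) powr p))"
      using K by (intro mult_left_mono) auto
    then show ?thesis
      using vol_holder[OF that \<kappa>(1,2)] unfolding K_def by (simp add: mult_ac)
  qed
  moreover have "0 \<le> K * c" using K by (simp add: c_def)
  ultimately show ?thesis using \<kappa>(1) by blast
qed

end

text \<open>The factor \<open>re2 (f 1)\<close> is integrated and the inner area is differentiated.  The antiderivative is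
normalized to vanish at \<open>t\<close>, and the area vanishes at \<open>s\<close>, so there are no boundary terms.\<close>

lemma (in half_plane_fields) vol_iterated:
  assumes "s \<le> t" and y: "0 < y"
  shows "integral {s..t} (\<lambda>x1. re2 (f 1) x1 y * integral {s..x1} (\<lambda>x2. re2 (f 2) x2 y * integral {s..x2} (\<lambda>x3. re2 (f 3) x3 y)))
     = vol y s t"
proof -
  have inner: "integral {s..x} (\<lambda>x3. re2 (f 3) x3 y) = re2 (F 3) x y - re2 (F 3) s y" if "s \<le> x" for x
    using that y indices_members
    by (intro integral_unique fundamental_theorem_of_calculus)
      (auto simp: has_real_derivative_iff_has_vector_derivative[symmetric] intro!: re2_x_derivative prim)
  let ?a = "\<lambda>x. re2 (f 2) x y * (re2 (F 3) x y - re2 (F 3) s y)"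
  let ?A = "\<lambda>x. integral {s..x} ?a"
  let ?g = "\<lambda>x. re2 (F 1) t y - re2 (F 1) x y"
  have middle: "integral {s..x} (\<lambda>x2. re2 (f 2) x2 y * integral {s..x2} (\<lambda>x3. re2 (f 3) x3 y)) = ?A x" for x
    by (rule Henstock_Kurzweil_Integration.integral_cong) (simp add: inner)
  have ca: "continuous_on {s..t} ?a" using y indices_members by (intro continuous_intros continuous_rules) auto
  have dA: "(?A has_real_derivative ?a x) (at x within {s..t})" if "x \<in> {s..t}" for x
    using integral_has_real_derivative[OF ca that] .
  have dg: "(?g has_real_derivative - re2 (f 1) x y) (at x within {s..t})" for x
    using DERIV_diff[OF DERIV_const re2_x_derivative, of "F 1" "f 1" x y "re2 (F 1) t y" "{s..t}"] prim indices_members y by auto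
  have I1: "((\<lambda>x. ?g x * ?a x - re2 (f 1) x y * ?A x) has_integral (?g t * ?A t - ?g s * ?A s)) {s..t}"
  proof (rule fundamental_theorem_of_calculus[OF assms(1)])
    fix x assume x: "x \<in> {s..t}"
    show "((\<lambda>x. ?g x * ?A x) has_vector_derivative ?g x * ?a x - re2 (f 1) x y * ?A x) (at x within {s..t})"
      using DERIV_mult[OF dg dA[OF x]] by (simp add: has_real_derivative_iff_has_vector_derivative[symmetric] algebra_simps)
  qed
  have I2: "((\<lambda>x. ?g x * ?a x) has_integral integral {s..t} (\<lambda>x. ?g x * ?a x)) {s..t}"
    using y indices_members by (intro integrable_integral integrable_continuous_interval continuous_intros ca continuous_rules) auto
  have "((\<lambda>x. ?g x * ?a x - (?g x * ?a x - re2 (f 1) x y * ?A x)) has_integral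
      (integral {s..t} (\<lambda>x. ?g x * ?a x) - (?g t * ?A t - ?g s * ?A s))) {s..t}"
    by (rule has_integral_diff[OF I2 I1])
  then have "((\<lambda>x. re2 (f 1) x y * ?A x) has_integral integral {s..t} (\<lambda>x. ?g x * ?a x)) {s..t}"
    by simp
  then have "integral {s..t} (\<lambda>x. re2 (f 1) x y * ?A x) = integral {s..t} (\<lambda>x. ?g x * ?a x)"
    by (rule integral_unique)
  then show ?thesis unfolding middle vol_def by (simp add: mult_ac)
qed

section \<open>The variation distance\<close>

text \<open>The exponents \<open>3 / q\<close> and \<open>q / 3\<close> cancel, which turns the sum over a partition into a telescoping sum.\<close>

lemma d3_le:
  assumes "0 < q" "0 \<le> D"
    and AL: "\<And>u v. s \<le> u \<Longrightarrow> u < v \<Longrightarrow> v \<le> t \<Longrightarrow> \<bar>A u v - L u v\<bar> \<le> D * (v - u) powr (3 / q)"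
  shows "d3 q A L s t \<le> ennreal (D * \<bar>t - s\<bar> powr (3 / q))"
proof -
  have sum_le: "(\<Sum>l=1..n. \<bar>A (p (l - 1)) (p l) - L (p (l - 1)) (p l)\<bar> powr (q / 3)) \<le> D powr (q / 3) * \<bar>t - s\<bar>"
    if "(n, p) \<in> partitions s t" for n p
  proof -
    have p: "p 0 = s" "p n = t" "\<And>l. l < n \<Longrightarrow> p l < p (Suc l)"
      using that by (auto simp: partitions_def)
    have mono: "p i \<le> p j" if "i \<le> j" "j \<le> n" for i j
      using that by (induction j rule: dec_induct) (auto intro: order.trans[OF _ less_imp_le[OF p(3)]])
    have "\<bar>A (p (l - 1)) (p l) - L (p (l - 1)) (p l)\<bar> powr (q / 3) \<le> D powr (q / 3) * (p l - p (l - 1))"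
      if l: "l \<in> {1..n}" for l
    proof -
      have lt: "p (l - 1) < p l" using p(3)[of "l - 1"] l by auto
      have "\<bar>A (p (l - 1)) (p l) - L (p (l - 1)) (p l)\<bar> \<le> D * (p l - p (l - 1)) powr (3 / q)"
        using lt l p mono[of 0 "l - 1"] mono[of l n] by (intro AL) auto
      then have "\<bar>A (p (l - 1)) (p l) - L (p (l - 1)) (p l)\<bar> powr (q / 3)
          \<le> (D * (p l - p (l - 1)) powr (3 / q)) powr (q / 3)"
        using assms(1) by (intro powr_mono2) auto
      also have "\<dots> = D powr (q / 3) * (p l - p (l - 1))"
        using assms lt by (simp add: powr_mult powr_powr)
      finally show ?thesis .
    qed
    then have "(\<Sum>l=1..n. \<bar>A (p (l - 1)) (p l) - L (p (l - 1)) (p l)\<bar> powr (q / 3))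
        \<le> (\<Sum>l=1..n. D powr (q / 3) * (p l - p (l - 1)))"
      by (rule sum_mono)
    also have "\<dots> = D powr (q / 3) * (t - s)"
      using sum_telescope''[of 0 n p] p by (simp add: sum_distrib_left[symmetric] atLeastSucAtMost_greaterThanAtMost)
    also have "\<dots> \<le> D powr (q / 3) * \<bar>t - s\<bar>" by (intro mult_left_mono) auto
    finally show ?thesis .
  qed
  let ?S = "SUP (n, p) \<in> partitions s t. ennreal (\<Sum>l=1..n. \<bar>A (p (l - 1)) (p l) - L (p (l - 1)) (p l)\<bar> powr (q / 3))"
  have S: "?S \<le> ennreal (D powr (q / 3) * \<bar>t - s\<bar>)"
    by (rule SUP_least) (use sum_le in \<open>auto intro!: ennreal_leI\<close>)
  then have fin: "?S \<noteq> \<top>"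
    using ennreal_less_top leD top.not_eq_extremum by (metis order_le_less_trans order_less_irrefl)
  have "enn2real ?S \<le> D powr (q / 3) * \<bar>t - s\<bar>"
    using S by (intro enn2real_leI) auto
  then have "enn2real ?S powr (3 / q) \<le> (D powr (q / 3) * \<bar>t - s\<bar>) powr (3 / q)"
    using assms by (intro powr_mono2) auto
  also have "\<dots> = D * \<bar>t - s\<bar> powr (3 / q)"
    using assms by (cases "D = 0") (auto simp: powr_mult powr_powr)
  finally show ?thesis
    unfolding d3_def ennreal_powr_def if_not_P[OF fin] by (rule ennreal_leI)
qed

lemma d3_tendsto_0:
  assumes q: "0 < q" and K: "0 \<le> K" and \<kappa>: "0 < \<kappa>" and e0: "0 < e0"
    and le: "\<And>\<epsilon> u v. 0 < \<epsilon> \<Longrightarrow> \<epsilon> \<le> e0 \<Longrightarrow> s \<le> u \<Longrightarrow> u < v \<Longrightarrow> v \<le> t \<Longrightarrow>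
      \<bar>A \<epsilon> u v - L u v\<bar> \<le> K * \<epsilon> powr \<kappa> * (v - u) powr (3 / q)"
  shows "((\<lambda>\<epsilon>. d3 q (A \<epsilon>) L s t) \<longlongrightarrow> 0) (at_right 0)"
proof (rule tendsto_sandwich[where f = "\<lambda>_. 0"])
  show "eventually (\<lambda>\<epsilon>. d3 q (A \<epsilon>) L s t \<le> ennreal (K * \<epsilon> powr \<kappa> * \<bar>t - s\<bar> powr (3 / q))) (at_right 0)"
    using eventually_at_right_less[of 0] eventually_at_right_real[OF e0]
  proof eventually_elim
    case (elim \<epsilon>)
    then show ?case using q K by (intro d3_le le) auto
  qed
  have "((\<lambda>\<epsilon>. K * \<epsilon> powr \<kappa> * \<bar>t - s\<bar> powr (3 / q)) \<longlongrightarrow> K * 0 powr \<kappa> * \<bar>t - s\<bar> powr (3 / q)) (at_right 0)"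
    using \<kappa> by (intro tendsto_mult tendsto_const tendsto_powr' tendsto_ident_at)
      (auto simp: eventually_at_filter)
  then have "((\<lambda>\<epsilon>. K * \<epsilon> powr \<kappa> * \<bar>t - s\<bar> powr (3 / q)) \<longlongrightarrow> 0) (at_right 0)" by simp
  from tendsto_ennrealI[OF this]
  show "((\<lambda>\<epsilon>. ennreal (K * \<epsilon> powr \<kappa> * \<bar>t - s\<bar> powr (3 / q))) \<longlongrightarrow> 0) (at_right 0)" by simp
qed auto

section \<open>From moments to almost sure bounds\<close>

text \<open>A sum with finite expectation is finite almost surely, and it dominates each of its terms.  The index
\<open>k\<close> is the scale; high moments make the expectations decay faster than the number of points grows.\<close>

lemma AE_bounded_of_summable_expectations:
  fixes Z :: "nat \<Rightarrow> 'i \<Rightarrow> 'w \<Rightarrow> ennreal"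
  assumes meas: "\<And>k i. i \<in> G k \<Longrightarrow> Z k i \<in> borel_measurable M" and fin: "\<And>k. finite (G k)"
    and le: "\<And>k. (\<Sum>i\<in>G k. \<integral>\<^sup>+\<omega>. Z k i \<omega> \<partial>M) \<le> ennreal (D * (1/2) ^ k)" and D: "0 \<le> D"
  shows "AE \<omega> in M. \<exists>C\<ge>0. \<forall>k. \<forall>i\<in>G k. Z k i \<omega> \<le> ennreal C"
proof -
  let ?S = "\<lambda>k \<omega>. \<Sum>i\<in>G k. Z k i \<omega>"
  have mS: "?S k \<in> borel_measurable M" for k by (intro borel_measurable_sum meas)
  have "(\<integral>\<^sup>+\<omega>. (\<Sum>k. ?S k \<omega>) \<partial>M) = (\<Sum>k. \<integral>\<^sup>+\<omega>. ?S k \<omega> \<partial>M)"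
    by (intro nn_integral_suminf mS)
  also have "\<dots> = (\<Sum>k. \<Sum>i\<in>G k. \<integral>\<^sup>+\<omega>. Z k i \<omega> \<partial>M)"
    by (intro suminf_cong nn_integral_sum meas)
  also have "\<dots> \<le> (\<Sum>k. ennreal (D * (1/2) ^ k))"
    by (intro suminf_le le summableI)
  also have "\<dots> = ennreal (\<Sum>k. D * (1/2) ^ k)"
    using D by (intro suminf_ennreal2) (auto intro!: summable_mult summable_geometric)
  finally have "(\<integral>\<^sup>+\<omega>. (\<Sum>k. ?S k \<omega>) \<partial>M) \<noteq> \<infinity>"
    using ennreal_less_top le_less_trans by (metis infinity_ennreal_def less_irrefl)
  then have "AE \<omega> in M. (\<Sum>k. ?S k \<omega>) \<noteq> \<infinity>"
    by (intro nn_integral_PInf_AE borel_measurable_suminf_order mS)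
  then show ?thesis
  proof eventually_elim
    fix \<omega> assume fin\<omega>: "(\<Sum>k. ?S k \<omega>) \<noteq> \<infinity>"
    have "Z k i \<omega> \<le> ennreal (enn2real (\<Sum>k. ?S k \<omega>))" if "i \<in> G k" for k i
    proof -
      have "Z k i \<omega> \<le> ?S k \<omega>" using fin that by (intro member_le_sum) auto
      also have "\<dots> \<le> (\<Sum>k. ?S k \<omega>)"
        using sum_le_suminf[of "\<lambda>k. ?S k \<omega>" "{k}"] by (simp add: summableI)
      also have "\<dots> = ennreal (enn2real (\<Sum>k. ?S k \<omega>))" using fin\<omega> by (simp add: less_top)
      finally show ?thesis .
    qed
    then show "\<exists>C\<ge>0. \<forall>k. \<forall>i\<in>G k. Z k i \<omega> \<le> ennreal C"
      by (intro exI[of _ "enn2real (\<Sum>k. ?S k \<omega>)"]) auto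
  qed
qed

text \<open>Riemann sums involve finitely many field variables.  Moments and independence can therefore be
computed for finite families and passed on to integrals by Fatou's lemma, without measurability of
the field as a function of two variables.\<close>

definition riemann_sum :: "real \<Rightarrow> real \<Rightarrow> nat \<Rightarrow> (real \<Rightarrow> real) \<Rightarrow> real" where
  "riemann_sum a b n f = (b - a) / real (Suc n) * (\<Sum>j<Suc n. f (a + (b - a) / real (Suc n) * real j))"

lemma riemann_sum_tendsto:
  assumes "a \<le> b" and f: "continuous_on {a..b} f"
  shows "(\<lambda>n. riemann_sum a b n f) \<longlonglongrightarrow> integral {a..b} f"
proof (rule LIMSEQ_I)
  fix e :: real assume "0 < e"
  define e' where "e' = e / (2 * (b - a + 1))"
  have e': "0 < e'" "e' * (b - a) < e"
  proof -
    show "0 < e'" using \<open>0 < e\<close> assms by (auto simp: e'_def)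
    have "e' * (b - a) < e' * (2 * (b - a + 1))" using \<open>0 < e'\<close> assms by (intro mult_strict_left_mono) auto
    also have "\<dots> = e" using assms by (simp add: e'_def)
    finally show "e' * (b - a) < e" .
  qed
  have "uniformly_continuous_on {a..b} f"
    using f compact_uniformly_continuous by blast
  then obtain d where d: "0 < d" "\<And>x x'. x \<in> {a..b} \<Longrightarrow> x' \<in> {a..b} \<Longrightarrow> \<bar>x' - x\<bar> < d \<Longrightarrow> \<bar>f x' - f x\<bar> < e'"
    using e'(1) unfolding uniformly_continuous_on_def dist_real_def by metis
  obtain N :: nat where N: "(b - a) / d < real N" using reals_Archimedean2 by blast
  have "norm (riemann_sum a b n f - integral {a..b} f) < e" if "n \<ge> N" for n
  proof -
    define D where "D = (b - a) / real (Suc n)"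
    define p where "p j = a + D * real j" for j :: nat
    have D0: "0 \<le> D" using assms by (simp add: D_def)
    have Dd: "D < d"
    proof -
      have "(b - a) / d < real (Suc n)" using N that by linarith
      then show ?thesis using d(1) by (simp add: D_def field_simps)
    qed
    have pn: "p 0 = a" "p (Suc n) = b" by (auto simp: p_def D_def)
    have pm: "p j \<le> p (Suc j)" for j using D0 by (simp add: p_def algebra_simps)
    have pin: "p j \<in> {a..b}" if "j \<le> Suc n" for j
    proof -
      have "D * real j \<le> D * real (Suc n)" using that D0 by (intro mult_left_mono) auto
      also have "\<dots> = b - a" by (simp add: D_def)
      finally show ?thesis using D0 by (simp add: p_def)
    qed
    have int: "f integrable_on {a..b}" using f by (rule integrable_continuous_interval)
    have step: "\<bar>D * f (p j) - (integral {a..p (Suc j)} f - integral {a..p j} f)\<bar> \<le> e' * D" if "j < Suc n" for j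
    proof -
      have sub: "{p j..p (Suc j)} \<subseteq> {a..b}" using pin[of j] pin[of "Suc j"] that by auto
      have "integral {a..p j} f + integral {p j..p (Suc j)} f = integral {a..p (Suc j)} f"
        using pin[of j] pin[of "Suc j"] that pm[of j] int
        by (intro Henstock_Kurzweil_Integration.integral_combine integrable_on_subinterval[OF int]) auto
      then have eq: "integral {a..p (Suc j)} f - integral {a..p j} f = integral {p j..p (Suc j)} f" by simp
      have "norm (integral {p j..p (Suc j)} (\<lambda>x. f (p j) - f x)) \<le> e' * (p (Suc j) - p j)"
      proof (rule integral_bound)
        show "continuous_on {p j..p (Suc j)} (\<lambda>x. f (p j) - f x)"
          using f sub by (intro continuous_intros) (rule continuous_on_subset)
        fix x assume x: "x \<in> {p j..p (Suc j)}"
        have "p (Suc j) - p j = D" by (simp add: p_def algebra_simps)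
        then have "\<bar>p j - x\<bar> < d" using x Dd by auto
        then show "norm (f (p j) - f x) \<le> e'"
          using d(2)[of x "p j"] x sub pin[of j] that by fastforce
      qed (use pm in auto)
      moreover have "integral {p j..p (Suc j)} (\<lambda>x. f (p j) - f x) = D * f (p j) - integral {p j..p (Suc j)} f"
        using integrable_on_subinterval[OF int sub] D0 by (subst integral_diff) (auto simp: p_def algebra_simps)
      moreover have "p (Suc j) - p j = D" by (simp add: p_def algebra_simps)
      ultimately show ?thesis unfolding eq by simp
    qed
    have "riemann_sum a b n f - integral {a..b} f
       = (\<Sum>j<Suc n. D * f (p j) - (integral {a..p (Suc j)} f - integral {a..p j} f))"
    proof -
      have "(\<Sum>j<Suc n. integral {a..p (Suc j)} f - integral {a..p j} f) = integral {a..b} f"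
        using sum_lessThan_telescope[of "\<lambda>j. integral {a..p j} f" "Suc n"] pn
        by (simp del: sum.lessThan_Suc)
      then show ?thesis
        unfolding sum_subtractf riemann_sum_def by (simp only: p_def D_def sum_distrib_left)
    qed
    also have "norm \<dots> \<le> (\<Sum>j<Suc n. e' * D)"
      unfolding real_norm_def by (rule order.trans[OF sum_abs]) (intro sum_mono step, auto)
    also have "\<dots> = e' * (b - a)" by (simp add: D_def)
    also have "\<dots> < e" by (rule e')
    finally show ?thesis .
  qed
  then show "\<exists>N. \<forall>n\<ge>N. norm (riemann_sum a b n f - integral {a..b} f) < e" by blast
qed

text \<open>The integral need not be a random variable, because the integrand is only almost surely continuous.
The lower limit of the powers of the Riemann sums is one, and on continuous paths it is the power of
the integral.\<close>

lemma integral_moment_majorant: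
  fixes \<xi> :: "real \<Rightarrow> 'w \<Rightarrow> real"
  assumes "a \<le> b" and meas: "\<And>x. x \<in> {a..b} \<Longrightarrow> \<xi> x \<in> borel_measurable M"
    and B: "\<And>n. n \<ge> N \<Longrightarrow> (\<integral>\<^sup>+\<omega>. ennreal (riemann_sum a b n (\<lambda>x. \<xi> x \<omega>) ^ (2 * m)) \<partial>M) \<le> B"
  shows "\<exists>Z \<in> borel_measurable M. (\<integral>\<^sup>+\<omega>. Z \<omega> \<partial>M) \<le> B \<and>
    (\<forall>\<omega>. continuous_on {a..b} (\<lambda>x. \<xi> x \<omega>) \<longrightarrow> ennreal (integral {a..b} (\<lambda>x. \<xi> x \<omega>) ^ (2 * m)) \<le> Z \<omega>)"
proof -
  let ?R = "\<lambda>n \<omega>. ennreal (riemann_sum a b n (\<lambda>x. \<xi> x \<omega>) ^ (2 * m))"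
  have in_ab: "a + (b - a) / real (Suc n) * real j \<in> {a..b}" if "j < Suc n" for n j
  proof -
    have "(b - a) / real (Suc n) * real j \<le> (b - a) / real (Suc n) * real (Suc n)"
      using that assms(1) by (intro mult_left_mono) auto
    also have "\<dots> = b - a" by simp
    finally show ?thesis using assms(1) by auto
  qed
  have R: "?R n \<in> borel_measurable M" for n
  proof -
    have "(\<lambda>\<omega>. riemann_sum a b n (\<lambda>x. \<xi> x \<omega>)) \<in> borel_measurable M"
      unfolding riemann_sum_def by (intro borel_measurable_times borel_measurable_const borel_measurable_sum meas in_ab) auto
    then show ?thesis by measurable
  qed
  let ?Z = "\<lambda>\<omega>. liminf (\<lambda>n. ?R n \<omega>)"
  have "(\<integral>\<^sup>+\<omega>. ?Z \<omega> \<partial>M) \<le> liminf (\<lambda>n. \<integral>\<^sup>+\<omega>. ?R n \<omega> \<partial>M)"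
    by (intro nn_integral_liminf R)
  also have "\<dots> \<le> liminf (\<lambda>n. B)"
    by (rule Liminf_mono) (use B in \<open>auto simp: eventually_sequentially\<close>)
  also have "\<dots> = B" by (simp add: Liminf_const)
  finally have "(\<integral>\<^sup>+\<omega>. ?Z \<omega> \<partial>M) \<le> B" .
  moreover have "ennreal (integral {a..b} (\<lambda>x. \<xi> x \<omega>) ^ (2 * m)) \<le> ?Z \<omega>"
    if "continuous_on {a..b} (\<lambda>x. \<xi> x \<omega>)" for \<omega>
  proof -
    have "(\<lambda>n. ?R n \<omega>) \<longlonglongrightarrow> ennreal (integral {a..b} (\<lambda>x. \<xi> x \<omega>) ^ (2 * m))"
      by (intro tendsto_ennrealI tendsto_power riemann_sum_tendsto assms(1) that)
    then show ?thesis using lim_imp_Liminf[OF sequentially_bot] by (metis order_refl)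
  qed
  moreover have "?Z \<in> borel_measurable M" by (intro borel_measurable_liminf R)
  ultimately show ?thesis by blast
qed

text \<open>The moment of order \<open>2 m\<close> of the standard normal distribution.\<close>

definition gaussian_constant :: "nat \<Rightarrow> real" where
  "gaussian_constant m = fact (2 * m) / (2 ^ m * fact m)"

lemma gaussian_constant_nonneg: "0 \<le> gaussian_constant m"
  by (simp add: gaussian_constant_def)

lemma gaussian_even_moments:
  assumes M: "prob_space M" and Y: "centered_gaussian_rv M Y"
  obtains v where "0 \<le> v" "\<And>m. has_bochner_integral M (\<lambda>\<omega>. Y \<omega> ^ (2 * m)) (gaussian_constant m * v ^ m)"
proof -
  interpret prob_space M by fact
  have meas[measurable]: "Y \<in> borel_measurable M" using Y by (simp add: centered_gaussian_rv_def)
  consider "AE \<omega> in M. Y \<omega> = 0" | \<sigma> where "\<sigma> > 0" "distributed M lborel Y (normal_density 0 \<sigma>)"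
    using Y by (auto simp: centered_gaussian_rv_def)
  then show ?thesis
  proof cases
    case 1
    have "has_bochner_integral M (\<lambda>\<omega>. Y \<omega> ^ (2 * m)) (gaussian_constant m * 0 ^ m)" for m
    proof -
      have "has_bochner_integral M (\<lambda>\<omega>. 0 ^ (2 * m) :: real) (0 ^ (2 * m))"
        by (simp add: has_bochner_integral_iff prob_space)
      moreover have "gaussian_constant m * 0 ^ m = 0 ^ (2 * m)"
        by (cases m) (auto simp: gaussian_constant_def)
      moreover have "AE \<omega> in M. (0::real) ^ (2 * m) = Y \<omega> ^ (2 * m)" using 1 by eventually_elim simp
      ultimately show ?thesis
        using has_bochner_integral_cong_AE[of "\<lambda>\<omega>. 0 ^ (2 * m) :: real" M "\<lambda>\<omega>. Y \<omega> ^ (2 * m)"] by simp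
    qed
    then show ?thesis using that[of 0] by simp
  next
    case 2
    have "has_bochner_integral M (\<lambda>\<omega>. Y \<omega> ^ (2 * m)) (gaussian_constant m * (\<sigma>\<^sup>2) ^ m)" for m
    proof -
      note H = normal_moment_even[OF 2(1), of 0 m]
      have "integrable M (\<lambda>\<omega>. Y \<omega> ^ (2 * m))"
        using distributed_integrable[OF 2(2), of "\<lambda>x. x ^ (2 * m)"] H
        by (auto simp: has_bochner_integral_iff)
      moreover have "(\<integral>\<omega>. Y \<omega> ^ (2 * m) \<partial>M) = gaussian_constant m * (\<sigma>\<^sup>2) ^ m"
        using distributed_integral[OF 2(2), of "\<lambda>x. x ^ (2 * m)"] H
        by (auto simp: has_bochner_integral_iff gaussian_constant_def field_simps)
      ultimately show ?thesis by (simp add: has_bochner_integral_iff)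
    qed
    then show ?thesis using that[of "\<sigma>\<^sup>2"] by simp
  qed
qed

lemma gaussian_square_integrable:
  assumes "prob_space M" "centered_gaussian_rv M Y"
  shows "integrable M (\<lambda>\<omega>. (Y \<omega>)\<^sup>2)"
proof -
  obtain v where "\<And>m. has_bochner_integral M (\<lambda>\<omega>. Y \<omega> ^ (2 * m)) (gaussian_constant m * v ^ m)"
    using gaussian_even_moments[OF assms] by metis
  from this[of 1] show ?thesis by (simp add: has_bochner_integral_iff)
qed

lemma gaussian_moment:
  assumes "prob_space M" "centered_gaussian_rv M Y"
  shows "(\<integral>\<^sup>+\<omega>. ennreal (Y \<omega> ^ (2 * m)) \<partial>M) = ennreal (gaussian_constant m * (\<integral>\<omega>. (Y \<omega>)\<^sup>2 \<partial>M) ^ m)"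
proof -
  obtain v where v: "\<And>m. has_bochner_integral M (\<lambda>\<omega>. Y \<omega> ^ (2 * m)) (gaussian_constant m * v ^ m)"
    using gaussian_even_moments[OF assms] by metis
  have "(\<integral>\<omega>. (Y \<omega>)\<^sup>2 \<partial>M) = v"
    using v[of 1] by (simp add: has_bochner_integral_iff gaussian_constant_def)
  moreover have "(\<integral>\<^sup>+\<omega>. ennreal (Y \<omega> ^ (2 * m)) \<partial>M) = ennreal (\<integral>\<omega>. Y \<omega> ^ (2 * m) \<partial>M)"
    using v[of m] by (intro nn_integral_eq_integral) (auto simp: has_bochner_integral_iff)
  ultimately show ?thesis using v[of m] by (simp add: has_bochner_integral_iff)
qed

section \<open>Moments of Gaussian sums with independent coefficients\<close>

lemma weighted_power_sum_le:
  fixes c a :: "'i \<Rightarrow> real"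
  assumes "finite I" "\<And>i. i \<in> I \<Longrightarrow> 0 \<le> c i" "\<And>i. i \<in> I \<Longrightarrow> 0 \<le> a i" "0 < m"
  shows "(\<Sum>i\<in>I. c i * a i) ^ m \<le> (\<Sum>i\<in>I. c i) ^ (m - 1) * (\<Sum>i\<in>I. c i * a i ^ m)"
proof (cases "(\<Sum>i\<in>I. c i) = 0")
  case True
  then have "\<And>i. i \<in> I \<Longrightarrow> c i = 0" using assms by (simp add: sum_nonneg_eq_0_iff)
  then have "(\<Sum>i\<in>I. c i * a i) = 0" "(\<Sum>i\<in>I. c i * a i ^ m) = 0" by auto
  then show ?thesis using assms(4) by (simp add: power_0_left)
next
  case False
  define S where "S = (\<Sum>i\<in>I. c i)"
  have S: "0 < S" using False assms by (simp add: S_def sum_nonneg order.not_eq_order_implies_strict)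
  have conv: "convex_on {0..} (\<lambda>x::real. x ^ m)"
    using convex_power_odd convex_on_subset[OF convex_power_even] by (cases "even m") auto
  have ne: "I \<noteq> {}" using False by auto
  have "(\<Sum>i\<in>I. (c i / S) *\<^sub>R a i) ^ m \<le> (\<Sum>i\<in>I. (c i / S) * a i ^ m)"
    using assms S ne
    by (intro convex_on_sum[OF _ _ conv]) (auto simp: sum_divide_distrib[symmetric] S_def)
  then have "((\<Sum>i\<in>I. c i * a i) / S) ^ m \<le> (\<Sum>i\<in>I. c i * a i ^ m) / S"
    by (simp add: sum_divide_distrib)
  then have "(\<Sum>i\<in>I. c i * a i) ^ m \<le> S ^ m * ((\<Sum>i\<in>I. c i * a i ^ m) / S)"
    using S by (simp add: power_divide field_simps)
  also have "\<dots> = S ^ (m - 1) * (\<Sum>i\<in>I. c i * a i ^ m)"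
    using S assms(4) by (cases m) auto
  finally show ?thesis unfolding S_def .
qed

lemma integrable_mult_of_squares:
  fixes f g :: "'w \<Rightarrow> real"
  assumes [measurable]: "f \<in> borel_measurable M" "g \<in> borel_measurable M"
    and "integrable M (\<lambda>\<omega>. (f \<omega>)\<^sup>2)" "integrable M (\<lambda>\<omega>. (g \<omega>)\<^sup>2)"
  shows "integrable M (\<lambda>\<omega>. f \<omega> * g \<omega>)"
proof (rule Bochner_Integration.integrable_bound)
  show "integrable M (\<lambda>\<omega>. (f \<omega>)\<^sup>2 + (g \<omega>)\<^sup>2)" using assms by auto
  show "AE \<omega> in M. norm (f \<omega> * g \<omega>) \<le> norm ((f \<omega>)\<^sup>2 + (g \<omega>)\<^sup>2)"
  proof (rule AE_I2)
    fix \<omega>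
    have "0 \<le> (\<bar>f \<omega>\<bar> - \<bar>g \<omega>\<bar>)\<^sup>2" by simp
    then have "2 * (\<bar>f \<omega>\<bar> * \<bar>g \<omega>\<bar>) \<le> (f \<omega>)\<^sup>2 + (g \<omega>)\<^sup>2"
      by (simp add: power2_diff)
    moreover have "0 \<le> \<bar>f \<omega>\<bar> * \<bar>g \<omega>\<bar>" by simp
    ultimately have "\<bar>f \<omega>\<bar> * \<bar>g \<omega>\<bar> \<le> (f \<omega>)\<^sup>2 + (g \<omega>)\<^sup>2" by linarith
    then show "norm (f \<omega> * g \<omega>) \<le> norm ((f \<omega>)\<^sup>2 + (g \<omega>)\<^sup>2)" by (simp add: abs_mult)
  qed
qed measurable

text \<open>Integrate over \<open>A\<close> first, with \<open>B\<close> frozen: the sum is then a centered Gaussian variable, and its moment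
is a power of its variance.  The variance is a quadratic form in the coefficients, so that its power
is estimated by Jensen's inequality and only moments of single coefficients remain.\<close>

lemma decoupled_moment:
  fixes u v :: "nat \<Rightarrow> 's \<Rightarrow> real"
  assumes M: "prob_space M" and ind: "prob_space.indep_var M S A T B"
    and mu: "\<And>j. j < n \<Longrightarrow> u j \<in> borel_measurable S" and mv: "\<And>j. j < n \<Longrightarrow> v j \<in> borel_measurable T"
    and gauss: "\<And>y :: nat \<Rightarrow> real. centered_gaussian_rv M (\<lambda>\<omega>. \<Sum>j<n. y j * u j (A \<omega>))"
    and cov: "\<And>j k. j < n \<Longrightarrow> k < n \<Longrightarrow> \<bar>\<integral>\<omega>. u j (A \<omega>) * u k (A \<omega>) \<partial>M\<bar> \<le> c j k"
    and mom: "\<And>j. j < n \<Longrightarrow> (\<integral>\<^sup>+\<omega>. ennreal (v j (B \<omega>) ^ (2 * m)) \<partial>M) \<le> ennreal b"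
    and b: "0 \<le> b" and m: "0 < m"
  shows "(\<integral>\<^sup>+\<omega>. ennreal ((\<Sum>j<n. u j (A \<omega>) * v j (B \<omega>)) ^ (2 * m)) \<partial>M)
     \<le> ennreal (gaussian_constant m * (\<Sum>j<n. \<Sum>k<n. c j k) ^ m * b)"
proof -
  interpret prob_space M by fact
  have A[measurable]: "A \<in> measurable M S" and B[measurable]: "B \<in> measurable M T"
    and D: "distr M S A \<Otimes>\<^sub>M distr M T B = distr M (S \<Otimes>\<^sub>M T) (\<lambda>x. (A x, B x))"
    using ind unfolding indep_var_distribution_eq by auto
  interpret SA: prob_space "distr M S A" by (rule prob_space_distr) fact
  interpret TB: prob_space "distr M T B" by (rule prob_space_distr) fact
  interpret P: pair_sigma_finite "distr M S A" "distr M T B" ..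
  define g where "g = (\<lambda>(a, b). ennreal ((\<Sum>j<n. u j a * v j b) ^ (2 * m)))"
  have gm: "g \<in> borel_measurable (S \<Otimes>\<^sub>M T)"
  proof -
    have "(\<lambda>(a, b). \<Sum>j<n. u j a * v j b) \<in> borel_measurable (S \<Otimes>\<^sub>M T)"
      unfolding split_beta
      by (intro borel_measurable_sum borel_measurable_times measurable_compose[OF measurable_fst mu]
          measurable_compose[OF measurable_snd mv]) auto
    then show ?thesis unfolding g_def split_beta by measurable
  qed
  have cnn: "0 \<le> c j k" if "j < n" "k < n" for j k using cov[OF that] by linarith
  have sq: "integrable M (\<lambda>\<omega>. (u j (A \<omega>))\<^sup>2)" if "j < n" for j
  proof -
    have "(\<Sum>i<n. (if i = j then 1 else 0) * u i (A \<omega>)) = u j (A \<omega>)" for \<omega>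
      using that by (simp add: if_distrib[of "\<lambda>x. x * _"] cong: if_cong)
    then show ?thesis
      using gaussian_square_integrable[OF M gauss[of "\<lambda>i. if i = j then 1 else 0"]] by simp
  qed
  have uA: "(\<lambda>\<omega>. u j (A \<omega>)) \<in> borel_measurable M" if "j < n" for j
    using measurable_compose[OF A mu[OF that]] .
  have vB: "(\<lambda>\<omega>. v j (B \<omega>)) \<in> borel_measurable M" if "j < n" for j
    using measurable_compose[OF B mv[OF that]] .
  have int_uu: "integrable M (\<lambda>\<omega>. u j (A \<omega>) * u k (A \<omega>))" if "j < n" "k < n" for j k
    using that by (intro integrable_mult_of_squares uA sq)
  define S2 where "S2 = (\<Sum>j<n. \<Sum>k<n. c j k)"
  have S2: "0 \<le> S2" unfolding S2_def using cnn by (intro sum_nonneg) auto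
  define h where "h y = (\<Sum>j<n. \<Sum>k<n. c j k / 2 * (y j ^ (2 * m) + y k ^ (2 * m)))" for y :: "nat \<Rightarrow> real"
  have inner: "(\<integral>\<^sup>+\<omega>. ennreal ((\<Sum>j<n. u j (A \<omega>) * y j) ^ (2 * m)) \<partial>M)
      \<le> ennreal (gaussian_constant m * (S2 ^ (m - 1) * h y))" for y :: "nat \<Rightarrow> real"
  proof -
    let ?V = "\<integral>\<omega>. (\<Sum>j<n. y j * u j (A \<omega>))\<^sup>2 \<partial>M"
    let ?V' = "\<Sum>j<n. \<Sum>k<n. (y j * y k) * (\<integral>\<omega>. u j (A \<omega>) * u k (A \<omega>) \<partial>M)"
    have "has_bochner_integral M (\<lambda>\<omega>. \<Sum>j<n. \<Sum>k<n. (y j * y k) * (u j (A \<omega>) * u k (A \<omega>))) ?V'"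
      by (intro has_bochner_integral_sum has_bochner_integral_mult_right has_bochner_integral_integrable int_uu) auto
    then have VV: "?V = ?V'"
      by (simp add: has_bochner_integral_iff power2_eq_square sum_product mult_ac)
    then have eq: "(\<integral>\<^sup>+\<omega>. ennreal ((\<Sum>j<n. u j (A \<omega>) * y j) ^ (2 * m)) \<partial>M)
       = ennreal (gaussian_constant m * ?V' ^ m)"
      using gaussian_moment[OF M gauss[of y], of m] by (simp add: mult.commute)
    have V0: "0 \<le> ?V'" unfolding VV[symmetric] by simp
    have "?V' \<le> (\<Sum>j<n. \<Sum>k<n. c j k * (\<bar>y j\<bar> * \<bar>y k\<bar>))"
    proof (intro sum_mono)
      fix j k assume "j \<in> {..<n}" "k \<in> {..<n}"
      then have "\<bar>y j * y k\<bar> * \<bar>\<integral>\<omega>. u j (A \<omega>) * u k (A \<omega>) \<partial>M\<bar> \<le> \<bar>y j * y k\<bar> * c j k"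
        by (intro mult_left_mono cov) auto
      then show "(y j * y k) * (\<integral>\<omega>. u j (A \<omega>) * u k (A \<omega>) \<partial>M) \<le> c j k * (\<bar>y j\<bar> * \<bar>y k\<bar>)"
        by (simp add: abs_mult[symmetric]) (metis abs_le_D1 abs_mult mult.commute)
    qed
    also have "\<dots> = (\<Sum>p\<in>{..<n}\<times>{..<n}. c (fst p) (snd p) * (\<bar>y (fst p)\<bar> * \<bar>y (snd p)\<bar>))"
      by (simp add: sum.cartesian_product split_beta)
    finally have "?V' ^ m \<le> (\<Sum>p\<in>{..<n}\<times>{..<n}. c (fst p) (snd p) * (\<bar>y (fst p)\<bar> * \<bar>y (snd p)\<bar>)) ^ m"
      using V0 by (rule power_mono)
    also have "\<dots> \<le> (\<Sum>p\<in>{..<n}\<times>{..<n}. c (fst p) (snd p)) ^ (m - 1)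
        * (\<Sum>p\<in>{..<n}\<times>{..<n}. c (fst p) (snd p) * (\<bar>y (fst p)\<bar> * \<bar>y (snd p)\<bar>) ^ m)"
      using m cnn by (intro weighted_power_sum_le) auto
    also have "(\<Sum>p\<in>{..<n}\<times>{..<n}. c (fst p) (snd p)) = S2"
      unfolding S2_def by (simp add: sum.cartesian_product split_beta)
    also have "(\<Sum>p\<in>{..<n}\<times>{..<n}. c (fst p) (snd p) * (\<bar>y (fst p)\<bar> * \<bar>y (snd p)\<bar>) ^ m) \<le> h y"
    proof -
      have "(\<bar>a\<bar> * \<bar>b\<bar>) ^ m \<le> (a ^ (2 * m) + b ^ (2 * m)) / 2" for a b :: real
      proof -
        have "0 \<le> (\<bar>a\<bar> ^ m - \<bar>b\<bar> ^ m)\<^sup>2" by simp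
        then have "2 * (\<bar>a\<bar> ^ m * \<bar>b\<bar> ^ m) \<le> (\<bar>a\<bar> ^ m)\<^sup>2 + (\<bar>b\<bar> ^ m)\<^sup>2"
          by (simp add: power2_diff)
        moreover have "(\<bar>x\<bar> ^ m)\<^sup>2 = x ^ (2 * m)" for x :: real
          by (metis power2_abs power_even_abs power_mult mult.commute even_mult_iff even_two_times_div_two dvd_triv_left)
        ultimately show ?thesis by (simp add: power_mult_distrib)
      qed
      then have "(\<Sum>p\<in>{..<n}\<times>{..<n}. c (fst p) (snd p) * (\<bar>y (fst p)\<bar> * \<bar>y (snd p)\<bar>) ^ m)
         \<le> (\<Sum>p\<in>{..<n}\<times>{..<n}. c (fst p) (snd p) * ((y (fst p) ^ (2 * m) + y (snd p) ^ (2 * m)) / 2))"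
        using cnn by (intro sum_mono mult_left_mono) auto
      also have "\<dots> = h y" unfolding h_def by (simp add: sum.cartesian_product split_beta)
      finally show ?thesis .
    qed
    finally have "?V' ^ m \<le> S2 ^ (m - 1) * h y" using S2 by (simp add: mult_left_mono)
    then show ?thesis unfolding eq
      by (intro ennreal_leI mult_left_mono gaussian_constant_nonneg)
  qed
  have pw: "ennreal (h y) = (\<Sum>j<n. \<Sum>k<n. ennreal (c j k / 2) * (ennreal (y j ^ (2 * m)) + ennreal (y k ^ (2 * m))))" for y
  proof -
    have "(\<Sum>j<n. \<Sum>k<n. ennreal (c j k / 2) * (ennreal (y j ^ (2 * m)) + ennreal (y k ^ (2 * m))))
        = (\<Sum>j<n. \<Sum>k<n. ennreal (c j k / 2 * (y j ^ (2 * m) + y k ^ (2 * m))))"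
    proof (intro sum.cong refl)
      fix j k assume "j \<in> {..<n}" "k \<in> {..<n}"
      then have "0 \<le> c j k / 2" using cnn by simp
      then show "ennreal (c j k / 2) * (ennreal (y j ^ (2 * m)) + ennreal (y k ^ (2 * m)))
          = ennreal (c j k / 2 * (y j ^ (2 * m) + y k ^ (2 * m)))"
        by (simp only: ennreal_mult' ennreal_plus zero_le_even_power' power_mult zero_le_power2 zero_le_power)
    qed
    also have "\<dots> = (\<Sum>j<n. ennreal (\<Sum>k<n. c j k / 2 * (y j ^ (2 * m) + y k ^ (2 * m))))"
      using cnn by (intro sum.cong refl sum_ennreal) auto
    also have "\<dots> = ennreal (h y)"
      unfolding h_def using cnn by (intro sum_ennreal sum_nonneg) auto
    finally show ?thesis by simp
  qed
  have hB: "(\<integral>\<^sup>+\<omega>. ennreal (h (\<lambda>j. v j (B \<omega>))) \<partial>M) \<le> ennreal (S2 * b)"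
  proof -
    have "(\<integral>\<^sup>+\<omega>. ennreal (h (\<lambda>j. v j (B \<omega>))) \<partial>M)
       = (\<integral>\<^sup>+\<omega>. (\<Sum>j<n. \<Sum>k<n. ennreal (c j k / 2) * (ennreal (v j (B \<omega>) ^ (2 * m)) + ennreal (v k (B \<omega>) ^ (2 * m)))) \<partial>M)"
      unfolding pw ..
    also have "\<dots> = (\<Sum>j<n. \<Sum>k<n. ennreal (c j k / 2) *
        ((\<integral>\<^sup>+\<omega>. ennreal (v j (B \<omega>) ^ (2 * m)) \<partial>M) + (\<integral>\<^sup>+\<omega>. ennreal (v k (B \<omega>) ^ (2 * m)) \<partial>M)))"
    proof -
      have mm: "(\<lambda>\<omega>. ennreal (v j (B \<omega>) ^ (2 * m))) \<in> borel_measurable M" if "j < n" for j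
        using vB[OF that] by measurable
      have one: "(\<integral>\<^sup>+\<omega>. ennreal (c j k / 2) * (ennreal (v j (B \<omega>) ^ (2 * m)) + ennreal (v k (B \<omega>) ^ (2 * m))) \<partial>M)
          = ennreal (c j k / 2) * ((\<integral>\<^sup>+\<omega>. ennreal (v j (B \<omega>) ^ (2 * m)) \<partial>M) + (\<integral>\<^sup>+\<omega>. ennreal (v k (B \<omega>) ^ (2 * m)) \<partial>M))"
        and [measurable]: "(\<lambda>\<omega>. ennreal (c j k / 2) * (ennreal (v j (B \<omega>) ^ (2 * m)) + ennreal (v k (B \<omega>) ^ (2 * m)))) \<in> borel_measurable M"
        if "j < n" "k < n" for j k
        using mm[OF that(1)] mm[OF that(2)] by (simp_all add: nn_integral_cmult nn_integral_add)
      show ?thesis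
        by (subst nn_integral_sum, force, intro sum.cong refl, subst nn_integral_sum, force, intro sum.cong refl one) auto
    qed
    also have "\<dots> \<le> (\<Sum>j<n. \<Sum>k<n. ennreal (c j k / 2) * (ennreal b + ennreal b))"
      by (intro sum_mono mult_left_mono add_mono mom) auto
    also have "\<dots> = ennreal (\<Sum>j<n. \<Sum>k<n. c j k * b)"
    proof -
      have "(\<Sum>j<n. \<Sum>k<n. ennreal (c j k / 2) * (ennreal b + ennreal b)) = (\<Sum>j<n. \<Sum>k<n. ennreal (c j k * b))"
        using cnn b by (intro sum.cong refl) (simp add: ennreal_mult[symmetric] ennreal_plus[symmetric] del: ennreal_plus)
      also have "\<dots> = (\<Sum>j<n. ennreal (\<Sum>k<n. c j k * b))"
        using cnn b by (intro sum.cong refl sum_ennreal) auto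
      also have "\<dots> = ennreal (\<Sum>j<n. \<Sum>k<n. c j k * b)"
        using cnn b by (intro sum_ennreal sum_nonneg) auto
      finally show ?thesis .
    qed
    also have "(\<Sum>j<n. \<Sum>k<n. c j k * b) = S2 * b" unfolding S2_def by (simp add: sum_distrib_right)
    finally show ?thesis .
  qed
  have "(\<integral>\<^sup>+\<omega>. ennreal ((\<Sum>j<n. u j (A \<omega>) * v j (B \<omega>)) ^ (2 * m)) \<partial>M)
     = (\<integral>\<^sup>+\<omega>. g (A \<omega>, B \<omega>) \<partial>M)" by (simp add: g_def)
  also have "\<dots> = (\<integral>\<^sup>+p. g p \<partial>distr M (S \<Otimes>\<^sub>M T) (\<lambda>x. (A x, B x)))"
    by (subst nn_integral_distr) (use gm in auto)
  also have "\<dots> = (\<integral>\<^sup>+p. g p \<partial>(distr M S A \<Otimes>\<^sub>M distr M T B))" unfolding D ..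
  also have "\<dots> = (\<integral>\<^sup>+b. (\<integral>\<^sup>+a. g (a, b) \<partial>distr M S A) \<partial>distr M T B)"
    by (subst P.nn_integral_snd) (use gm in \<open>auto simp: measurable_cong_sets[OF sets_pair_measure_cong[OF sets_distr sets_distr] refl]\<close>)
  also have "\<dots> \<le> (\<integral>\<^sup>+b. ennreal (gaussian_constant m * (S2 ^ (m - 1) * h (\<lambda>j. v j b))) \<partial>distr M T B)"
  proof (rule nn_integral_mono)
    fix b assume "b \<in> space (distr M T B)"
    then have b: "b \<in> space T" by simp
    have "(\<lambda>a. g (a, b)) \<in> borel_measurable S" using measurable_compose[OF measurable_Pair2'[OF b] gm] by simp
    then have "(\<integral>\<^sup>+a. g (a, b) \<partial>distr M S A) = (\<integral>\<^sup>+\<omega>. g (A \<omega>, b) \<partial>M)"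
      by (intro nn_integral_distr) auto
    also have "\<dots> \<le> ennreal (gaussian_constant m * (S2 ^ (m - 1) * h (\<lambda>j. v j b)))"
      using inner[of "\<lambda>j. v j b"] by (simp add: g_def)
    finally show "(\<integral>\<^sup>+a. g (a, b) \<partial>distr M S A) \<le> ennreal (gaussian_constant m * (S2 ^ (m - 1) * h (\<lambda>j. v j b)))" .
  qed
  also have "\<dots> = (\<integral>\<^sup>+\<omega>. ennreal (gaussian_constant m * (S2 ^ (m - 1) * h (\<lambda>j. v j (B \<omega>)))) \<partial>M)"
  proof (rule nn_integral_distr)
    have "(\<lambda>b. h (\<lambda>j. v j b)) \<in> borel_measurable T"
      unfolding h_def by (intro borel_measurable_sum borel_measurable_times borel_measurable_const
        borel_measurable_add borel_measurable_power mv) auto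
    then show "(\<lambda>b. ennreal (gaussian_constant m * (S2 ^ (m - 1) * h (\<lambda>j. v j b)))) \<in> borel_measurable (distr M T B)"
      by simp
  qed fact
  also have "\<dots> = ennreal (gaussian_constant m * S2 ^ (m - 1)) * (\<integral>\<^sup>+\<omega>. ennreal (h (\<lambda>j. v j (B \<omega>))) \<partial>M)"
  proof -
    have "(\<lambda>\<omega>. h (\<lambda>j. v j (B \<omega>))) \<in> borel_measurable M"
      unfolding h_def by (intro borel_measurable_sum borel_measurable_times borel_measurable_const
        borel_measurable_add borel_measurable_power vB) auto
    then show ?thesis
      using S2 gaussian_constant_nonneg[of m]
      by (subst nn_integral_cmult[symmetric]) (auto simp: ennreal_mult'[symmetric] mult.assoc)
  qed
  also have "\<dots> \<le> ennreal (gaussian_constant m * S2 ^ (m - 1)) * ennreal (S2 * b)"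
    by (intro mult_left_mono hB) auto
  also have "\<dots> = ennreal (gaussian_constant m * (S2 ^ (m - 1) * S2) * b)"
    using S2 gaussian_constant_nonneg[of m] by (subst ennreal_mult'[symmetric]) (auto simp: mult_ac)
  also have "S2 ^ (m - 1) * S2 = S2 ^ m" using m by (cases m) auto
  finally show ?thesis unfolding S2_def .
qed

section \<open>The covariance kernel\<close>

lemma decay_sum_le:
  fixes \<Delta> \<epsilon> :: real
  assumes "0 \<le> \<Delta>" "\<Delta> \<le> \<epsilon>" "0 < \<epsilon>"
  shows "(\<Sum>l<Suc n. \<Delta> * (\<Delta> * real l + \<epsilon>) powr (-3/2)) \<le> 3 * \<epsilon> powr (-1/2) - 2 * (\<Delta> * real n + \<epsilon>) powr (-1/2)"
proof (induction n)
  case 0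
  have "\<Delta> * \<epsilon> powr (-3/2) \<le> \<epsilon> * \<epsilon> powr (-3/2)" using assms by (intro mult_right_mono) auto
  also have "\<dots> = \<epsilon> powr (-1/2)" using assms by (simp add: powr_mult_base)
  finally show ?case by simp
next
  case (Suc n)
  define a where "a = \<Delta> * real n + \<epsilon>"
  define b where "b = \<Delta> * real (Suc n) + \<epsilon>"
  define p where "p = sqrt a"
  define r where "r = sqrt b"
  have a0: "0 < a" and ab: "a \<le> b" and D: "\<Delta> = b - a" using assms by (auto simp: a_def b_def algebra_simps intro!: add_pos_nonneg)
  have pr: "0 < p" "p \<le> r" "a = p\<^sup>2" "b = r\<^sup>2" using a0 ab by (auto simp: p_def r_def)
  have r0: "0 < r" using pr by simp
  have e1: "x powr (-1/2) = 1 / sqrt x" if "0 < x" for x :: real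
  proof -
    have "x powr (-1/2) = inverse (x powr (1/2))" by (simp add: powr_minus[symmetric])
    then show ?thesis using that by (simp add: powr_half_sqrt inverse_eq_divide)
  qed
  have e3: "x powr (-3/2) = 1 / (x * sqrt x)" if "0 < x" for x :: real
  proof -
    have "x powr (3/2) = x powr 1 * x powr (1/2)" by (simp only: powr_add[symmetric]) simp
    then have "x powr (3/2) = x * sqrt x" using that by (simp add: powr_half_sqrt)
    moreover have "x powr (-3/2) = inverse (x powr (3/2))" using powr_minus[of x "3/2"] by simp
    ultimately show ?thesis by (simp add: inverse_eq_divide)
  qed
  have "p * (r + p) \<le> r * (r + r)" using pr by (intro mult_mono) auto
  then have "(r - p) * (p * (r + p)) \<le> (r - p) * (2 * r\<^sup>2)"
    using pr by (intro mult_left_mono) (auto simp: power2_eq_square)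
  then have "(r\<^sup>2 - p\<^sup>2) * p / (p * (r\<^sup>2 * r)) \<le> 2 * (r - p) * r\<^sup>2 / (p * (r\<^sup>2 * r))"
    using pr r0 by (intro divide_right_mono) (auto simp: power2_eq_square algebra_simps)
  moreover have "2 * (r - p) * r\<^sup>2 / (p * (r\<^sup>2 * r)) = 2 * (1 / p - 1 / r)"
    using pr r0 by (simp add: field_simps)
  ultimately have "(r\<^sup>2 - p\<^sup>2) / (r\<^sup>2 * r) \<le> 2 * (1 / p - 1 / r)"
    using pr r0 by simp
  then have "\<Delta> * b powr (-3/2) \<le> 2 * (a powr (-1/2) - b powr (-1/2))"
  proof -
    assume le: "(r\<^sup>2 - p\<^sup>2) / (r\<^sup>2 * r) \<le> 2 * (1 / p - 1 / r)"
    have "b powr (-3/2) = 1 / (r\<^sup>2 * r)" using e3[of b] a0 ab unfolding pr(4)[symmetric] r_def by simp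
    moreover have "a powr (-1/2) = 1 / p" using e1[of a] a0 by (simp add: p_def)
    moreover have "b powr (-1/2) = 1 / r" using e1[of b] a0 ab by (simp add: r_def)
    moreover have "\<Delta> = r\<^sup>2 - p\<^sup>2" using D pr(3,4) by simp
    ultimately show ?thesis using le by (simp only:) simp
  qed
  then show ?case
    using Suc.IH unfolding a_def b_def by simp
qed

text \<open>Each value \<open>f l\<close> is attained at most twice as \<open>k\<close> runs to the left and to the right of \<open>j\<close>.\<close>

lemma two_sided_sum_le:
  fixes f :: "nat \<Rightarrow> real"
  assumes f: "\<And>l. 0 \<le> f l" and j: "j < N"
  shows "(\<Sum>k<N. f (if k \<le> j then j - k else k - j)) \<le> 2 * (\<Sum>l<N. f l)"
proof -
  have "{..<N} = {..j} \<union> {Suc j..<N}" using j by auto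
  moreover have "sum g ({..j} \<union> {Suc j..<N}) = sum g {..j} + sum g {Suc j..<N}" for g :: "nat \<Rightarrow> real"
    by (rule sum.union_disjoint) auto
  ultimately have "(\<Sum>k<N. f (if k \<le> j then j - k else k - j))
      = (\<Sum>k\<in>{..j}. f (if k \<le> j then j - k else k - j)) + (\<Sum>k\<in>{Suc j..<N}. f (if k \<le> j then j - k else k - j))"
    by (simp only:)
  also have "(\<Sum>k\<in>{..j}. f (if k \<le> j then j - k else k - j)) = (\<Sum>l\<in>{..j}. f l)"
    by (rule sum.reindex_bij_witness[of _ "\<lambda>l. j - l" "\<lambda>l. j - l"]) auto
  also have "(\<Sum>k\<in>{Suc j..<N}. f (if k \<le> j then j - k else k - j)) = (\<Sum>l\<in>{1..<N - j}. f l)"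
    by (rule sum.reindex_bij_witness[of _ "\<lambda>l. l + j" "\<lambda>l. l - j"]) auto
  also have "(\<Sum>l\<in>{..j}. f l) \<le> (\<Sum>l<N. f l)" using j f by (intro sum_mono2) auto
  also have "(\<Sum>l\<in>{1..<N - j}. f l) \<le> (\<Sum>l<N. f l)" using j f by (intro sum_mono2) auto
  finally show ?thesis by simp
qed

text \<open>The covariance is \<open>\<bar>x - x' + 2 \<i> \<epsilon>\<bar> powr (2 * \<alpha> - 2)\<close>.  It is split into the power \<open>-3/2\<close>, which is
summable along the line and contributes \<open>\<epsilon> powr (-1/2)\<close>, and the power \<open>2 * \<alpha> - 1/2\<close>, which is
positive because \<open>\<alpha> > 1/4\<close> and is bounded by its value at the length scale \<open>t - s + \<epsilon>\<close>.\<close>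

lemma kernel_sum_le:
  fixes \<alpha> s t \<epsilon> :: real
  assumes \<alpha>: "1/4 < \<alpha>" "\<alpha> < 1" and st: "s \<le> t" and \<epsilon>: "0 < \<epsilon>" and N: "(t - s) / real (Suc n) \<le> \<epsilon>"
  defines "\<Delta> \<equiv> (t - s) / real (Suc n)"
  shows "(\<Sum>j<Suc n. \<Sum>k<Suc n. \<Delta>\<^sup>2 *
      norm (Complex (s + \<Delta> * real j) \<epsilon> - cnj (Complex (s + \<Delta> * real k) \<epsilon>)) powr (2 * \<alpha> - 2))
    \<le> 96 * ((t - s + \<epsilon>) powr (2 * \<alpha> + 1/2) * \<epsilon> powr (-1/2))"
proof -
  define \<tau> where "\<tau> = t - s + \<epsilon>"
  define f where "f l = 4 * (\<Delta> * real l + \<epsilon>) powr (-3/2) * (2 * \<tau>) powr (2 * \<alpha> - 1/2)" for l :: nat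
  have \<Delta>: "0 \<le> \<Delta>" "\<Delta> \<le> \<epsilon>" using st N by (auto simp: \<Delta>_def)
  have \<tau>: "0 < \<tau>" using st \<epsilon> by (simp add: \<tau>_def)
  have term_le: "norm (Complex (s + \<Delta> * real j) \<epsilon> - cnj (Complex (s + \<Delta> * real k) \<epsilon>)) powr (2 * \<alpha> - 2)
      \<le> f (if k \<le> j then j - k else k - j)" if "j < Suc n" "k < Suc n" for j k
  proof -
    define l where "l = (if k \<le> j then j - k else k - j)"
    define a where "a = \<Delta> * real l"
    define d where "d = sqrt (a\<^sup>2 + (2 * \<epsilon>)\<^sup>2)"
    have a: "0 \<le> a" using \<Delta> by (simp add: a_def)
    have aT: "a \<le> t - s"
    proof -
      have "a \<le> \<Delta> * real (Suc n)" unfolding a_def using that \<Delta> by (intro mult_left_mono) (auto simp: l_def)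
      then show ?thesis by (simp add: \<Delta>_def)
    qed
    have "\<bar>\<Delta> * real j - \<Delta> * real k\<bar> = a"
      using \<Delta> by (auto simp: a_def l_def of_nat_diff right_diff_distrib[symmetric] abs_mult)
    then have "(\<Delta> * real j - \<Delta> * real k)\<^sup>2 = a\<^sup>2" by (metis power2_abs)
    then have nd: "norm (Complex (s + \<Delta> * real j) \<epsilon> - cnj (Complex (s + \<Delta> * real k) \<epsilon>)) = d"
      by (simp add: d_def cmod_def)
    have dlow: "(a + \<epsilon>) / 2 \<le> d"
    proof -
      have "(a + \<epsilon>)\<^sup>2 + (a - \<epsilon>)\<^sup>2 = 2 * a\<^sup>2 + 2 * \<epsilon>\<^sup>2" by (simp add: power2_eq_square algebra_simps)
      moreover have e: "((a + \<epsilon>) / 2)\<^sup>2 = (a + \<epsilon>)\<^sup>2 / 4" "(2 * \<epsilon>)\<^sup>2 = 4 * \<epsilon>\<^sup>2"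
        by (simp_all add: power_divide power_mult_distrib)
      ultimately have "((a + \<epsilon>) / 2)\<^sup>2 \<le> a\<^sup>2 + (2 * \<epsilon>)\<^sup>2"
        using zero_le_power2[of "a - \<epsilon>"] zero_le_power2[of a] zero_le_power2[of \<epsilon>] e by linarith
      then show ?thesis unfolding d_def by (rule real_le_rsqrt)
    qed
    have "0 < (a + \<epsilon>) / 2" using a \<epsilon> by simp
    then have d0: "0 < d" using dlow by (rule less_le_trans)
    have dup: "d \<le> 2 * \<tau>"
    proof -
      have "d \<le> \<bar>a\<bar> + \<bar>2 * \<epsilon>\<bar>" unfolding d_def by (rule sqrt_sum_squares_le_sum_abs)
      then show ?thesis using a aT \<epsilon> by (simp add: \<tau>_def)
    qed
    have "d powr (2 * \<alpha> - 2) = d powr (-3/2) * d powr (2 * \<alpha> - 1/2)"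
      by (simp add: powr_add[symmetric])
    also have "\<dots> \<le> ((a + \<epsilon>) / 2) powr (-3/2) * (2 * \<tau>) powr (2 * \<alpha> - 1/2)"
      using d0 dlow dup \<alpha> a \<epsilon> by (intro mult_mono powr_mono2' powr_mono2) auto
    also have "((a + \<epsilon>) / 2) powr (-3/2) = 2 powr (3/2) * (a + \<epsilon>) powr (-3/2)"
    proof -
      have "((a + \<epsilon>) / 2) powr (-3/2) = (a + \<epsilon>) powr (-3/2) / 2 powr (-3/2)"
        by (rule powr_divide)
      moreover have "(2::real) powr (-3/2) = inverse (2 powr (3/2))"
        using powr_minus[of "2::real" "3/2"] by (simp only: minus_divide_left)
      ultimately show ?thesis by (simp only: divide_inverse inverse_inverse_eq mult.commute)
    qed
    also have "2 powr (3/2) * (a + \<epsilon>) powr (-3/2) \<le> 4 * (a + \<epsilon>) powr (-3/2)"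
    proof -
      have "(2::real) powr (3/2) \<le> 2 powr 2" by (intro powr_mono) auto
      then show ?thesis by (intro mult_right_mono) auto
    qed
    finally have "d powr (2 * \<alpha> - 2) \<le> 4 * (a + \<epsilon>) powr (-3/2) * (2 * \<tau>) powr (2 * \<alpha> - 1/2)"
      by (simp add: mult_right_mono)
    then show ?thesis unfolding nd f_def a_def l_def .
  qed
  have f0: "0 \<le> f l" for l by (simp add: f_def)
  have decay: "(\<Sum>l<Suc n. \<Delta> * (\<Delta> * real l + \<epsilon>) powr (-3/2)) \<le> 3 * \<epsilon> powr (-1/2)"
    using decay_sum_le[OF \<Delta> \<epsilon>, of n] powr_ge_zero[of "\<Delta> * real n + \<epsilon>" "-1/2"] by linarith
  have "(\<Sum>j<Suc n. \<Sum>k<Suc n. \<Delta>\<^sup>2 *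
      norm (Complex (s + \<Delta> * real j) \<epsilon> - cnj (Complex (s + \<Delta> * real k) \<epsilon>)) powr (2 * \<alpha> - 2))
    \<le> (\<Sum>j<Suc n. \<Sum>k<Suc n. \<Delta>\<^sup>2 * f (if k \<le> j then j - k else k - j))"
    by (intro sum_mono mult_left_mono term_le) auto
  also have "\<dots> = (\<Sum>j<Suc n. \<Delta>\<^sup>2 * (\<Sum>k<Suc n. f (if k \<le> j then j - k else k - j)))"
    by (simp only: sum_distrib_left)
  also have "\<dots> \<le> (\<Sum>j<Suc n. \<Delta>\<^sup>2 * (2 * (\<Sum>l<Suc n. f l)))"
    by (intro sum_mono mult_left_mono two_sided_sum_le f0) auto
  also have "\<dots> = real (Suc n) * (\<Delta>\<^sup>2 * (2 * (\<Sum>l<Suc n. f l)))"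
    by (simp del: of_nat_Suc sum.lessThan_Suc)
  also have "\<dots> = (real (Suc n) * \<Delta>) * (2 * (\<Delta> * (\<Sum>l<Suc n. f l)))"
    by (simp only: power2_eq_square mult_ac)
  also have "\<Delta> * (\<Sum>l<Suc n. f l) = (\<Sum>l<Suc n. \<Delta> * f l)"
    by (rule sum_distrib_left)
  also have "real (Suc n) * \<Delta> = t - s" by (simp add: \<Delta>_def)
  also have "(\<Sum>l<Suc n. \<Delta> * f l) = 4 * (2 * \<tau>) powr (2 * \<alpha> - 1/2) * (\<Sum>l<Suc n. \<Delta> * (\<Delta> * real l + \<epsilon>) powr (-3/2))"
    unfolding f_def sum_distrib_left by (intro sum.cong) auto
  also have "(t - s) * (2 * (4 * (2 * \<tau>) powr (2 * \<alpha> - 1/2) * (\<Sum>l<Suc n. \<Delta> * (\<Delta> * real l + \<epsilon>) powr (-3/2))))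
      \<le> (t - s) * (2 * (4 * (2 * \<tau>) powr (2 * \<alpha> - 1/2) * (3 * \<epsilon> powr (-1/2))))"
    by (intro mult_left_mono decay) (use st in auto)
  also have "\<dots> = 24 * ((t - s) * (2 * \<tau>) powr (2 * \<alpha> - 1/2)) * \<epsilon> powr (-1/2)" by simp
  also have "\<dots> \<le> 24 * (4 * \<tau> powr (2 * \<alpha> + 1/2)) * \<epsilon> powr (-1/2)"
  proof (intro mult_right_mono mult_left_mono)
    have "(2 * \<tau>) powr (2 * \<alpha> - 1/2) = 2 powr (2 * \<alpha> - 1/2) * \<tau> powr (2 * \<alpha> - 1/2)"
      using \<tau> by (simp add: powr_mult)
    also have "\<dots> \<le> 2 powr 2 * \<tau> powr (2 * \<alpha> - 1/2)"
      using \<alpha> by (intro mult_right_mono powr_mono) auto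
    finally have "(2 * \<tau>) powr (2 * \<alpha> - 1/2) \<le> 4 * \<tau> powr (2 * \<alpha> - 1/2)" by simp
    then have "(t - s) * (2 * \<tau>) powr (2 * \<alpha> - 1/2) \<le> \<tau> * (4 * \<tau> powr (2 * \<alpha> - 1/2))"
      using st \<epsilon> \<tau> by (intro mult_mono) (auto simp: \<tau>_def)
    also have "\<dots> = 4 * \<tau> powr (2 * \<alpha> + 1/2)"
      using \<tau> by (simp add: powr_mult_base add.commute)
    finally show "(t - s) * (2 * \<tau>) powr (2 * \<alpha> - 1/2) \<le> 4 * \<tau> powr (2 * \<alpha> + 1/2)" .
  qed auto
  finally show ?thesis by (simp add: \<tau>_def)
qed

definition kernel_const :: "real \<Rightarrow> real" where
  "kernel_const \<alpha> = \<bar>\<alpha> * (1 - 2 * \<alpha>) / (2 * cos (pi * \<alpha>))\<bar>"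

lemma kernel_const_nonneg: "0 \<le> kernel_const \<alpha>" by (simp add: kernel_const_def)

lemma field_measurable:
  assumes "analytic_fbm_derivative \<alpha> M X" "z \<in> upper_half_plane"
  shows "X z \<in> borel_measurable M"
  using assms by (simp add: analytic_fbm_derivative_def complex_centered_gaussian_process_def)

lemma field_combination_gaussian:
  fixes z :: "nat \<Rightarrow> complex"
  assumes X: "analytic_fbm_derivative \<alpha> M X" and z: "\<And>j. j < n \<Longrightarrow> z j \<in> upper_half_plane"
  shows "centered_gaussian_rv M (\<lambda>\<omega>. \<Sum>j<n. y j * Re (c * X (z j) \<omega>))"
proof -
  let ?F = "z ` {..<n}"
  define C where "C w = (\<Sum>j\<in>{j \<in> {..<n}. z j = w}. of_real (y j) * c)" for w
  have F: "finite ?F" "?F \<subseteq> upper_half_plane" using z by auto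
  have "(\<Sum>j<n. y j * Re (c * X (z j) \<omega>)) = Re (\<Sum>w\<in>?F. C w * X w \<omega>)" for \<omega>
  proof -
    have "(\<Sum>j<n. y j * Re (c * X (z j) \<omega>)) = Re (\<Sum>j<n. of_real (y j) * c * X (z j) \<omega>)"
      unfolding Re_sum by (intro sum.cong refl) (simp add: mult.assoc)
    also have "(\<Sum>j<n. of_real (y j) * c * X (z j) \<omega>)
        = (\<Sum>w\<in>?F. \<Sum>j\<in>{j \<in> {..<n}. z j = w}. of_real (y j) * c * X (z j) \<omega>)"
      by (rule sum.image_gen) simp
    also have "\<dots> = (\<Sum>w\<in>?F. C w * X w \<omega>)"
      unfolding C_def sum_distrib_right by (intro sum.cong refl) auto
    finally show ?thesis .
  qed
  then show ?thesis
    using X F unfolding analytic_fbm_derivative_def complex_centered_gaussian_process_def by simp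
qed

lemma field_gaussian:
  assumes X: "analytic_fbm_derivative \<alpha> M X" and z: "z \<in> upper_half_plane"
  shows "centered_gaussian_rv M (\<lambda>\<omega>. Re (c * X z \<omega>))"
  using field_combination_gaussian[OF X, of 1 "\<lambda>_. z" "\<lambda>_. 1" c] z by simp

lemma field_norm_square_integrable:
  assumes M: "prob_space M" and X: "analytic_fbm_derivative \<alpha> M X" and z: "z \<in> upper_half_plane"
  shows "integrable M (\<lambda>\<omega>. (norm (X z \<omega>))\<^sup>2)"
proof -
  have "integrable M (\<lambda>\<omega>. (Re (1 * X z \<omega>))\<^sup>2 + (Re (- \<i> * X z \<omega>))\<^sup>2)"
    by (intro Bochner_Integration.integrable_add gaussian_square_integrable[OF M] field_gaussian[OF X z])
  then show ?thesis by (simp add: cmod_power2)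
qed

lemma field_product_integrable:
  assumes M: "prob_space M" and X: "analytic_fbm_derivative \<alpha> M X"
    and z: "z \<in> upper_half_plane" and w: "w \<in> upper_half_plane"
  shows "integrable M (\<lambda>\<omega>. X z \<omega> * X w \<omega>)" "integrable M (\<lambda>\<omega>. X z \<omega> * cnj (X w \<omega>))"
proof -
  note [measurable] = field_measurable[OF X z] field_measurable[OF X w]
  have [measurable]: "cnj \<in> borel_measurable borel"
    by (intro borel_measurable_continuous_onI continuous_intros)
  have I: "integrable M (\<lambda>\<omega>. norm (X z \<omega>) * norm (X w \<omega>))"
    by (intro integrable_mult_of_squares field_norm_square_integrable[OF M X] z w) measurable
  show "integrable M (\<lambda>\<omega>. X z \<omega> * X w \<omega>)"
    by (rule Bochner_Integration.integrable_bound[OF I]) (auto simp: norm_mult)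
  show "integrable M (\<lambda>\<omega>. X z \<omega> * cnj (X w \<omega>))"
    by (rule Bochner_Integration.integrable_bound[OF I]) (auto simp: norm_mult)
qed

text \<open>Writing \<open>Re a * Re b\<close> as half the real part of \<open>a * b + a * cnj b\<close> leaves only the mixed covariance,
since the expectation of \<open>X z * X w\<close> vanishes.\<close>

lemma field_covariance_bound:
  assumes M: "prob_space M" and X: "analytic_fbm_derivative \<alpha> M X"
    and z: "z \<in> upper_half_plane" and w: "w \<in> upper_half_plane" and c: "norm c = 1"
  shows "\<bar>\<integral>\<omega>. Re (c * X z \<omega>) * Re (c * X w \<omega>) \<partial>M\<bar>
     \<le> kernel_const \<alpha> * norm (z - cnj w) powr (2 * \<alpha> - 2)"
proof -
  note I = field_product_integrable[OF M X z w]
  have E0: "(\<integral>\<omega>. X z \<omega> * X w \<omega> \<partial>M) = 0"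
    and E1: "(\<integral>\<omega>. X z \<omega> * cnj (X w \<omega>) \<partial>M) =
        complex_of_real (\<alpha> * (1 - 2 * \<alpha>) / (2 * cos (pi * \<alpha>))) *
          (- \<i> * (z - cnj w)) powr complex_of_real (2 * \<alpha> - 2)"
    using X z w unfolding analytic_fbm_derivative_def reflected_process_def by simp_all
  have cc: "c * cnj c = 1" using c by (simp add: complex_norm_square[symmetric])
  have "(\<lambda>\<omega>. Re (c * X z \<omega>) * Re (c * X w \<omega>))
      = (\<lambda>\<omega>. Re (c\<^sup>2 * (X z \<omega> * X w \<omega>) + X z \<omega> * cnj (X w \<omega>)) / 2)"
  proof
    fix \<omega>
    have "Re a * Re b = Re (a * b + a * cnj b) / 2" for a b :: complex by simp
    from this[of "c * X z \<omega>" "c * X w \<omega>"]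
    have "Re (c * X z \<omega>) * Re (c * X w \<omega>) = Re (c\<^sup>2 * (X z \<omega> * X w \<omega>) + (c * cnj c) * (X z \<omega> * cnj (X w \<omega>))) / 2"
      by (simp only: complex_cnj_mult power2_eq_square mult_ac)
    then show "Re (c * X z \<omega>) * Re (c * X w \<omega>) = Re (c\<^sup>2 * (X z \<omega> * X w \<omega>) + X z \<omega> * cnj (X w \<omega>)) / 2"
      unfolding cc by simp
  qed
  then have "(\<integral>\<omega>. Re (c * X z \<omega>) * Re (c * X w \<omega>) \<partial>M)
      = Re (\<integral>\<omega>. c\<^sup>2 * (X z \<omega> * X w \<omega>) + X z \<omega> * cnj (X w \<omega>) \<partial>M) / 2"
    using I by (simp del: plus_complex.sel times_complex.sel)
  also have "(\<integral>\<omega>. c\<^sup>2 * (X z \<omega> * X w \<omega>) + X z \<omega> * cnj (X w \<omega>) \<partial>M) = (\<integral>\<omega>. X z \<omega> * cnj (X w \<omega>) \<partial>M)"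
    using I E0 by simp
  finally have "\<bar>\<integral>\<omega>. Re (c * X z \<omega>) * Re (c * X w \<omega>) \<partial>M\<bar> \<le> norm (\<integral>\<omega>. X z \<omega> * cnj (X w \<omega>) \<partial>M) / 2"
    using abs_Re_le_cmod[of "\<integral>\<omega>. X z \<omega> * cnj (X w \<omega>) \<partial>M"] by simp
  also have "norm (\<integral>\<omega>. X z \<omega> * cnj (X w \<omega>) \<partial>M) = kernel_const \<alpha> * norm (z - cnj w) powr (2 * \<alpha> - 2)"
    unfolding E1 norm_mult norm_of_real kernel_const_def by (subst norm_powr_real_powr') (auto simp: norm_mult)
  finally show ?thesis
    using kernel_const_nonneg[of \<alpha>] by (smt (verit) field_sum_of_halves mult_nonneg_nonneg powr_ge_zero)
qed

lemma field_moment: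
  assumes M: "prob_space M" and X: "analytic_fbm_derivative \<alpha> M X" and "\<alpha> < 1"
    and y: "0 < y" and c: "norm c = 1"
  shows "(\<integral>\<^sup>+\<omega>. ennreal (Re (c * X (Complex x y) \<omega>) ^ (2 * m)) \<partial>M)
    \<le> ennreal (gaussian_constant m * (kernel_const \<alpha> * y powr (2 * \<alpha> - 2)) ^ m)"
proof -
  have z: "Complex x y \<in> upper_half_plane" using y by simp
  have "(\<integral>\<omega>. (Re (c * X (Complex x y) \<omega>))\<^sup>2 \<partial>M) \<le> kernel_const \<alpha> * norm (Complex x y - cnj (Complex x y)) powr (2 * \<alpha> - 2)"
    using field_covariance_bound[OF M X z z c] by (simp add: power2_eq_square)
  also have "\<dots> \<le> kernel_const \<alpha> * y powr (2 * \<alpha> - 2)"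
    using kernel_const_nonneg y assms(3) by (intro mult_left_mono powr_mono2') (auto simp: cmod_def real_sqrt_mult)
  finally show ?thesis
    unfolding gaussian_moment[OF M field_gaussian[OF X z]]
    by (intro ennreal_leI mult_left_mono power_mono gaussian_constant_nonneg) auto
qed

abbreviation path_space :: "nat set \<Rightarrow> (nat \<Rightarrow> complex \<Rightarrow> complex) measure" where
  "path_space J \<equiv> PiM J (\<lambda>_. PiM upper_half_plane (\<lambda>_. borel))"

text \<open>The sample paths with indices in \<open>J\<close>, restricted to the half-plane: the random element to which
independence refers.\<close>

abbreviation paths :: "(nat \<Rightarrow> complex \<Rightarrow> 'w \<Rightarrow> complex) \<Rightarrow> nat set \<Rightarrow> 'w \<Rightarrow> nat \<Rightarrow> complex \<Rightarrow> complex" where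
  "paths X J \<omega> \<equiv> \<lambda>k\<in>J. \<lambda>z\<in>upper_half_plane. X k z \<omega>"

lemma evaluation_measurable:
  assumes "k \<in> I" "z \<in> upper_half_plane"
  shows "(\<lambda>a. a k z) \<in> borel_measurable (path_space I)"
  using measurable_compose[OF measurable_component_singleton[OF assms(1), of "\<lambda>_. PiM upper_half_plane (\<lambda>_. borel)"]
      measurable_component_singleton[OF assms(2), of "\<lambda>_. borel"]]
  by simp

text \<open>The mesh must not exceed \<open>\<epsilon>\<close>, the scale on which the covariance varies.\<close>

lemma field_riemann_moment:
  fixes v :: "real \<Rightarrow> (nat \<Rightarrow> complex \<Rightarrow> complex) \<Rightarrow> real"
  assumes M: "prob_space M" and X: "analytic_fbm_derivative \<alpha> M (X i)" and \<alpha>: "1/4 < \<alpha>" "\<alpha> < 1"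
    and ind: "prob_space.indep_var M (path_space {i})
      (paths X {i}) T B"
    and v: "\<And>x. v x \<in> borel_measurable T"
    and mom: "\<And>x. (\<integral>\<^sup>+\<omega>. ennreal (v x (B \<omega>) ^ (2 * m)) \<partial>M) \<le> ennreal b" and b: "0 \<le> b"
    and m: "0 < m" and c: "norm c = 1"
    and st: "s \<le> t" and \<epsilon>: "0 < \<epsilon>" and n: "(t - s) / real (Suc n) \<le> \<epsilon>"
  shows "(\<integral>\<^sup>+\<omega>. ennreal (riemann_sum s t n (\<lambda>x. Re (c * X i (Complex x \<epsilon>) \<omega>) * v x (B \<omega>)) ^ (2 * m)) \<partial>M)
    \<le> ennreal (gaussian_constant m *
        (96 * kernel_const \<alpha> * ((t - s + \<epsilon>) powr (2 * \<alpha> + 1/2) * \<epsilon> powr (-1/2))) ^ m * b)"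
proof -
  define \<Delta> where "\<Delta> = (t - s) / real (Suc n)"
  define p where "p j = Complex (s + \<Delta> * real j) \<epsilon>" for j
  have p: "p j \<in> upper_half_plane" for j using \<epsilon> by (simp add: p_def)
  define u where "u j a = \<Delta> * Re (c * a i (p j))" for j and a :: "nat \<Rightarrow> complex \<Rightarrow> complex"
  define cc where "cc j k = kernel_const \<alpha> * (\<Delta>\<^sup>2 * norm (p j - cnj (p k)) powr (2 * \<alpha> - 2))" for j k
  let ?A = "\<lambda>\<omega>. \<lambda>k\<in>{i}. \<lambda>z\<in>upper_half_plane. X k z \<omega>"
  have uA: "u j (?A \<omega>) = \<Delta> * Re (c * X i (p j) \<omega>)" for j \<omega> using p by (simp add: u_def)
  have "(\<integral>\<^sup>+\<omega>. ennreal ((\<Sum>j<Suc n. u j (?A \<omega>) * v (s + \<Delta> * real j) (B \<omega>)) ^ (2 * m)) \<partial>M)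
     \<le> ennreal (gaussian_constant m * (\<Sum>j<Suc n. \<Sum>k<Suc n. cc j k) ^ m * b)"
  proof (rule decoupled_moment[OF M ind])
    show "u j \<in> borel_measurable (path_space {i})" for j
      unfolding u_def using evaluation_measurable[of i "{i}" "p j"] p[of j] by measurable
    show "centered_gaussian_rv M (\<lambda>\<omega>. \<Sum>j<Suc n. y j * u j (?A \<omega>))" for y
      using field_combination_gaussian[OF X p, where n = "Suc n" and y = "\<lambda>j. y j * \<Delta>" and c = c] unfolding uA by (simp add: mult.assoc)
    show "\<bar>\<integral>\<omega>. u j (?A \<omega>) * u k (?A \<omega>) \<partial>M\<bar> \<le> cc j k" for j k
    proof -
      have "(\<integral>\<omega>. u j (?A \<omega>) * u k (?A \<omega>) \<partial>M) = \<Delta>\<^sup>2 * (\<integral>\<omega>. Re (c * X i (p j) \<omega>) * Re (c * X i (p k) \<omega>) \<partial>M)"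
        unfolding uA by (subst integral_mult_right_zero[symmetric]) (simp add: power2_eq_square mult_ac)
      then have "\<bar>\<integral>\<omega>. u j (?A \<omega>) * u k (?A \<omega>) \<partial>M\<bar> = \<Delta>\<^sup>2 * \<bar>\<integral>\<omega>. Re (c * X i (p j) \<omega>) * Re (c * X i (p k) \<omega>) \<partial>M\<bar>"
        by (simp add: abs_mult)
      also have "\<dots> \<le> \<Delta>\<^sup>2 * (kernel_const \<alpha> * norm (p j - cnj (p k)) powr (2 * \<alpha> - 2))"
        by (intro mult_left_mono field_covariance_bound[OF M X p p c]) auto
      finally show ?thesis by (simp add: cc_def mult_ac)
    qed
  qed (use v mom b m in auto)
  also have "(\<Sum>j<Suc n. \<Sum>k<Suc n. cc j k)
      = kernel_const \<alpha> * (\<Sum>j<Suc n. \<Sum>k<Suc n. \<Delta>\<^sup>2 * norm (p j - cnj (p k)) powr (2 * \<alpha> - 2))"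
    unfolding cc_def by (simp only: sum_distrib_left)
  also have "ennreal (gaussian_constant m * (\<dots>) ^ m * b)
     \<le> ennreal (gaussian_constant m * (kernel_const \<alpha> * (96 * ((t - s + \<epsilon>) powr (2 * \<alpha> + 1/2) * \<epsilon> powr (-1/2)))) ^ m * b)"
    unfolding p_def \<Delta>_def
    by (intro ennreal_leI mult_right_mono mult_left_mono power_mono kernel_sum_le
         gaussian_constant_nonneg kernel_const_nonneg mult_nonneg_nonneg sum_nonneg b \<alpha> st \<epsilon> n) auto
  also have "(\<lambda>\<omega>. \<Sum>j<Suc n. u j (?A \<omega>) * v (s + \<Delta> * real j) (B \<omega>))
      = (\<lambda>\<omega>. riemann_sum s t n (\<lambda>x. Re (c * X i (Complex x \<epsilon>) \<omega>) * v x (B \<omega>)))"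
    unfolding riemann_sum_def uA sum_distrib_left p_def \<Delta>_def by (simp add: mult.assoc)
  finally show ?thesis by (simp add: mult_ac)
qed

section \<open>Almost sure growth of the field at the boundary\<close>

lemma le_of_power_le:
  fixes a C :: real
  assumes "0 \<le> a" "a ^ n \<le> C" "0 < n"
  shows "a \<le> 1 + C"
proof (cases "a \<le> 1")
  case True
  moreover have "0 \<le> a ^ n" using assms by simp
  ultimately show ?thesis using assms by linarith
next
  case False
  then have "a ^ 1 \<le> a ^ n" using assms by (intro power_increasing) auto
  then show ?thesis using assms by simp
qed

lemma dyadic_scale:
  fixes u :: real
  assumes "0 < u" "u \<le> 1"
  obtains k :: nat where "(1/2) ^ Suc k < u" "u \<le> (1/2) ^ k"
proof -
  obtain n where n: "(1/2::real) ^ n < u" using real_arch_pow_inv[of u "1/2"] assms by auto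
  define l where "l = (LEAST n. (1/2::real) ^ n < u)"
  have l: "(1/2) ^ l < u" unfolding l_def using n by (rule LeastI)
  have "l \<noteq> 0" using l assms by (intro notI) simp
  then obtain k where k: "l = Suc k" using not0_implies_Suc by blast
  have "\<not> (1/2) ^ k < u" using not_less_Least[of k "\<lambda>n. (1/2::real) ^ n < u"] k l_def by simp
  then show ?thesis using that[of k] l k by simp
qed

text \<open>Cauchy's formula.  It controls the field on a whole disc by an average over one circle, and this
replaces any chaining argument for the supremum.\<close>

lemma norm_le_circle_average:
  assumes f: "f holomorphic_on cball z0 r" and r: "0 < r" and z: "dist z0 z \<le> \<rho>" "\<rho> < r"
  shows "norm (f z) \<le> r / (r - \<rho>) * integral {0..1} (\<lambda>x. norm (f (circlepath z0 r x)))"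
proof -
  let ?\<gamma> = "circlepath z0 r"
  let ?g = "\<lambda>x. f (?\<gamma> x) / (?\<gamma> x - z) * vector_derivative ?\<gamma> (at x within {0..1})"
  have zb: "norm (z - z0) < r" using z by (simp add: dist_norm norm_minus_commute)
  have on: "?\<gamma> x \<in> sphere z0 r" for x using r by (simp add: circlepath dist_norm norm_mult)
  have H: "(?g has_integral (2 * of_real pi * \<i> * f z)) {0..1}"
    using Cauchy_integral_circlepath_simple[OF f zb] by (simp add: has_contour_integral_def)
  have c\<gamma>: "continuous_on {0..1} ?\<gamma>" using path_circlepath unfolding path_def by blast
  have cn: "continuous_on {0..1} (\<lambda>x. norm (f (?\<gamma> x)))"
    using on holomorphic_on_imp_continuous_on[OF f]
    by (intro continuous_on_norm continuous_on_compose2[OF _ c\<gamma>]) (auto simp: sphere_cball[THEN subsetD])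
  have "norm (integral {0..1} ?g) \<le> integral {0..1} (\<lambda>x. (2 * pi * r / (r - \<rho>)) * norm (f (?\<gamma> x)))"
  proof (rule integral_norm_bound_integral)
    show "?g integrable_on {0..1}" using H by blast
    show "(\<lambda>x. (2 * pi * r / (r - \<rho>)) * norm (f (?\<gamma> x))) integrable_on {0..1}"
      by (intro integrable_continuous_interval continuous_intros cn)
    fix x :: real assume x: "x \<in> {0..1}"
    have "r - \<rho> \<le> norm (?\<gamma> x - z)"
    proof -
      have "dist z0 (?\<gamma> x) \<le> dist z0 z + dist z (?\<gamma> x)" by (rule dist_triangle)
      then show ?thesis using on[of x] z by (simp add: dist_norm norm_minus_commute)
    qed
    then have "norm (f (?\<gamma> x)) / norm (?\<gamma> x - z) * (2 * pi * r) \<le> norm (f (?\<gamma> x)) / (r - \<rho>) * (2 * pi * r)"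
      using z r by (intro mult_right_mono divide_left_mono mult_pos_pos) auto
    then show "norm (?g x) \<le> (2 * pi * r / (r - \<rho>)) * norm (f (?\<gamma> x))"
      using x r by (simp add: vector_derivative_circlepath01 norm_mult norm_divide mult_ac)
  qed
  then have "2 * pi * norm (f z) \<le> (2 * pi) * (r / (r - \<rho>) * integral {0..1} (\<lambda>x. norm (f (?\<gamma> x))))"
    using integral_unique[OF H] by (simp add: norm_mult)
  then show ?thesis by (simp only: mult_le_cancel_left_pos pi_gt_zero mult_pos_pos zero_less_numeral)
qed

lemma field_norm_moment:
  assumes M: "prob_space M" and X: "analytic_fbm_derivative \<alpha> M X" and "\<alpha> < 1" and y: "0 < y" and m: "0 < m"
  shows "(\<integral>\<^sup>+\<omega>. ennreal (norm (X (Complex x y) \<omega>) ^ (2 * m)) \<partial>M)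
    \<le> ennreal (2 ^ (2 * m) * (gaussian_constant m * (kernel_const \<alpha> * y powr (2 * \<alpha> - 2)) ^ m))"
proof -
  let ?z = "Complex x y"
  let ?B = "gaussian_constant m * (kernel_const \<alpha> * y powr (2 * \<alpha> - 2)) ^ m"
  have [measurable]: "X ?z \<in> borel_measurable M" using y by (intro field_measurable[OF X]) simp
  have B: "0 \<le> ?B" using gaussian_constant_nonneg kernel_const_nonneg by simp
  have pt: "norm w ^ (2 * m) \<le> 2 ^ (2 * m - 1) * (Re (1 * w) ^ (2 * m) + Re (- \<i> * w) ^ (2 * m))" for w :: complex
  proof -
    have "norm w ^ (2 * m) \<le> (\<bar>Re w\<bar> + \<bar>Im w\<bar>) ^ (2 * m)"
      by (intro power_mono cmod_le) auto
    also have "\<dots> = (\<Sum>i\<in>{True, False}. 1 * (if i then \<bar>Re w\<bar> else \<bar>Im w\<bar>)) ^ (2 * m)" by simp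
    also have "\<dots> \<le> (\<Sum>i\<in>{True, False}. 1) ^ (2 * m - 1) * (\<Sum>i\<in>{True, False}. 1 * (if i then \<bar>Re w\<bar> else \<bar>Im w\<bar>) ^ (2 * m))"
      using m by (intro weighted_power_sum_le) auto
    also have "\<dots> = 2 ^ (2 * m - 1) * (Re w ^ (2 * m) + Im w ^ (2 * m))" by (simp add: power_even_abs)
    finally show ?thesis by simp
  qed
  have "(\<integral>\<^sup>+\<omega>. ennreal (norm (X ?z \<omega>) ^ (2 * m)) \<partial>M)
     \<le> (\<integral>\<^sup>+\<omega>. ennreal (2 ^ (2 * m - 1)) * (ennreal (Re (1 * X ?z \<omega>) ^ (2 * m)) + ennreal (Re (- \<i> * X ?z \<omega>) ^ (2 * m))) \<partial>M)"
  proof (rule nn_integral_mono)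
    fix \<omega>
    have "ennreal (norm (X ?z \<omega>) ^ (2 * m)) \<le> ennreal (2 ^ (2 * m - 1) * (Re (1 * X ?z \<omega>) ^ (2 * m) + Re (- \<i> * X ?z \<omega>) ^ (2 * m)))"
      by (rule ennreal_leI) (rule pt)
    also have "\<dots> = ennreal (2 ^ (2 * m - 1)) * (ennreal (Re (1 * X ?z \<omega>) ^ (2 * m)) + ennreal (Re (- \<i> * X ?z \<omega>) ^ (2 * m)))"
      by (subst ennreal_mult) (auto simp: ennreal_plus)
    finally show "ennreal (norm (X ?z \<omega>) ^ (2 * m))
      \<le> ennreal (2 ^ (2 * m - 1)) * (ennreal (Re (1 * X ?z \<omega>) ^ (2 * m)) + ennreal (Re (- \<i> * X ?z \<omega>) ^ (2 * m)))" .
  qed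
  also have "\<dots> = ennreal (2 ^ (2 * m - 1)) *
      ((\<integral>\<^sup>+\<omega>. ennreal (Re (1 * X ?z \<omega>) ^ (2 * m)) \<partial>M) + (\<integral>\<^sup>+\<omega>. ennreal (Re (- \<i> * X ?z \<omega>) ^ (2 * m)) \<partial>M))"
    by (subst nn_integral_cmult, measurable, subst nn_integral_add) auto
  also have "\<dots> \<le> ennreal (2 ^ (2 * m - 1)) * (ennreal ?B + ennreal ?B)"
    using y assms(3) by (intro mult_left_mono add_mono field_moment[OF M X]) auto
  also have "\<dots> = ennreal (2 ^ (2 * m - 1) * (?B + ?B))"
    using B by (simp only: ennreal_mult ennreal_plus zero_le_power zero_le_numeral add_nonneg_nonneg)
  also have "2 ^ (2 * m - 1) * (?B + ?B) = 2 ^ (2 * m) * ?B"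
    using m by (cases m) auto
  finally show ?thesis .
qed

lemma circle_average_moment:
  assumes M: "prob_space M" and X: "analytic_fbm_derivative \<alpha> M X" and "\<alpha> < 1"
    and r: "0 < r" "r + h \<le> Im z0" and h: "0 < h" and m: "0 < m"
  shows "(\<integral>\<^sup>+\<omega>. ennreal (riemann_sum 0 1 n (\<lambda>x. norm (X (circlepath z0 r x) \<omega>)) ^ (2 * m)) \<partial>M)
    \<le> ennreal (2 ^ (2 * m) * (gaussian_constant m * (kernel_const \<alpha> * h powr (2 * \<alpha> - 2)) ^ m))"
proof -
  let ?B = "2 ^ (2 * m) * (gaussian_constant m * (kernel_const \<alpha> * h powr (2 * \<alpha> - 2)) ^ m)"
  let ?N = "real (Suc n)"
  define p where "p j = circlepath z0 r (0 + (1 - 0) / ?N * real j)" for j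
  have ph: "h \<le> Im (p j)" for j
  proof -
    have "norm (p j - z0) = r" using r by (simp add: p_def circlepath norm_mult)
    then have "\<bar>Im (p j - z0)\<bar> \<le> r" using abs_Im_le_cmod[of "p j - z0"] by simp
    then show ?thesis using r by simp
  qed
  have B: "0 \<le> ?B" using gaussian_constant_nonneg kernel_const_nonneg by simp
  have [measurable]: "X (p j) \<in> borel_measurable M" for j
    using ph[of j] h by (intro field_measurable[OF X]) (simp add: upper_half_plane_def)
  have mom: "(\<integral>\<^sup>+\<omega>. ennreal (norm (X (p j) \<omega>) ^ (2 * m)) \<partial>M) \<le> ennreal ?B" for j
  proof -
    have "(\<integral>\<^sup>+\<omega>. ennreal (norm (X (p j) \<omega>) ^ (2 * m)) \<partial>M)
       \<le> ennreal (2 ^ (2 * m) * (gaussian_constant m * (kernel_const \<alpha> * Im (p j) powr (2 * \<alpha> - 2)) ^ m))"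
      using field_norm_moment[OF M X assms(3), of "Im (p j)" m "Re (p j)"] ph[of j] h m by simp
    also have "\<dots> \<le> ennreal ?B"
      using ph[of j] h assms(3) gaussian_constant_nonneg kernel_const_nonneg
      by (intro ennreal_leI mult_left_mono power_mono powr_mono2') auto
    finally show ?thesis .
  qed
  have "(\<integral>\<^sup>+\<omega>. ennreal (riemann_sum 0 1 n (\<lambda>x. norm (X (circlepath z0 r x) \<omega>)) ^ (2 * m)) \<partial>M)
     \<le> (\<integral>\<^sup>+\<omega>. (\<Sum>j<Suc n. ennreal (1 / ?N) * ennreal (norm (X (p j) \<omega>) ^ (2 * m))) \<partial>M)"
  proof (rule nn_integral_mono)
    fix \<omega>
    have "riemann_sum 0 1 n (\<lambda>x. norm (X (circlepath z0 r x) \<omega>)) = (\<Sum>j<Suc n. 1 / ?N * norm (X (p j) \<omega>))"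
      unfolding riemann_sum_def p_def sum_distrib_left by simp
    then have "riemann_sum 0 1 n (\<lambda>x. norm (X (circlepath z0 r x) \<omega>)) ^ (2 * m)
       \<le> (\<Sum>j<Suc n. 1 / ?N) ^ (2 * m - 1) * (\<Sum>j<Suc n. 1 / ?N * norm (X (p j) \<omega>) ^ (2 * m))"
      using m by (simp only:) (intro weighted_power_sum_le, auto)
    also have "(\<Sum>j<Suc n. 1 / ?N) = 1" by simp
    finally have "ennreal (riemann_sum 0 1 n (\<lambda>x. norm (X (circlepath z0 r x) \<omega>)) ^ (2 * m))
       \<le> ennreal (\<Sum>j<Suc n. 1 / ?N * norm (X (p j) \<omega>) ^ (2 * m))"
      by (intro ennreal_leI) simp
    also have "\<dots> = (\<Sum>j<Suc n. ennreal (1 / ?N * norm (X (p j) \<omega>) ^ (2 * m)))"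
      by (rule sum_ennreal[symmetric]) auto
    also have "\<dots> = (\<Sum>j<Suc n. ennreal (1 / ?N) * ennreal (norm (X (p j) \<omega>) ^ (2 * m)))"
      by (intro sum.cong refl ennreal_mult) auto
    finally show "ennreal (riemann_sum 0 1 n (\<lambda>x. norm (X (circlepath z0 r x) \<omega>)) ^ (2 * m))
       \<le> (\<Sum>j<Suc n. ennreal (1 / ?N) * ennreal (norm (X (p j) \<omega>) ^ (2 * m)))" .
  qed
  also have "\<dots> = (\<Sum>j<Suc n. \<integral>\<^sup>+\<omega>. ennreal (1 / ?N) * ennreal (norm (X (p j) \<omega>) ^ (2 * m)) \<partial>M)"
    by (rule nn_integral_sum) measurable
  also have "\<dots> = (\<Sum>j<Suc n. ennreal (1 / ?N) * (\<integral>\<^sup>+\<omega>. ennreal (norm (X (p j) \<omega>) ^ (2 * m)) \<partial>M))"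
    by (intro sum.cong refl nn_integral_cmult) measurable
  also have "\<dots> \<le> (\<Sum>j<Suc n. ennreal (1 / ?N) * ennreal ?B)"
    by (intro sum_mono mult_left_mono mom) auto
  also have "\<dots> = (\<Sum>j<Suc n. ennreal (1 / ?N * ?B))"
    using B by (intro sum.cong refl ennreal_mult[symmetric]) auto
  also have "\<dots> = ennreal (\<Sum>j<Suc n. 1 / ?N * ?B)"
    using B by (intro sum_ennreal) auto
  also have "(\<Sum>j<Suc n. 1 / ?N * ?B) = ?B" by (simp only: sum_constant card_lessThan) simp
  finally show ?thesis .
qed

text \<open>The strip is covered by discs whose radii are comparable to their heights.  At height \<open>2 ^ (-k)\<close> there are
of the order of \<open>2 ^ k\<close> of them, while the normalized \<open>2 m\<close>-th moments on the circles are of order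
\<open>2 ^ (- 2 m (\<alpha> - \<beta>) k)\<close>; the choice of \<open>m\<close> makes the product summable.\<close>

lemma field_sup_bound:
  assumes M: "prob_space M" and X: "analytic_fbm_derivative \<alpha> M X" and \<beta>: "\<beta> < \<alpha>" "0 < \<alpha>" "\<alpha> < 1" and R: "0 < R"
  shows "AE \<omega> in M. \<exists>C\<ge>0. \<forall>x y. \<bar>x\<bar> \<le> R \<longrightarrow> 0 < y \<longrightarrow> y \<le> R \<longrightarrow>
      norm (X (Complex x y) \<omega>) \<le> C * y powr (\<beta> - 1)"
proof -
  define m where "m = Suc (nat \<lceil>1 / (\<alpha> - \<beta>)\<rceil>)"
  have m: "0 < m" by (simp add: m_def)
  have "1 / (\<alpha> - \<beta>) \<le> real m" unfolding m_def by linarith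
  then have m2: "2 \<le> (2 * (\<alpha> - \<beta>)) * real m" using \<beta> by (simp add: field_simps)
  define \<rho> where "\<rho> k = R * (1/2) ^ k" for k :: nat
  have \<rho>: "0 < \<rho> k" for k using R by (simp add: \<rho>_def)
  \<comment> \<open>A disc of radius \<open>3/8 * \<rho> k\<close> around such a centre covers the points of heights between \<open>\<rho> k / 2\<close> and
    \<open>\<rho> k\<close> over an interval of length \<open>\<rho> k / 8\<close>; the circle of radius \<open>5/8 * \<rho> k\<close> stays above height \<open>\<rho> k / 8\<close>.\<close>
  define zc where "zc k j = Complex (\<rho> k / 8 * real_of_int j) (3/4 * \<rho> k)" for k and j :: int
  let ?r = "\<lambda>k. 5/8 * \<rho> k"
  let ?I = "\<lambda>k j \<omega>. integral {0..1} (\<lambda>x. norm (X (circlepath (zc k j) (?r k) x) \<omega>))"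
  define B where "B k = 2 ^ (2 * m) * (gaussian_constant m * (kernel_const \<alpha> * (\<rho> k / 8) powr (2 * \<alpha> - 2)) ^ m)" for k
  have circ: "circlepath (zc k j) (?r k) x \<in> upper_half_plane" "cball (zc k j) (?r k) \<subseteq> upper_half_plane" for k j x
  proof -
    show "cball (zc k j) (?r k) \<subseteq> upper_half_plane"
    proof
      fix w assume "w \<in> cball (zc k j) (?r k)"
      then have "Im (zc k j - w) \<le> ?r k" using abs_Im_le_cmod[of "zc k j - w"] unfolding mem_cball dist_norm by linarith
      then show "w \<in> upper_half_plane" using \<rho>[of k] by (simp add: upper_half_plane_def zc_def)
    qed
    moreover have "circlepath (zc k j) (?r k) x \<in> cball (zc k j) (?r k)"
      using \<rho>[of k] by (simp add: circlepath dist_norm norm_mult)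
    ultimately show "circlepath (zc k j) (?r k) x \<in> upper_half_plane" by blast
  qed
  have "\<exists>Z\<in>borel_measurable M. (\<integral>\<^sup>+\<omega>. Z \<omega> \<partial>M) \<le> ennreal (B k) \<and>
     (\<forall>\<omega>. continuous_on {0..1} (\<lambda>x. norm (X (circlepath (zc k j) (?r k) x) \<omega>)) \<longrightarrow> ennreal (?I k j \<omega> ^ (2 * m)) \<le> Z \<omega>)" for k j
  proof (rule integral_moment_majorant)
    show "(\<lambda>\<omega>. norm (X (circlepath (zc k j) (?r k) x) \<omega>)) \<in> borel_measurable M" for x
      using field_measurable[OF X circ(1)[of k j x]] by measurable
    show "(\<integral>\<^sup>+\<omega>. ennreal (riemann_sum 0 1 n (\<lambda>x. norm (X (circlepath (zc k j) (?r k) x) \<omega>)) ^ (2 * m)) \<partial>M) \<le> ennreal (B k)" for n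
      unfolding B_def using \<rho>[of k] m \<beta> by (intro circle_average_moment[OF M X]) (auto simp: zc_def)
  qed auto
  then obtain Z where Zm: "\<And>k j. Z k j \<in> borel_measurable M" and ZB: "\<And>k j. (\<integral>\<^sup>+\<omega>. Z k j \<omega> \<partial>M) \<le> ennreal (B k)"
    and ZI: "\<And>k j \<omega>. continuous_on {0..1} (\<lambda>x. norm (X (circlepath (zc k j) (?r k) x) \<omega>)) \<Longrightarrow> ennreal (?I k j \<omega> ^ (2 * m)) \<le> Z k j \<omega>"
    by metis
  define wt where "wt k = \<rho> k powr (2 * (1 - \<beta>) * real m)" for k
  define G where "G k = {- (8 * 2 ^ k + 1) .. 8 * 2 ^ k + 1 :: int}" for k :: nat
  define D where "D = 19 * (2 ^ (2 * m) * (gaussian_constant m * (64 * kernel_const \<alpha>) ^ m) * R powr ((2 * (\<alpha> - \<beta>)) * real m))"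
  have D: "0 \<le> D" unfolding D_def using gaussian_constant_nonneg kernel_const_nonneg by simp
  have BW: "wt k * B k \<le> 2 ^ (2 * m) * (gaussian_constant m * (64 * kernel_const \<alpha>) ^ m) * R powr ((2 * (\<alpha> - \<beta>)) * real m) * (1/4) ^ k" for k
  proof -
    have "(\<rho> k / 8) powr (2 * \<alpha> - 2) = \<rho> k powr (2 * \<alpha> - 2) * 8 powr (2 - 2 * \<alpha>)"
      using powr_divide[of "\<rho> k" 8 "2 * \<alpha> - 2"] powr_minus_divide[of 8 "2 - 2 * \<alpha>"] by simp
    also have "\<dots> \<le> \<rho> k powr (2 * \<alpha> - 2) * 8 powr 2"
      using \<beta> by (intro mult_left_mono powr_mono) auto
    finally have "kernel_const \<alpha> * (\<rho> k / 8) powr (2 * \<alpha> - 2) \<le> kernel_const \<alpha> * (\<rho> k powr (2 * \<alpha> - 2) * 64)"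
      using kernel_const_nonneg by (intro mult_left_mono) auto
    then have "B k \<le> 2 ^ (2 * m) * (gaussian_constant m * (kernel_const \<alpha> * (\<rho> k powr (2 * \<alpha> - 2) * 64)) ^ m)"
      unfolding B_def using gaussian_constant_nonneg kernel_const_nonneg
      by (intro mult_left_mono[OF mult_left_mono[OF power_mono]]) auto
    also have "\<dots> = 2 ^ (2 * m) * (gaussian_constant m * (64 * kernel_const \<alpha>) ^ m) * \<rho> k powr ((2 * \<alpha> - 2) * real m)"
      using \<rho>[of k] by (simp add: power_mult_distrib powr_power mult_ac)
    finally have "wt k * B k \<le> wt k * (2 ^ (2 * m) * (gaussian_constant m * (64 * kernel_const \<alpha>) ^ m) * \<rho> k powr ((2 * \<alpha> - 2) * real m))"
      by (rule mult_left_mono) (simp add: wt_def)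
    also have "\<dots> = 2 ^ (2 * m) * (gaussian_constant m * (64 * kernel_const \<alpha>) ^ m) * (wt k * \<rho> k powr ((2 * \<alpha> - 2) * real m))"
      by (simp only: mult_ac)
    also have "wt k * \<rho> k powr ((2 * \<alpha> - 2) * real m) = \<rho> k powr ((2 * (\<alpha> - \<beta>)) * real m)"
      unfolding wt_def powr_add[symmetric] by (simp add: algebra_simps)
    also have "\<dots> = R powr ((2 * (\<alpha> - \<beta>)) * real m) * ((1/2) ^ k) powr ((2 * (\<alpha> - \<beta>)) * real m)"
      unfolding \<rho>_def using R by (intro powr_mult)
    also have "((1/2) ^ k) powr ((2 * (\<alpha> - \<beta>)) * real m) \<le> ((1/2::real) ^ k) powr 2"
      using m2 by (intro powr_mono') (auto simp: power_le_one)
    also have "((1/2::real) ^ k) powr 2 = (1/4) ^ k"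
      by (simp add: power_mult_distrib[symmetric] power2_eq_square power_divide)
    finally show ?thesis
      using gaussian_constant_nonneg kernel_const_nonneg by (simp add: mult_left_mono mult.assoc)
  qed
  have "AE \<omega> in M. \<exists>C\<ge>0. \<forall>k. \<forall>j\<in>G k. ennreal (wt k) * Z k j \<omega> \<le> ennreal C"
  proof (rule AE_bounded_of_summable_expectations[OF _ _ _ D])
    show "(\<Sum>j\<in>G k. \<integral>\<^sup>+\<omega>. ennreal (wt k) * Z k j \<omega> \<partial>M) \<le> ennreal (D * (1/2) ^ k)" for k
    proof -
      have wB: "0 \<le> wt k" "0 \<le> B k"
        using gaussian_constant_nonneg kernel_const_nonneg by (auto simp: wt_def B_def)
      have "(\<Sum>j\<in>G k. \<integral>\<^sup>+\<omega>. ennreal (wt k) * Z k j \<omega> \<partial>M) \<le> (\<Sum>j\<in>G k. ennreal (wt k * B k))"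
      proof (rule sum_mono)
        fix j
        have "(\<integral>\<^sup>+\<omega>. ennreal (wt k) * Z k j \<omega> \<partial>M) = ennreal (wt k) * (\<integral>\<^sup>+\<omega>. Z k j \<omega> \<partial>M)"
          by (rule nn_integral_cmult) (rule Zm)
        also have "\<dots> \<le> ennreal (wt k) * ennreal (B k)" by (intro mult_left_mono ZB) auto
        also have "\<dots> = ennreal (wt k * B k)" using wB by (simp add: ennreal_mult)
        finally show "(\<integral>\<^sup>+\<omega>. ennreal (wt k) * Z k j \<omega> \<partial>M) \<le> ennreal (wt k * B k)" .
      qed
      also have "\<dots> = ennreal (real (card (G k)) * (wt k * B k))"
        using wB by (simp add: ennreal_of_nat_eq_real_of_nat ennreal_mult)
      also have "real (card (G k)) * (wt k * B k) \<le> (19 * 2 ^ k) * (2 ^ (2 * m) * (gaussian_constant m * (64 * kernel_const \<alpha>) ^ m) * R powr ((2 * (\<alpha> - \<beta>)) * real m) * (1/4) ^ k)"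
      proof (rule mult_mono[OF _ BW])
        have "real (card (G k)) = 16 * 2 ^ k + 3" by (simp add: G_def)
        also have "\<dots> \<le> 19 * 2 ^ k" using one_le_power[of "2::real" k] by linarith
        finally show "real (card (G k)) \<le> 19 * 2 ^ k" .
      qed (use wB in auto)
      also have "\<dots> = D * (2 ^ k * (1/4) ^ k)" by (simp add: D_def mult_ac)
      also have "(2::real) ^ k * (1/4) ^ k = (1/2) ^ k" by (simp add: power_mult_distrib[symmetric])
      finally show ?thesis by (simp add: ennreal_leI)
    qed
  qed (auto simp: G_def Zm intro!: borel_measurable_times_ennreal)
  moreover have "AE \<omega> in M. (\<lambda>z. X z \<omega>) analytic_on upper_half_plane"
    using X by (simp add: analytic_fbm_derivative_def)
  ultimately show ?thesis
  proof eventually_elim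
    fix \<omega>
    assume "\<exists>C\<ge>0. \<forall>k. \<forall>j\<in>G k. ennreal (wt k) * Z k j \<omega> \<le> ennreal C"
    then obtain C where C: "0 \<le> C" "\<And>k j. j \<in> G k \<Longrightarrow> ennreal (wt k) * Z k j \<omega> \<le> ennreal C" by blast
    assume "(\<lambda>z. X z \<omega>) analytic_on upper_half_plane"
    then have hol: "(\<lambda>z. X z \<omega>) holomorphic_on upper_half_plane" by (rule analytic_imp_holomorphic)
    have cont: "continuous_on {0..1} (\<lambda>x. norm (X (circlepath (zc k j) (?r k) x) \<omega>))" for k j
    proof -
      have "continuous_on {0..1} (circlepath (zc k j) (?r k))" using path_circlepath unfolding path_def by blast
      then show ?thesis
        using circ(1) by (intro continuous_on_norm continuous_on_compose2[OF holomorphic_on_imp_continuous_on[OF hol]]) auto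
    qed
    have "norm (X (Complex x y) \<omega>) \<le> (5/2 * (1 + C)) * y powr (\<beta> - 1)"
      if xy: "\<bar>x\<bar> \<le> R" "0 < y" "y \<le> R" for x y
    proof -
      obtain k where k: "(1/2) ^ Suc k < y / R" "y / R \<le> (1/2) ^ k"
        using dyadic_scale[of "y / R"] xy by auto
      have y\<rho>: "\<rho> k / 2 < y" "y \<le> \<rho> k" using k R by (auto simp: \<rho>_def field_simps)
      define j where "j = \<lfloor>8 * x / \<rho> k\<rfloor>"
      have j1: "real_of_int j \<le> 8 * x / \<rho> k" "8 * x / \<rho> k < real_of_int j + 1" unfolding j_def by linarith+
      have "\<bar>8 * x / \<rho> k\<bar> \<le> 8 * 2 ^ k"
      proof -
        have "\<bar>8 * x / \<rho> k\<bar> = 8 * \<bar>x\<bar> / \<rho> k" using \<rho>[of k] by (simp add: abs_mult abs_divide)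
        also have "\<dots> \<le> 8 * R / \<rho> k" using xy \<rho>[of k] by (intro divide_right_mono) auto
        also have "\<dots> = 8 * 2 ^ k" using R by (simp add: \<rho>_def field_simps power_divide)
        finally show ?thesis .
      qed
      then have "8 * x / \<rho> k \<le> 8 * 2 ^ k" "- (8 * 2 ^ k) \<le> 8 * x / \<rho> k"
        unfolding abs_le_iff by linarith+
      then have "real_of_int j \<le> 8 * 2 ^ k + 1" "- (8 * 2 ^ k + 1) \<le> real_of_int j"
        using j1 by linarith+
      then have "real_of_int j \<le> real_of_int (8 * 2 ^ k + 1)" "real_of_int (- (8 * 2 ^ k + 1)) \<le> real_of_int j"
        by simp_all
      then have jG: "j \<in> G k" unfolding G_def of_int_le_iff by simp
      have d: "dist (zc k j) (Complex x y) \<le> 3/8 * \<rho> k"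
      proof -
        have "dist (zc k j) (Complex x y) \<le> \<bar>Re (zc k j - Complex x y)\<bar> + \<bar>Im (zc k j - Complex x y)\<bar>"
          unfolding dist_norm by (rule cmod_le)
        moreover have "\<bar>Re (zc k j - Complex x y)\<bar> \<le> \<rho> k / 8"
        proof -
          have "\<rho> k / 8 * real_of_int j \<le> x" "x \<le> \<rho> k / 8 * real_of_int j + \<rho> k / 8"
            using j1 \<rho>[of k] by (auto simp: field_simps)
          then show ?thesis by (simp add: zc_def abs_le_iff)
        qed
        moreover have "\<bar>Im (zc k j - Complex x y)\<bar> \<le> \<rho> k / 4"
          using y\<rho> by (simp only: zc_def abs_le_iff minus_complex.sel complex.sel) linarith
        ultimately show ?thesis by linarith
      qed
      have I0: "0 \<le> ?I k j \<omega>" by (intro integral_nonneg integrable_continuous_interval cont) auto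
      have "norm (X (Complex x y) \<omega>) \<le> ?r k / (?r k - 3/8 * \<rho> k) * ?I k j \<omega>"
        using \<rho>[of k] circ(2)[of k j] d by (intro norm_le_circle_average holomorphic_on_subset[OF hol]) auto
      also have "?r k / (?r k - 3/8 * \<rho> k) = 5/2" using \<rho>[of k] by (simp add: field_simps)
      finally have n1: "norm (X (Complex x y) \<omega>) \<le> 5/2 * ?I k j \<omega>" .
      have "ennreal (wt k * ?I k j \<omega> ^ (2 * m)) = ennreal (wt k) * ennreal (?I k j \<omega> ^ (2 * m))"
        by (intro ennreal_mult) (auto simp: wt_def)
      also have "\<dots> \<le> ennreal (wt k) * Z k j \<omega>" by (intro mult_left_mono ZI cont) auto
      also have "\<dots> \<le> ennreal C" by (rule C(2)[OF jG])
      finally have "wt k * ?I k j \<omega> ^ (2 * m) \<le> C" using C(1) by simp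
      moreover have "wt k = (\<rho> k powr (1 - \<beta>)) ^ (2 * m)"
        unfolding wt_def using \<rho>[of k] by (simp add: powr_power mult_ac)
      ultimately have "(\<rho> k powr (1 - \<beta>) * ?I k j \<omega>) ^ (2 * m) \<le> C" by (simp add: power_mult_distrib)
      then have "\<rho> k powr (1 - \<beta>) * ?I k j \<omega> \<le> 1 + C"
        using I0 m by (intro le_of_power_le[of _ "2 * m"]) auto
      then have "\<rho> k powr (\<beta> - 1) * (\<rho> k powr (1 - \<beta>) * ?I k j \<omega>) \<le> \<rho> k powr (\<beta> - 1) * (1 + C)"
        by (rule mult_left_mono) simp
      moreover have "\<rho> k powr (\<beta> - 1) * (\<rho> k powr (1 - \<beta>) * ?I k j \<omega>) = ?I k j \<omega>"
        using \<rho>[of k] unfolding mult.assoc[symmetric] powr_add[symmetric] by simp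
      moreover have "\<rho> k powr (\<beta> - 1) * (1 + C) \<le> y powr (\<beta> - 1) * (1 + C)"
        using y\<rho> xy \<beta> C(1) by (intro mult_right_mono powr_mono2') auto
      ultimately have "?I k j \<omega> \<le> y powr (\<beta> - 1) * (1 + C)" by linarith
      then have "norm (X (Complex x y) \<omega>) \<le> 5/2 * (y powr (\<beta> - 1) * (1 + C))" using n1 by linarith
      then show ?thesis by (simp only: mult_ac)
    qed
    moreover have "0 \<le> 5/2 * (1 + C)" using C by simp
    ultimately show "\<exists>C\<ge>0. \<forall>x y. \<bar>x\<bar> \<le> R \<longrightarrow> 0 < y \<longrightarrow> y \<le> R \<longrightarrow> norm (X (Complex x y) \<omega>) \<le> C * y powr (\<beta> - 1)"
      by blast
  qed
qed

section \<open>Almost sure bounds for integrals of products\<close>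

text \<open>The size of the integrals of products at exponent \<open>a\<close>.  Using \<open>t - s + \<epsilon>\<close> in place of \<open>t - s\<close> makes it
a bound also for intervals that are shorter than \<open>\<epsilon>\<close>.\<close>

definition weight :: "real \<Rightarrow> real \<Rightarrow> real \<Rightarrow> real \<Rightarrow> real \<Rightarrow> real \<Rightarrow> real" where
  "weight a p \<epsilon> \<eta> s t = (t - s + \<epsilon>) powr (a + 1/4) * \<epsilon> powr (a - 5/4) * \<eta> powr (- p)"

lemma weight_nonneg: "0 \<le> weight \<beta> p \<epsilon> \<eta> s t"
  by (simp add: weight_def)

lemma weight_pos: "s \<le> t \<Longrightarrow> 0 < \<epsilon> \<Longrightarrow> 0 < \<eta> \<Longrightarrow> 0 < weight a p \<epsilon> \<eta> s t"
  by (simp add: weight_def)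

lemma weight_rounding:
  assumes \<beta>: "1/4 < \<beta>" "\<beta> < 1" and p: "0 \<le> p" "p \<le> 1" and st: "s \<le> t" "s' \<le> t'"
    and \<epsilon>: "0 < \<epsilon>" "\<epsilon> / 2 \<le> \<epsilon>'" "\<epsilon>' \<le> \<epsilon>" and \<eta>: "0 < \<eta>" "\<eta> / 2 \<le> \<eta>'"
    and len: "t' - s' \<le> t - s + \<epsilon>"
  shows "weight \<beta> p \<epsilon>' \<eta>' s' t' \<le> 16 * weight \<beta> p \<epsilon> \<eta> s t"
proof -
  have two: "2 powr x \<le> (4::real)" if "x \<le> 2" for x
    using powr_mono[OF that, of "2::real"] by simp
  have two1: "2 powr x \<le> (2::real)" if "x \<le> 1" for x
    using powr_mono[OF that, of "2::real"] by simp
  have half: "(u / 2) powr (- x) = 2 powr x * u powr (- x)" for u x :: real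
    by (subst powr_divide) (simp only: powr_minus divide_inverse inverse_inverse_eq mult.commute)
  have "(t' - s' + \<epsilon>') powr (\<beta> + 1/4) \<le> (2 * (t - s + \<epsilon>)) powr (\<beta> + 1/4)"
    using st \<epsilon> len \<beta> by (intro powr_mono2) auto
  also have "\<dots> = 2 powr (\<beta> + 1/4) * (t - s + \<epsilon>) powr (\<beta> + 1/4)"
    by (rule powr_mult)
  also have "\<dots> \<le> 4 * (t - s + \<epsilon>) powr (\<beta> + 1/4)"
    using \<beta> by (intro mult_right_mono two) auto
  finally have 1: "(t' - s' + \<epsilon>') powr (\<beta> + 1/4) \<le> 4 * (t - s + \<epsilon>) powr (\<beta> + 1/4)" .
  have "\<epsilon>' powr (- (5/4 - \<beta>)) \<le> (\<epsilon> / 2) powr (- (5/4 - \<beta>))"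
    using \<epsilon> \<beta> by (intro powr_mono2') auto
  also have "\<dots> \<le> 2 * \<epsilon> powr (- (5/4 - \<beta>))"
    unfolding half using \<beta> by (intro mult_right_mono two1) auto
  finally have 2: "\<epsilon>' powr (\<beta> - 5/4) \<le> 2 * \<epsilon> powr (\<beta> - 5/4)" by simp
  have "\<eta>' powr (- p) \<le> (\<eta> / 2) powr (- p)"
    using \<eta> p by (intro powr_mono2') auto
  also have "\<dots> \<le> 2 * \<eta> powr (- p)"
    unfolding half using p by (intro mult_right_mono two1) auto
  finally have 3: "\<eta>' powr (- p) \<le> 2 * \<eta> powr (- p)" .
  have "weight \<beta> p \<epsilon>' \<eta>' s' t' \<le> (4 * (t - s + \<epsilon>) powr (\<beta> + 1/4)) * (2 * \<epsilon> powr (\<beta> - 5/4)) * (2 * \<eta> powr (- p))"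
    unfolding weight_def using 1 2 3 by (intro mult_mono) auto
  then show ?thesis by (simp add: weight_def)
qed

lemma weight_lower_bound:
  assumes \<beta>: "1/4 < \<beta>" "\<beta> < 1" and p: "0 \<le> p" and st: "s \<le> t" and \<epsilon>: "0 < \<epsilon>" "\<epsilon> \<le> H" and \<eta>: "0 < \<eta>" "\<eta> \<le> H"
  shows "\<epsilon> \<le> H powr (2 - 2 * \<beta> + p) * weight \<beta> p \<epsilon> \<eta> s t"
proof -
  have "H powr (- p) * \<epsilon> powr (2 * \<beta> - 1) = \<epsilon> powr (\<beta> + 1/4) * \<epsilon> powr (\<beta> - 5/4) * H powr (- p)"
    by (simp add: powr_add[symmetric])
  also have "\<dots> \<le> weight \<beta> p \<epsilon> \<eta> s t"
    unfolding weight_def using \<beta> \<epsilon> \<eta> p st by (intro mult_mono powr_mono2 powr_mono2') auto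
  finally have "H powr (2 - 2 * \<beta> + p) * (H powr (- p) * \<epsilon> powr (2 * \<beta> - 1)) \<le> H powr (2 - 2 * \<beta> + p) * weight \<beta> p \<epsilon> \<eta> s t"
    by (rule mult_left_mono) simp
  moreover have "H powr (2 - 2 * \<beta> + p) * (H powr (- p) * \<epsilon> powr (2 * \<beta> - 1)) = H powr (2 - 2 * \<beta>) * \<epsilon> powr (2 * \<beta> - 1)"
    unfolding mult.assoc[symmetric] powr_add[symmetric] by simp
  moreover have "\<epsilon> powr (2 - 2 * \<beta>) * \<epsilon> powr (2 * \<beta> - 1) \<le> H powr (2 - 2 * \<beta>) * \<epsilon> powr (2 * \<beta> - 1)"
    using \<beta> \<epsilon> by (intro mult_right_mono powr_mono2) auto
  moreover have "\<epsilon> powr (2 - 2 * \<beta>) * \<epsilon> powr (2 * \<beta> - 1) = \<epsilon>"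
    unfolding powr_add[symmetric] using \<epsilon> by simp
  ultimately show ?thesis by linarith
qed

lemma weight_ratio:
  assumes \<beta>: "\<beta> < \<alpha>" and st: "s \<le> t" "t - s + \<epsilon> \<le> L" and \<epsilon>: "0 < \<epsilon>" "\<epsilon> \<le> e"
  shows "weight \<alpha> p \<epsilon> \<eta> s t \<le> (L * e) powr (\<alpha> - \<beta>) * weight \<beta> p \<epsilon> \<eta> s t"
proof -
  have "weight \<alpha> p \<epsilon> \<eta> s t = ((t - s + \<epsilon>) powr (\<alpha> - \<beta>) * \<epsilon> powr (\<alpha> - \<beta>)) * weight \<beta> p \<epsilon> \<eta> s t"
  proof -
    have "(t - s + \<epsilon>) powr (\<alpha> + 1/4) = (t - s + \<epsilon>) powr (\<alpha> - \<beta>) * (t - s + \<epsilon>) powr (\<beta> + 1/4)"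
      by (simp add: powr_add[symmetric])
    moreover have "\<epsilon> powr (\<alpha> - 5/4) = \<epsilon> powr (\<alpha> - \<beta>) * \<epsilon> powr (\<beta> - 5/4)"
      by (simp add: powr_add[symmetric])
    ultimately show ?thesis unfolding weight_def by (simp only: mult_ac)
  qed
  also have "(t - s + \<epsilon>) powr (\<alpha> - \<beta>) * \<epsilon> powr (\<alpha> - \<beta>) \<le> L powr (\<alpha> - \<beta>) * e powr (\<alpha> - \<beta>)"
    using \<beta> st \<epsilon> by (intro mult_mono powr_mono2) auto
  also have "L powr (\<alpha> - \<beta>) * e powr (\<alpha> - \<beta>) = (L * e) powr (\<alpha> - \<beta>)"
    by (rule powr_mult[symmetric])
  finally show ?thesis by (simp add: mult_right_mono weight_def)
qed

lemma round_down:
  fixes x \<delta> :: real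
  assumes "0 < \<delta>"
  shows "real_of_int \<lfloor>x / \<delta>\<rfloor> * \<delta> \<le> x" "x - \<delta> < real_of_int \<lfloor>x / \<delta>\<rfloor> * \<delta>"
proof -
  define n where "n = \<lfloor>x / \<delta>\<rfloor>"
  have "real_of_int n \<le> x / \<delta>" "x / \<delta> < real_of_int n + 1" unfolding n_def by linarith+
  then show "real_of_int \<lfloor>x / \<delta>\<rfloor> * \<delta> \<le> x" "x - \<delta> < real_of_int \<lfloor>x / \<delta>\<rfloor> * \<delta>"
    unfolding n_def[symmetric] using assms by (auto simp: field_simps)
qed

definition admissible :: "real \<Rightarrow> real \<Rightarrow> real \<Rightarrow> real \<Rightarrow> real \<Rightarrow> bool" where
  "admissible R \<epsilon> \<eta> s t \<longleftrightarrow> \<bar>s\<bar> \<le> R \<and> \<bar>t\<bar> \<le> R \<and> s \<le> t \<and> 0 < \<epsilon> \<and> \<epsilon> \<le> \<eta> \<and> \<eta> \<le> 2 * R"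

definition close_below :: "real \<Rightarrow> real \<Rightarrow> real \<Rightarrow> bool" where
  "close_below \<delta> x x' \<longleftrightarrow> x - \<delta> \<le> x' \<and> x' \<le> x"

text \<open>Moments control the values on a grid.  At \<open>\<epsilon> \<approx> 2 ^ (-k)\<close> the spacing is \<open>2 ^ (- 5 k)\<close> up to a constant:
fine enough to beat the crude Lipschitz constant \<open>\<epsilon> ^ (-4)\<close> by a factor \<open>\<epsilon>\<close>, and still polynomial, so
that there are about \<open>2 ^ (20 k)\<close> grid points.  Passing from the exponent \<open>\<alpha>\<close> to \<open>\<beta>\<close> gains
\<open>\<epsilon> powr (\<alpha> - \<beta>)\<close>, and a moment of high order turns this into the required factor \<open>2 ^ (- 21 k)\<close>.\<close>

lemma grid_sup_bound:
  fixes \<Phi> :: "real \<Rightarrow> real \<Rightarrow> real \<Rightarrow> real \<Rightarrow> 'w \<Rightarrow> real"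
  assumes \<beta>: "1/4 < \<beta>" "\<beta> < \<alpha>" "\<alpha> < 1" and p: "0 \<le> p" "p \<le> 1" and R: "1 \<le> R"
    and m: "0 < m" "21 \<le> (\<alpha> - \<beta>) * real (2 * m)" and D: "0 \<le> D"
    and mom: "\<And>\<epsilon> \<eta> s t. 0 < \<epsilon> \<Longrightarrow> 0 < \<eta> \<Longrightarrow> s \<le> t \<Longrightarrow>
       \<exists>Z\<in>borel_measurable M. (\<integral>\<^sup>+\<omega>. Z \<omega> \<partial>M) \<le> ennreal (D * weight \<alpha> p \<epsilon> \<eta> s t ^ (2 * m)) \<and>
         (AE \<omega> in M. ennreal (\<Phi> \<epsilon> \<eta> s t \<omega> ^ (2 * m)) \<le> Z \<omega>)"
    and lip: "AE \<omega> in M. \<exists>C\<ge>0. \<forall>\<epsilon> \<eta> s t \<epsilon>' \<eta>' s' t' \<delta>.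
       admissible R \<epsilon> \<eta> s t \<longrightarrow> s' \<le> t' \<longrightarrow> \<delta> \<le> \<epsilon> / 2 \<longrightarrow> close_below \<delta> \<epsilon> \<epsilon>' \<longrightarrow> close_below \<delta> \<eta> \<eta>' \<longrightarrow>
       close_below \<delta> s s' \<longrightarrow> close_below \<delta> t t' \<longrightarrow>
       \<bar>\<Phi> \<epsilon> \<eta> s t \<omega> - \<Phi> \<epsilon>' \<eta>' s' t' \<omega>\<bar> \<le> C / \<epsilon> ^ 4 * \<delta>"
  shows "AE \<omega> in M. \<exists>C\<ge>0. \<forall>\<epsilon> \<eta> s t. admissible R \<epsilon> \<eta> s t \<longrightarrow>
       \<bar>\<Phi> \<epsilon> \<eta> s t \<omega>\<bar> \<le> C * weight \<beta> p \<epsilon> \<eta> s t"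
proof -
  define H where "H = 2 * R"
  have H: "2 \<le> H" using R by (simp add: H_def)
  \<comment> \<open>The summand \<open>2\<close> in the exponent keeps the spacing below \<open>\<epsilon> / 2\<close>, so that rounded heights stay positive.\<close>
  define \<delta> where "\<delta> k = H * (1/2) ^ (5 * k + 2)" for k :: nat
  have \<delta>: "0 < \<delta> k" for k using H by (simp add: \<delta>_def)
  define N where "N k = (2::int) ^ (5 * k + 3)" for k :: nat
  define G where "G k = {(a, b, c, d). a \<in> {1..N k} \<and> b \<in> {1..N k} \<and> c \<in> {-N k..N k} \<and> d \<in> {-N k..N k} \<and>
      c \<le> d \<and> real_of_int a * \<delta> k \<le> H * (1/2) ^ k}" for k
  have GS: "G k \<subseteq> {-N k..N k} \<times> {-N k..N k} \<times> {-N k..N k} \<times> {-N k..N k}" for k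
    unfolding G_def by (auto simp: N_def intro: order.trans[of _ 1])
  have finG: "finite (G k)" for k by (rule finite_subset[OF GS]) auto
  have cardG: "real (card (G k)) \<le> 2 ^ 20 * 2 ^ (20 * k)" for k
  proof -
    have "card (G k) \<le> card ({-N k..N k} \<times> {-N k..N k} \<times> {-N k..N k} \<times> {-N k..N k})"
      by (intro card_mono GS) auto
    also have "\<dots> = nat (2 * N k + 1) ^ 4" by (simp add: card_cartesian_product power4_eq_xxxx algebra_simps)
    also have "\<dots> \<le> nat (4 * N k) ^ 4"
    proof (intro power_mono nat_mono)
      have "1 \<le> N k" by (simp add: N_def)
      then show "2 * N k + 1 \<le> 4 * N k" by linarith
    qed simp
    also have "nat (4 * N k) = 2 ^ (5 * k + 5)" by (simp add: N_def nat_mult_distrib nat_power_eq power_add)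
    also have "((2::nat) ^ (5 * k + 5)) ^ 4 = 2 ^ 20 * 2 ^ (20 * k)" 
      by (simp only: power_mult[symmetric] power_add[symmetric]) (rule arg_cong[of _ _ "(^) 2"], simp)
    finally have "real (card (G k)) \<le> real (2 ^ 20 * 2 ^ (20 * k))" by (rule of_nat_mono)
    then show ?thesis by simp
  qed
  let ?\<Phi> = "\<lambda>k (a :: int, b :: int, c :: int, d :: int). \<Phi> (real_of_int a * \<delta> k) (real_of_int b * \<delta> k) (real_of_int c * \<delta> k) (real_of_int d * \<delta> k)"
  let ?w = "\<lambda>g k (a :: int, b :: int, c :: int, d :: int). weight g p (real_of_int a * \<delta> k) (real_of_int b * \<delta> k) (real_of_int c * \<delta> k) (real_of_int d * \<delta> k)"
  have "\<exists>Z. Z \<in> borel_measurable M \<and> (i \<in> G k \<longrightarrow> (\<integral>\<^sup>+\<omega>. Z \<omega> \<partial>M) \<le> ennreal (D * ?w \<alpha> k i ^ (2 * m)) \<and>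
         (AE \<omega> in M. ennreal (?\<Phi> k i \<omega> ^ (2 * m)) \<le> Z \<omega>))" for k and i :: "int \<times> int \<times> int \<times> int"
  proof (cases "i \<in> G k")
    case True
    obtain a b c d where i: "i = (a, b, c, d)" by (cases i) auto
    show ?thesis
      using mom[of "real_of_int a * \<delta> k" "real_of_int b * \<delta> k" "real_of_int c * \<delta> k" "real_of_int d * \<delta> k"] \<delta>[of k] True
      by (auto simp: i G_def mult_right_mono)
  next
    case False
    then show ?thesis by (intro exI[of _ "\<lambda>_. 0"]) auto
  qed
  then have "\<forall>k i. \<exists>Z. Z \<in> borel_measurable M \<and> (i \<in> G k \<longrightarrow> (\<integral>\<^sup>+\<omega>. Z \<omega> \<partial>M) \<le> ennreal (D * ?w \<alpha> k i ^ (2 * m)) \<and>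
         (AE \<omega> in M. ennreal (?\<Phi> k i \<omega> ^ (2 * m)) \<le> Z \<omega>))"
    by blast
  then obtain Z where Z: "\<forall>k i. Z k i \<in> borel_measurable M \<and> (i \<in> G k \<longrightarrow> (\<integral>\<^sup>+\<omega>. Z k i \<omega> \<partial>M) \<le> ennreal (D * ?w \<alpha> k i ^ (2 * m)) \<and>
         (AE \<omega> in M. ennreal (?\<Phi> k i \<omega> ^ (2 * m)) \<le> Z k i \<omega>))"
    unfolding choice_iff by blast
  have Zm: "Z k i \<in> borel_measurable M" for k i using Z by blast
  have ZB: "(\<integral>\<^sup>+\<omega>. Z k i \<omega> \<partial>M) \<le> ennreal (D * ?w \<alpha> k i ^ (2 * m))" if "i \<in> G k" for k i using Z that by blast
  have Z\<Phi>: "AE \<omega> in M. ennreal (?\<Phi> k i \<omega> ^ (2 * m)) \<le> Z k i \<omega>" if "i \<in> G k" for k i using Z that by blast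
  define D' where "D' = 2 ^ 20 * (D * ((5 * H * H) powr (\<alpha> - \<beta>)) ^ (2 * m))"
  have D': "0 \<le> D'" using D by (simp add: D'_def)
  have wpos: "0 < ?w g k i" if "i \<in> G k" for g k i
    using that \<delta>[of k] by (auto simp: G_def intro!: weight_pos mult_right_mono)
  have wratio: "D * ?w \<alpha> k i ^ (2 * m) \<le> D * ((5 * H * H) powr (\<alpha> - \<beta>)) ^ (2 * m) * (1/2) ^ (21 * k) * ?w \<beta> k i ^ (2 * m)" if "i \<in> G k" for k i
  proof -
    obtain a b c d where i: "i = (a, b, c, d)" by (cases i) auto
    have abcd: "1 \<le> a" "c \<le> d" "c \<ge> - N k" "d \<le> N k" "real_of_int a * \<delta> k \<le> H * (1/2) ^ k"
      using that by (auto simp: i G_def)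
    have N\<delta>: "real_of_int (N k) * \<delta> k = 2 * H"
      by (simp add: N_def \<delta>_def power_add power_one_over field_simps)
    have "real_of_int d * \<delta> k \<le> real_of_int (N k) * \<delta> k" "- (real_of_int (N k) * \<delta> k) \<le> real_of_int c * \<delta> k"
      using abcd \<delta>[of k] by (auto intro!: mult_right_mono simp flip: mult_minus_left of_int_minus)
    moreover have "H * (1/2) ^ k \<le> H" using H by (simp add: power_le_one)
    ultimately have len: "real_of_int d * \<delta> k - real_of_int c * \<delta> k + real_of_int a * \<delta> k \<le> 5 * H"
      using N\<delta> abcd(5) by linarith
    have "?w \<alpha> k i \<le> (5 * H * (H * (1/2) ^ k)) powr (\<alpha> - \<beta>) * ?w \<beta> k i"
      unfolding i prod.case using \<beta> abcd \<delta>[of k] len by (intro weight_ratio) (auto intro: mult_right_mono)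
    then have "?w \<alpha> k i ^ (2 * m) \<le> ((5 * H * (H * (1/2) ^ k)) powr (\<alpha> - \<beta>) * ?w \<beta> k i) ^ (2 * m)"
      using wpos[OF that, of \<alpha>] by (intro power_mono) auto
    also have "\<dots> = ((5 * H * H) powr (\<alpha> - \<beta>)) ^ (2 * m) * (((1/2) ^ k) powr (\<alpha> - \<beta>)) ^ (2 * m) * ?w \<beta> k i ^ (2 * m)"
      by (simp add: powr_mult mult.assoc[symmetric] power_mult_distrib)
    also have "(((1/2) ^ k) powr (\<alpha> - \<beta>)) ^ (2 * m) = ((1/2::real) ^ k) powr ((\<alpha> - \<beta>) * real (2 * m))"
      by (simp add: powr_power mult_ac)
    also have "((1/2::real) ^ k) powr ((\<alpha> - \<beta>) * real (2 * m)) \<le> ((1/2::real) ^ k) powr (real 21)"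
      using m by (intro powr_mono') (auto simp: power_le_one)
    also have "((1/2::real) ^ k) powr (real 21) = (1/2) ^ (21 * k)"
      by (subst powr_realpow) (auto simp: power_mult[symmetric] mult.commute)
    finally have "?w \<alpha> k i ^ (2 * m) \<le> ((5 * H * H) powr (\<alpha> - \<beta>)) ^ (2 * m) * (1/2) ^ (21 * k) * ?w \<beta> k i ^ (2 * m)"
      using wpos[OF that, of \<beta>] by (simp add: mult_left_mono mult_right_mono)
    then show ?thesis using D by (simp add: mult.assoc mult_left_mono)
  qed
  have "AE \<omega> in M. \<exists>C\<ge>0. \<forall>k. \<forall>i\<in>G k. ennreal (1 / ?w \<beta> k i ^ (2 * m)) * Z k i \<omega> \<le> ennreal C"
  proof (rule AE_bounded_of_summable_expectations[OF _ _ _ D'])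
    fix k
    have "(\<Sum>i\<in>G k. \<integral>\<^sup>+\<omega>. ennreal (1 / ?w \<beta> k i ^ (2 * m)) * Z k i \<omega> \<partial>M)
        \<le> (\<Sum>i\<in>G k. ennreal (D * ((5 * H * H) powr (\<alpha> - \<beta>)) ^ (2 * m) * (1/2) ^ (21 * k)))"
    proof (rule sum_mono)
      fix i assume i: "i \<in> G k"
      have "(\<integral>\<^sup>+\<omega>. ennreal (1 / ?w \<beta> k i ^ (2 * m)) * Z k i \<omega> \<partial>M) = ennreal (1 / ?w \<beta> k i ^ (2 * m)) * (\<integral>\<^sup>+\<omega>. Z k i \<omega> \<partial>M)"
        by (rule nn_integral_cmult) (rule Zm)
      also have "\<dots> \<le> ennreal (1 / ?w \<beta> k i ^ (2 * m)) * ennreal (D * ((5 * H * H) powr (\<alpha> - \<beta>)) ^ (2 * m) * (1/2) ^ (21 * k) * ?w \<beta> k i ^ (2 * m))"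
        by (intro mult_left_mono order.trans[OF ZB[OF i]] ennreal_leI wratio i) auto
      also have "\<dots> = ennreal (1 / ?w \<beta> k i ^ (2 * m) * (D * ((5 * H * H) powr (\<alpha> - \<beta>)) ^ (2 * m) * (1/2) ^ (21 * k) * ?w \<beta> k i ^ (2 * m)))"
        using wpos[OF i, of \<beta>] D by (intro ennreal_mult[symmetric]) (auto simp del: mult_eq_0_iff split_paired_All)
      also have "1 / ?w \<beta> k i ^ (2 * m) * (D * ((5 * H * H) powr (\<alpha> - \<beta>)) ^ (2 * m) * (1/2) ^ (21 * k) * ?w \<beta> k i ^ (2 * m))
          = D * ((5 * H * H) powr (\<alpha> - \<beta>)) ^ (2 * m) * (1/2) ^ (21 * k)"
        using wpos[OF i, of \<beta>] by simp
      finally show "(\<integral>\<^sup>+\<omega>. ennreal (1 / ?w \<beta> k i ^ (2 * m)) * Z k i \<omega> \<partial>M) \<le> ennreal (D * ((5 * H * H) powr (\<alpha> - \<beta>)) ^ (2 * m) * (1/2) ^ (21 * k))" .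
    qed
    also have "\<dots> = ennreal (real (card (G k)) * (D * ((5 * H * H) powr (\<alpha> - \<beta>)) ^ (2 * m) * (1/2) ^ (21 * k)))"
      using D by (simp add: ennreal_of_nat_eq_real_of_nat ennreal_mult)
    also have "\<dots> \<le> ennreal ((2 ^ 20 * 2 ^ (20 * k)) * (D * ((5 * H * H) powr (\<alpha> - \<beta>)) ^ (2 * m) * (1/2) ^ (21 * k)))"
      using D by (intro ennreal_leI mult_right_mono cardG) auto
    also have "(2 ^ 20 * 2 ^ (20 * k)) * (D * ((5 * H * H) powr (\<alpha> - \<beta>)) ^ (2 * m) * (1/2) ^ (21 * k)) = D' * (2 ^ (20 * k) * (1/2) ^ (21 * k))"
      by (simp add: D'_def)
    also have "(2::real) ^ (20 * k) * (1/2) ^ (21 * k) = (1/2) ^ k"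
    proof -
      have "(1/2::real) ^ (21 * k) = (1/2) ^ (20 * k) * (1/2) ^ k" by (simp flip: power_add)
      moreover have "(2::real) ^ (20 * k) * (1/2) ^ (20 * k) = 1" by (simp flip: power_mult_distrib)
      ultimately show ?thesis by simp
    qed
    finally show "(\<Sum>i\<in>G k. \<integral>\<^sup>+\<omega>. ennreal (1 / ?w \<beta> k i ^ (2 * m)) * Z k i \<omega> \<partial>M) \<le> ennreal (D' * (1/2) ^ k)" .
  qed (use finG Zm in \<open>auto intro!: borel_measurable_times_ennreal\<close>)
  moreover have "AE \<omega> in M. \<forall>k. \<forall>i\<in>G k. ennreal (?\<Phi> k i \<omega> ^ (2 * m)) \<le> Z k i \<omega>"
    unfolding AE_all_countable by (intro allI AE_finite_allI finG Z\<Phi>)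
  ultimately show ?thesis using lip
  proof eventually_elim
    case (elim \<omega>)
    obtain C where C: "0 \<le> C" "\<And>k i. i \<in> G k \<Longrightarrow> ennreal (1 / ?w \<beta> k i ^ (2 * m)) * Z k i \<omega> \<le> ennreal C"
      using elim(1) by blast
    obtain C1 where C1: "0 \<le> C1" and lip': "\<And>\<epsilon> \<eta> s t \<epsilon>' \<eta>' s' t' \<delta>.
       admissible R \<epsilon> \<eta> s t \<Longrightarrow> s' \<le> t' \<Longrightarrow> \<delta> \<le> \<epsilon> / 2 \<Longrightarrow> close_below \<delta> \<epsilon> \<epsilon>' \<Longrightarrow> close_below \<delta> \<eta> \<eta>' \<Longrightarrow>
       close_below \<delta> s s' \<Longrightarrow> close_below \<delta> t t' \<Longrightarrow>
       \<bar>\<Phi> \<epsilon> \<eta> s t \<omega> - \<Phi> \<epsilon>' \<eta>' s' t' \<omega>\<bar> \<le> C1 / \<epsilon> ^ 4 * \<delta>"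
      using elim(3) by meson
    have grid: "\<bar>?\<Phi> k i \<omega>\<bar> \<le> (1 + C) * ?w \<beta> k i" if i: "i \<in> G k" for k i
    proof -
      have w: "0 < ?w \<beta> k i" by (rule wpos[OF i])
      have "ennreal (1 / ?w \<beta> k i ^ (2 * m) * ?\<Phi> k i \<omega> ^ (2 * m)) = ennreal (1 / ?w \<beta> k i ^ (2 * m)) * ennreal (?\<Phi> k i \<omega> ^ (2 * m))"
        using w by (intro ennreal_mult) auto
      also have "\<dots> \<le> ennreal (1 / ?w \<beta> k i ^ (2 * m)) * Z k i \<omega>"
        using elim(2) i by (intro mult_left_mono) auto
      also have "\<dots> \<le> ennreal C" by (rule C(2)[OF i])
      finally have "1 / ?w \<beta> k i ^ (2 * m) * ?\<Phi> k i \<omega> ^ (2 * m) \<le> C" using C(1) by simp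
      moreover have "1 / ?w \<beta> k i ^ (2 * m) * ?\<Phi> k i \<omega> ^ (2 * m) = (\<bar>?\<Phi> k i \<omega>\<bar> / ?w \<beta> k i) ^ (2 * m)"
        by (simp add: power_divide power_even_abs)
      ultimately have "\<bar>?\<Phi> k i \<omega>\<bar> / ?w \<beta> k i \<le> 1 + C"
        using w m by (intro le_of_power_le[of _ "2 * m"]) auto
      then show ?thesis using w by (simp add: pos_divide_le_eq)
    qed
    define C2 where "C2 = 16 * (1 + C) + 8 * C1 * H powr (2 - 2 * \<beta> + p)"
    have "\<bar>\<Phi> \<epsilon> \<eta> s t \<omega>\<bar> \<le> C2 * weight \<beta> p \<epsilon> \<eta> s t"
      if adm: "admissible R \<epsilon> \<eta> s t" for \<epsilon> \<eta> s t
    proof -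
      have par: "\<bar>s\<bar> \<le> R" "\<bar>t\<bar> \<le> R" "s \<le> t" "0 < \<epsilon>" "\<epsilon> \<le> \<eta>" "\<eta> \<le> 2 * R"
        using adm by (auto simp: admissible_def)
      obtain k where "(1/2) ^ Suc k < \<epsilon> / H" "\<epsilon> / H \<le> (1/2) ^ k"
        using dyadic_scale[of "\<epsilon> / H"] par H by (auto simp: H_def)
      then have k: "H * (1/2) ^ k < 2 * \<epsilon>" "\<epsilon> \<le> H * (1/2) ^ k" using H by (auto simp: field_simps)
      define q where "q = (1/2::real) ^ k"
      have q: "0 < q" "q \<le> 1" by (auto simp: q_def power_le_one)
      have \<delta>q: "\<delta> k = H * q ^ 5 / 4"
        by (simp add: \<delta>_def q_def power_add power_mult[symmetric] mult.commute power2_eq_square)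
      have \<delta>e: "\<delta> k \<le> \<epsilon> / 2"
      proof -
        have "q ^ 5 \<le> q ^ 1" using q by (intro power_decreasing) auto
        then have "H * q ^ 5 / 4 \<le> H * q / 4" using H by simp
        then show ?thesis using k(1) unfolding \<delta>q q_def[symmetric] by linarith
      qed
      have \<delta>5: "\<delta> k \<le> 8 * \<epsilon> ^ 5"
      proof -
        have "q \<le> H * q / 2" using H q by simp
        then have "q \<le> \<epsilon>" using k(1) unfolding q_def[symmetric] by linarith
        then have q4: "q ^ 4 \<le> \<epsilon> ^ 4" using q by (intro power_mono) auto
        have "H * q ^ 5 = (H * q) * q ^ 4" by (simp add: eval_nat_numeral)
        also have "\<dots> \<le> (2 * \<epsilon>) * \<epsilon> ^ 4" 
          by (rule mult_mono[OF less_imp_le[OF k(1)[folded q_def]] q4]) (use q par in auto)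
        also have "\<dots> = 2 * \<epsilon> ^ 5" by (simp add: eval_nat_numeral)
        finally show ?thesis using zero_le_power[of \<epsilon> 5] par unfolding \<delta>q by linarith
      qed
      define a b c d where "a = \<lfloor>\<epsilon> / \<delta> k\<rfloor>" and "b = \<lfloor>\<eta> / \<delta> k\<rfloor>" and "c = \<lfloor>s / \<delta> k\<rfloor>" and "d = \<lfloor>t / \<delta> k\<rfloor>"
      note abcd = a_def b_def c_def d_def
      let ?e = "real_of_int a * \<delta> k" and ?h = "real_of_int b * \<delta> k" and ?s = "real_of_int c * \<delta> k" and ?t = "real_of_int d * \<delta> k"
      have rd: "?e \<le> \<epsilon>" "\<epsilon> - \<delta> k < ?e" "?h \<le> \<eta>" "\<eta> - \<delta> k < ?h" "?s \<le> s" "s - \<delta> k < ?s" "?t \<le> t" "t - \<delta> k < ?t"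
        unfolding abcd by (intro round_down \<delta>)+
      have NH: "H / \<delta> k \<le> real_of_int (N k)"
        using H by (simp add: \<delta>_def N_def power_add power_one_over field_simps)
      have le_N: "i \<le> N k" if "real_of_int i * \<delta> k \<le> H" for i
      proof -
        have "real_of_int i \<le> H / \<delta> k" using that \<delta>[of k] by (simp add: pos_le_divide_eq)
        then have "real_of_int i \<le> real_of_int (N k)" using NH by linarith
        then show ?thesis by simp
      qed
      have ge_N: "- N k \<le> i" if "- H \<le> real_of_int i * \<delta> k" for i
        using le_N[of "- i"] that by simp
      have \<epsilon>H: "\<epsilon> \<le> H" using par H_def by simp
      have cd: "c \<le> d" unfolding abcd using par \<delta>[of k] by (intro floor_mono divide_right_mono) auto
      have a1: "1 \<le> a" "1 \<le> b" unfolding abcd using \<delta>e par \<delta>[of k] by (auto simp: le_floor_iff)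
      have "a \<le> N k" "b \<le> N k" "c \<le> N k" "d \<le> N k" "- N k \<le> c" "- N k \<le> d"
        using rd par \<delta>e \<epsilon>H H_def by (intro le_N ge_N; linarith)+
      then have G: "(a, b, c, d) \<in> G k"
        unfolding G_def using a1 cd order.trans[OF rd(1) k(2)] by simp
      have st': "?s \<le> ?t" using cd \<delta>[of k] by (simp add: mult_right_mono)
      have "\<bar>\<Phi> \<epsilon> \<eta> s t \<omega> - \<Phi> ?e ?h ?s ?t \<omega>\<bar> \<le> C1 / \<epsilon> ^ 4 * \<delta> k"
        using adm st' rd \<delta>e by (intro lip') (auto simp: close_below_def)
      also have "\<dots> \<le> C1 / \<epsilon> ^ 4 * (8 * \<epsilon> ^ 5)" using C1 \<delta>5 par by (intro mult_left_mono) auto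
      also have "\<dots> = 8 * C1 * \<epsilon>" using par by (simp add: eval_nat_numeral field_simps)
      also have "\<dots> \<le> 8 * C1 * (H powr (2 - 2 * \<beta> + p) * weight \<beta> p \<epsilon> \<eta> s t)"
        using C1 par \<beta> p H_def by (intro mult_left_mono weight_lower_bound) auto
      finally have 1: "\<bar>\<Phi> \<epsilon> \<eta> s t \<omega> - \<Phi> ?e ?h ?s ?t \<omega>\<bar> \<le> 8 * C1 * (H powr (2 - 2 * \<beta> + p) * weight \<beta> p \<epsilon> \<eta> s t)" .
      have "\<bar>\<Phi> ?e ?h ?s ?t \<omega>\<bar> \<le> (1 + C) * weight \<beta> p ?e ?h ?s ?t"
        using grid[OF G] by simp
      also have "\<dots> \<le> (1 + C) * (16 * weight \<beta> p \<epsilon> \<eta> s t)"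
        using C(1) \<beta> p par st' rd \<delta>e by (intro mult_left_mono weight_rounding) auto
      finally have 2: "\<bar>\<Phi> ?e ?h ?s ?t \<omega>\<bar> \<le> (1 + C) * (16 * weight \<beta> p \<epsilon> \<eta> s t)" .
      have "\<bar>\<Phi> \<epsilon> \<eta> s t \<omega>\<bar> \<le> (1 + C) * (16 * weight \<beta> p \<epsilon> \<eta> s t) + 8 * C1 * (H powr (2 - 2 * \<beta> + p) * weight \<beta> p \<epsilon> \<eta> s t)"
        using 1 2 by linarith
      also have "\<dots> = C2 * weight \<beta> p \<epsilon> \<eta> s t" by (simp add: C2_def algebra_simps)
      finally show ?thesis .
    qed
    moreover have "0 \<le> C2" using C(1) C1 by (simp add: C2_def)
    ultimately show ?case by blast
  qed
qed

text \<open>Cauchy's estimate for the derivative on a disc of radius half the height.\<close>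

lemma inverse_square_lipschitz:
  assumes f: "f holomorphic_on upper_half_plane"
    and bound: "\<And>x y. \<bar>x\<bar> \<le> 4 * R \<Longrightarrow> 0 < y \<Longrightarrow> y \<le> 4 * R \<Longrightarrow> norm (f (Complex x y)) \<le> C / y"
    and x: "\<bar>x\<bar> \<le> 2 * R" and y: "0 < y'" "y' \<le> y" "y \<le> 2 * R" and C: "0 \<le> C"
  shows "norm (f (Complex x y) - f (Complex x y')) \<le> 4 * C / y'\<^sup>2 * (y - y')"
proof -
  have deriv_bound: "norm (deriv f (Complex x u)) \<le> 4 * C / u\<^sup>2" if u: "0 < u" "u \<le> 2 * R" for u
  proof -
    have sub: "cball (Complex x u) (u / 2) \<subseteq> upper_half_plane"
    proof
      fix w assume "w \<in> cball (Complex x u) (u / 2)"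
      then have "Im (Complex x u - w) \<le> u / 2"
        using abs_Im_le_cmod[of "Complex x u - w"] unfolding mem_cball dist_norm by linarith
      then show "w \<in> upper_half_plane" using u by (simp add: upper_half_plane_def)
    qed
    have "norm ((deriv ^^ 1) f (Complex x u)) \<le> fact 1 * (2 * C / u) / (u / 2) ^ 1"
    proof (rule Cauchy_inequality)
      show "f holomorphic_on ball (Complex x u) (u / 2)"
        using f sub by (meson ball_subset_cball holomorphic_on_subset)
      show "continuous_on (cball (Complex x u) (u / 2)) f"
        using f sub holomorphic_on_imp_continuous_on holomorphic_on_subset by blast
      fix w assume w: "norm (Complex x u - w) = u / 2"
      have i: "\<bar>x - Re w\<bar> \<le> u / 2" "\<bar>u - Im w\<bar> \<le> u / 2"
        using w abs_Im_le_cmod[of "Complex x u - w"] abs_Re_le_cmod[of "Complex x u - w"] by auto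
      have "norm (f (Complex (Re w) (Im w))) \<le> C / Im w"
        using i u x by (intro bound) linarith+
      also have "\<dots> \<le> C / (u / 2)"
        using i u C by (intro divide_left_mono mult_pos_pos) linarith+
      finally show "norm (f w) \<le> 2 * C / u" by (simp add: mult.commute)
    qed (use u in auto)
    also have "fact 1 * (2 * C / u) / (u / 2) ^ 1 = 4 * C / u\<^sup>2" using u by (simp add: power2_eq_square)
    finally show ?thesis by simp
  qed
  let ?S = "closed_segment (Complex x y') (Complex x y)"
  have S: "Re w = x \<and> y' \<le> Im w \<and> Im w \<le> y" if wS: "w \<in> ?S" for w
  proof -
    obtain u where u: "0 \<le> u" "u \<le> 1" "w = (1 - u) *\<^sub>R Complex x y' + u *\<^sub>R Complex x y"
      using wS unfolding in_segment by blast
    have "Im w = y' + u * (y - y')" "Re w = x" unfolding u(3) by (simp_all add: algebra_simps)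
    moreover have "u * (y - y') \<le> 1 * (y - y')" using u y by (intro mult_right_mono) auto
    moreover have "0 \<le> u * (y - y')" using u y by simp
    ultimately show ?thesis by simp
  qed
  have "norm (f (Complex x y) - f (Complex x y')) \<le> 4 * C / y'\<^sup>2 * norm (Complex x y - Complex x y')"
  proof (rule field_differentiable_bound[where S = ?S and f' = "deriv f"])
    fix w assume w: "w \<in> ?S"
    have w2: "w = Complex x (Im w)" using S[OF w] by (simp add: complex_eq_iff)
    have "w \<in> upper_half_plane" using S[OF w] y by (simp add: upper_half_plane_def)
    then show "(f has_field_derivative deriv f w) (at w within ?S)"
      using f open_upper_half_plane by (meson has_field_derivative_at_within holomorphic_derivI)
    have "norm (deriv f (Complex x (Im w))) \<le> 4 * C / (Im w)\<^sup>2" using S[OF w] y by (intro deriv_bound) auto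
    also have "\<dots> \<le> 4 * C / y'\<^sup>2"
      using S[OF w] y C by (intro divide_left_mono power_mono mult_pos_pos) auto
    finally show "norm (deriv f w) \<le> 4 * C / y'\<^sup>2" using w2 by simp
  qed auto
  also have "norm (Complex x y - Complex x y') = y - y'" using y by (simp add: cmod_def)
  finally show ?thesis .
qed

text \<open>Telescoping over the three factors.\<close>

lemma product_difference_le:
  fixes a b c a' b' c' Q P :: real
  assumes "\<bar>a\<bar> \<le> Q" "\<bar>b\<bar> \<le> Q" "\<bar>b'\<bar> \<le> Q" "\<bar>a'\<bar> \<le> Q" "\<bar>c\<bar> \<le> Q" "\<bar>c'\<bar> \<le> Q"
    and "\<bar>a - a'\<bar> \<le> P" "\<bar>b - b'\<bar> \<le> P" "\<bar>c - c'\<bar> \<le> P"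
  shows "\<bar>a * b * c - a' * b' * c'\<bar> \<le> 3 * (Q * Q * P)"
proof -
  have eq: "a * b * c - a' * b' * c' = (a - a') * b * c + a' * (b - b') * c + a' * b' * (c - c')"
    by (simp add: algebra_simps)
  have PQ: "0 \<le> Q" "0 \<le> P" using assms(1,7) by linarith+
  then have "\<bar>(a - a') * b * c\<bar> \<le> P * Q * Q" "\<bar>a' * (b - b') * c\<bar> \<le> Q * P * Q" "\<bar>a' * b' * (c - c')\<bar> \<le> Q * Q * P"
    unfolding abs_mult by (intro mult_mono[OF mult_mono] assms mult_nonneg_nonneg abs_ge_zero PQ)+
  moreover have "P * Q * Q = Q * Q * P" "Q * P * Q = Q * Q * P" by simp_all
  ultimately show ?thesis unfolding eq by linarith
qed

text \<open>The change of the heights is felt through the factors, which are Lipschitz with constant of order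
\<open>\<epsilon> powr (-2)\<close>; the change of the interval through their size, of order \<open>\<epsilon> powr (-1)\<close> each.  Heights never
fall below \<open>\<epsilon> / 2\<close>.\<close>

lemma triple_integral_lipschitz:
  fixes u v h :: "real \<Rightarrow> real \<Rightarrow> real"
  assumes cont: "\<And>y a b. 0 < y \<Longrightarrow> continuous_on {a..b} (\<lambda>x. u x y)" "\<And>y a b. 0 < y \<Longrightarrow> continuous_on {a..b} (\<lambda>x. v x y)"
      "\<And>y a b. 0 < y \<Longrightarrow> continuous_on {a..b} (\<lambda>x. h x y)"
    and bd: "\<And>x y. \<bar>x\<bar> \<le> 2 * R \<Longrightarrow> 0 < y \<Longrightarrow> y \<le> 2 * R \<Longrightarrow> \<bar>u x y\<bar> \<le> C / y \<and> \<bar>v x y\<bar> \<le> C / y \<and> \<bar>h x y\<bar> \<le> C / y"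
    and lp: "\<And>x y y'. \<bar>x\<bar> \<le> 2 * R \<Longrightarrow> 0 < y' \<Longrightarrow> y' \<le> y \<Longrightarrow> y \<le> 2 * R \<Longrightarrow>
        \<bar>u x y - u x y'\<bar> \<le> C / y'\<^sup>2 * (y - y') \<and> \<bar>v x y - v x y'\<bar> \<le> C / y'\<^sup>2 * (y - y') \<and> \<bar>h x y - h x y'\<bar> \<le> C / y'\<^sup>2 * (y - y')"
    and C: "0 \<le> C" and st: "\<bar>s\<bar> \<le> R" "\<bar>t\<bar> \<le> R" "s \<le> t" "s' \<le> t'" and \<epsilon>: "0 < \<epsilon>" "\<epsilon> \<le> \<eta>" "\<eta> \<le> 2 * R" and \<delta>: "\<delta> \<le> \<epsilon> / 2"
    and r: "\<epsilon> - \<delta> \<le> \<epsilon>'" "\<epsilon>' \<le> \<epsilon>" "\<eta> - \<delta> \<le> \<eta>'" "\<eta>' \<le> \<eta>" "s - \<delta> \<le> s'" "s' \<le> s" "t - \<delta> \<le> t'" "t' \<le> t"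
  shows "\<bar>integral {s..t} (\<lambda>x. u x \<epsilon> * v x \<epsilon> * h x \<eta>) - integral {s'..t'} (\<lambda>x. u x \<epsilon>' * v x \<epsilon>' * h x \<eta>')\<bar>
     \<le> (128 * R * C ^ 3) / \<epsilon> ^ 4 * \<delta>"
proof -
  define Q where "Q = 2 * C / \<epsilon>"
  define P where "P = 4 * C / \<epsilon>\<^sup>2 * \<delta>"
  have \<delta>0: "0 \<le> \<delta>" using r by linarith
  have QP: "0 \<le> Q" "0 \<le> P" using C \<epsilon> \<delta>0 by (auto simp: Q_def P_def)
  have lo: "\<epsilon> / 2 \<le> \<epsilon>'" "\<epsilon> / 2 \<le> \<eta>'" "0 < \<epsilon>'" "0 < \<eta>'" using r \<delta> \<epsilon> by auto
  have Qb: "C / y \<le> Q" if "\<epsilon> / 2 \<le> y" for y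
  proof -
    have "C / y \<le> C / (\<epsilon> / 2)" using that \<epsilon> C by (intro divide_left_mono mult_pos_pos) auto
    then show ?thesis by (simp add: Q_def mult.commute)
  qed
  have Pb: "C / y'\<^sup>2 * (y - y') \<le> P" if "\<epsilon> / 2 \<le> y'" "y' \<le> y" "y - y' \<le> \<delta>" for y y'
  proof -
    have "C / y'\<^sup>2 \<le> C / (\<epsilon> / 2)\<^sup>2" using that \<epsilon> C by (intro divide_left_mono mult_pos_pos power_mono) auto
    also have "\<dots> = 4 * C / \<epsilon>\<^sup>2" by (simp add: power_divide)
    finally show ?thesis unfolding P_def using that C \<epsilon> by (intro mult_mono) auto
  qed
  let ?p = "\<lambda>x. u x \<epsilon> * v x \<epsilon> * h x \<eta>" and ?p' = "\<lambda>x. u x \<epsilon>' * v x \<epsilon>' * h x \<eta>'"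
  have cp: "continuous_on {a..b} ?p" "continuous_on {a..b} ?p'" for a b
    using lo \<epsilon> by (auto intro!: continuous_intros cont)
  have ip: "?p' integrable_on {a..b}" for a b by (intro integrable_continuous_interval cp)
  have s'R: "- (2 * R) \<le> s'" "t \<le> 2 * R" "- (2 * R) \<le> t'" using st r \<delta> \<epsilon> by auto
  have p'b: "\<bar>?p' x\<bar> \<le> Q * Q * Q" if "\<bar>x\<bar> \<le> 2 * R" for x
  proof -
    have "\<bar>u x \<epsilon>'\<bar> \<le> Q" "\<bar>v x \<epsilon>'\<bar> \<le> Q" "\<bar>h x \<eta>'\<bar> \<le> Q"
      using bd[of x \<epsilon>'] bd[of x \<eta>'] that lo Qb[of \<epsilon>'] Qb[of \<eta>'] r \<epsilon> by auto
    then show ?thesis unfolding abs_mult using QP by (intro mult_mono) auto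
  qed
  have ends: "\<bar>integral {a..b} ?p'\<bar> \<le> Q * Q * Q * \<delta>" if "a \<le> b" "b - a \<le> \<delta>" "- (2 * R) \<le> a" "b \<le> 2 * R" for a b
  proof -
    have "norm (integral {a..b} ?p') \<le> Q * Q * Q * (b - a)"
      using that by (intro integral_bound cp) (auto intro!: p'b)
    also have "\<dots> \<le> Q * Q * Q * \<delta>" using that QP by (intro mult_left_mono) auto
    finally show ?thesis by simp
  qed
  have main: "\<bar>integral {s..t} (\<lambda>x. ?p x - ?p' x)\<bar> \<le> 3 * (Q * Q * P) * (2 * R)"
  proof -
    have "norm (integral {s..t} (\<lambda>x. ?p x - ?p' x)) \<le> 3 * (Q * Q * P) * (t - s)"
    proof (intro integral_bound continuous_on_diff cp)
      fix x assume "x \<in> {s..t}"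
      then have x: "\<bar>x\<bar> \<le> 2 * R" using st by auto
      have ub: "\<bar>u x y\<bar> \<le> Q \<and> \<bar>v x y\<bar> \<le> Q \<and> \<bar>h x y\<bar> \<le> Q" if "\<epsilon> / 2 \<le> y" "y \<le> 2 * R" for y
      proof -
        have "0 < y" using that \<epsilon> by linarith
        then show ?thesis using bd[OF x _ that(2)] Qb[OF that(1)] by (meson order.trans)
      qed
      have ul: "\<bar>u x y - u x y'\<bar> \<le> P \<and> \<bar>v x y - v x y'\<bar> \<le> P \<and> \<bar>h x y - h x y'\<bar> \<le> P"
        if "\<epsilon> / 2 \<le> y'" "y' \<le> y" "y - y' \<le> \<delta>" "y \<le> 2 * R" for y y'
      proof -
        have "0 < y'" using that \<epsilon> by linarith
        then show ?thesis using lp[OF x _ that(2) that(4)] Pb[OF that(1-3)] by (meson order.trans)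
      qed
      have "\<bar>u x \<epsilon>\<bar> \<le> Q \<and> \<bar>v x \<epsilon>\<bar> \<le> Q \<and> \<bar>h x \<epsilon>\<bar> \<le> Q" "\<bar>u x \<epsilon>'\<bar> \<le> Q \<and> \<bar>v x \<epsilon>'\<bar> \<le> Q \<and> \<bar>h x \<epsilon>'\<bar> \<le> Q"
        "\<bar>u x \<eta>\<bar> \<le> Q \<and> \<bar>v x \<eta>\<bar> \<le> Q \<and> \<bar>h x \<eta>\<bar> \<le> Q" "\<bar>u x \<eta>'\<bar> \<le> Q \<and> \<bar>v x \<eta>'\<bar> \<le> Q \<and> \<bar>h x \<eta>'\<bar> \<le> Q"
        using lo r \<epsilon> by (intro ub; linarith)+
      moreover have "\<bar>u x \<epsilon> - u x \<epsilon>'\<bar> \<le> P \<and> \<bar>v x \<epsilon> - v x \<epsilon>'\<bar> \<le> P \<and> \<bar>h x \<epsilon> - h x \<epsilon>'\<bar> \<le> P"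
        "\<bar>u x \<eta> - u x \<eta>'\<bar> \<le> P \<and> \<bar>v x \<eta> - v x \<eta>'\<bar> \<le> P \<and> \<bar>h x \<eta> - h x \<eta>'\<bar> \<le> P"
        using lo r \<epsilon> by (intro ul; linarith)+
      ultimately show "norm (?p x - ?p' x) \<le> 3 * (Q * Q * P)"
        unfolding real_norm_def by (intro product_difference_le) blast+
    qed (use st in auto)
    also have "\<dots> \<le> 3 * (Q * Q * P) * (2 * R)" using st QP by (intro mult_left_mono) auto
    finally show ?thesis by simp
  qed
  have "integral {s..t} (\<lambda>x. ?p x - ?p' x) = integral {s..t} ?p - integral {s..t} ?p'"
    by (intro integral_diff integrable_continuous_interval cp)
  moreover have "integral {s'..s} ?p' + integral {s..t} ?p' = integral {s'..t} ?p'"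
    using st r ip by (intro Henstock_Kurzweil_Integration.integral_combine) auto
  moreover have "integral {s'..t'} ?p' + integral {t'..t} ?p' = integral {s'..t} ?p'"
    using st r ip by (intro Henstock_Kurzweil_Integration.integral_combine) auto
  moreover have "\<bar>integral {s'..s} ?p'\<bar> \<le> Q * Q * Q * \<delta>" "\<bar>integral {t'..t} ?p'\<bar> \<le> Q * Q * Q * \<delta>"
    using r s'R st by (auto intro!: ends)
  ultimately have "\<bar>integral {s..t} ?p - integral {s'..t'} ?p'\<bar> \<le> 3 * (Q * Q * P) * (2 * R) + 2 * (Q * Q * Q * \<delta>)"
    using main by linarith
  also have "Q * Q * Q * \<delta> = 8 * C ^ 3 * \<delta> / \<epsilon> ^ 4 * \<epsilon>"
    using \<epsilon> by (simp add: Q_def eval_nat_numeral)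
  also have "8 * C ^ 3 * \<delta> / \<epsilon> ^ 4 * \<epsilon> \<le> 8 * C ^ 3 * \<delta> / \<epsilon> ^ 4 * (2 * R)"
    using \<epsilon> C \<delta>0 by (intro mult_left_mono) auto
  also have "3 * (Q * Q * P) * (2 * R) + 2 * (8 * C ^ 3 * \<delta> / \<epsilon> ^ 4 * (2 * R)) = (128 * R * C ^ 3) / \<epsilon> ^ 4 * \<delta>"
    using \<epsilon> by (simp add: Q_def P_def eval_nat_numeral)
  finally show ?thesis by simp
qed

lemma independent_pair:
  assumes M: "prob_space M" and X: "independent_copies \<alpha> M {1, 2, 3} X" and A: "A \<subseteq> {1, 2, 3}" "B \<subseteq> {1, 2, 3}" "A \<inter> B = {}"
  shows "prob_space.indep_var M (path_space A) (paths X A)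
     (path_space B) (paths X B)"
  using prob_space.indep_var_restrict[OF M _ A(3) A(1) A(2)] X unfolding independent_copies_def by blast

lemma weight_power:
  assumes "s \<le> t" "0 < \<epsilon>" "0 < \<eta>"
  shows "weight \<alpha> p \<epsilon> \<eta> s t ^ (2 * m)
    = ((t - s + \<epsilon>) powr (2 * \<alpha> + 1/2) * \<epsilon> powr (-1/2)) ^ m * (\<epsilon> powr (2 * \<alpha> - 2)) ^ m * (\<eta> powr (- 2 * p)) ^ m"
proof -
  have sq: "(x powr y)\<^sup>2 = x powr (2 * y)" for x y :: real
    by (simp add: power2_eq_square powr_add[symmetric])
  have e: "2 * (\<alpha> + 1/4) = 2 * \<alpha> + 1/2" "2 * (\<alpha> - 5/4) = -1/2 + (2 * \<alpha> - 2)" "2 * - p = - 2 * p" by simp_all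
  have "(weight \<alpha> p \<epsilon> \<eta> s t)\<^sup>2
      = (t - s + \<epsilon>) powr (2 * \<alpha> + 1/2) * (\<epsilon> powr (-1/2) * \<epsilon> powr (2 * \<alpha> - 2)) * \<eta> powr (- 2 * p)"
    by (simp only: weight_def power_mult_distrib sq e powr_add[of \<epsilon> "-1/2" "2 * \<alpha> - 2"])
  then have "((weight \<alpha> p \<epsilon> \<eta> s t)\<^sup>2) ^ m = (((t - s + \<epsilon>) powr (2 * \<alpha> + 1/2) * \<epsilon> powr (-1/2)) * \<epsilon> powr (2 * \<alpha> - 2) * \<eta> powr (- 2 * p)) ^ m"
    by (simp only: mult.assoc)
  then show ?thesis by (simp only: power_mult[symmetric] power_mult_distrib)
qed

lemma riemann_mesh_small:
  fixes \<epsilon> L :: real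
  assumes "0 < \<epsilon>"
  obtains N where "\<And>n. n \<ge> N \<Longrightarrow> L / real (Suc n) \<le> \<epsilon>"
proof -
  obtain N :: nat where N: "L / \<epsilon> < real N" using reals_Archimedean2 by blast
  have "L / real (Suc n) \<le> \<epsilon>" if "n \<ge> N" for n
  proof -
    have "L / \<epsilon> \<le> real (Suc n)" using N that by linarith
    then show ?thesis using assms by (simp add: field_simps)
  qed
  then show ?thesis using that by blast
qed

text \<open>The factor \<open>v\<close> is a function of the sample paths with indices in \<open>J\<close>, which are independent of the path
with index \<open>i\<close>.\<close>

lemma product_integral_majorant:
  fixes v :: "real \<Rightarrow> (nat \<Rightarrow> complex \<Rightarrow> complex) \<Rightarrow> real"
  assumes M: "prob_space M" and X: "independent_copies \<alpha> M {1, 2, 3} X" and \<alpha>: "1/4 < \<alpha>" "\<alpha> < 1"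
    and i: "i \<in> {1, 2, 3}" and J: "J \<subseteq> {1, 2, 3}" "i \<notin> J"
    and v: "\<And>x. v x \<in> borel_measurable (path_space J)"
    and mom: "\<And>x. (\<integral>\<^sup>+\<omega>. ennreal (v x (paths X J \<omega>) ^ (2 * m)) \<partial>M) \<le> ennreal b" and b: "0 \<le> b"
    and m: "0 < m" and c: "norm c = 1" and st: "s \<le> t" and \<epsilon>: "0 < \<epsilon>"
  shows "\<exists>Z\<in>borel_measurable M. (\<integral>\<^sup>+\<omega>. Z \<omega> \<partial>M) \<le> ennreal (gaussian_constant m *
        (96 * kernel_const \<alpha> * ((t - s + \<epsilon>) powr (2 * \<alpha> + 1/2) * \<epsilon> powr (-1/2))) ^ m * b) \<and>
     (\<forall>\<omega>. continuous_on {s..t} (\<lambda>x. Re (c * X i (Complex x \<epsilon>) \<omega>) * v x (paths X J \<omega>)) \<longrightarrow>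
       ennreal (integral {s..t} (\<lambda>x. Re (c * X i (Complex x \<epsilon>) \<omega>) * v x (paths X J \<omega>)) ^ (2 * m)) \<le> Z \<omega>)"
proof -
  have Xi: "analytic_fbm_derivative \<alpha> M (X i)" using X i unfolding independent_copies_def by blast
  note ind = independent_pair[OF M X, of "{i}" J]
  have ind': "prob_space.indep_var M (path_space {i}) (paths X {i})
     (path_space J) (paths X J)"
    using i J by (intro ind) auto
  have mJ: "(paths X J) \<in> measurable M (path_space J)"
    using prob_space.indep_var_rv2[OF M ind'] .
  obtain N where N: "\<And>n. n \<ge> N \<Longrightarrow> (t - s) / real (Suc n) \<le> \<epsilon>" using riemann_mesh_small[OF \<epsilon>] by blast
  show ?thesis
  proof (rule integral_moment_majorant[OF st, where N = N])
    fix x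
    have "(\<lambda>\<omega>. v x (paths X J \<omega>)) \<in> borel_measurable M"
      by (rule measurable_compose[OF mJ v])
    moreover have "X i (Complex x \<epsilon>) \<in> borel_measurable M" using \<epsilon> by (intro field_measurable[OF Xi]) simp
    ultimately show "(\<lambda>\<omega>. Re (c * X i (Complex x \<epsilon>) \<omega>) * v x (paths X J \<omega>)) \<in> borel_measurable M"
      by measurable
  next
    fix n assume "n \<ge> N"
    then show "(\<integral>\<^sup>+\<omega>. ennreal (riemann_sum s t n (\<lambda>x. Re (c * X i (Complex x \<epsilon>) \<omega>) * v x (paths X J \<omega>)) ^ (2 * m)) \<partial>M)
      \<le> ennreal (gaussian_constant m * (96 * kernel_const \<alpha> * ((t - s + \<epsilon>) powr (2 * \<alpha> + 1/2) * \<epsilon> powr (-1/2))) ^ m * b)"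
      using N by (intro field_riemann_moment[OF M Xi \<alpha> ind' v mom b m c st \<epsilon>]) auto
  qed
qed

text \<open>Regularity of a sample path to the low precision that rounding to a fine grid asks for.\<close>

definition regular_field :: "real \<Rightarrow> (real \<Rightarrow> real \<Rightarrow> real) \<Rightarrow> bool" where
  "regular_field R u \<longleftrightarrow> (\<forall>y>0. \<forall>a b. continuous_on {a..b} (\<lambda>x. u x y)) \<and>
     (\<exists>C\<ge>0. \<forall>x y. \<bar>x\<bar> \<le> 2 * R \<longrightarrow> 0 < y \<longrightarrow> y \<le> 2 * R \<longrightarrow>
        \<bar>u x y\<bar> \<le> C / y \<and> (\<forall>y'. 0 < y' \<longrightarrow> y' \<le> y \<longrightarrow> \<bar>u x y - u x y'\<bar> \<le> C / y'\<^sup>2 * (y - y')))"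

lemma regular_field_const: "0 < R \<Longrightarrow> regular_field R (\<lambda>_ _. 1)"
  unfolding regular_field_def
  by (auto intro!: exI[of _ "2 * R"] mult_nonneg_nonneg divide_nonneg_nonneg simp: pos_le_divide_eq)

lemma regular_field_continuous:
  "regular_field R u \<Longrightarrow> 0 < y \<Longrightarrow> continuous_on {a..b} (\<lambda>x. u x y)"
  by (simp add: regular_field_def)

lemma regular_triple_lipschitz:
  assumes u: "regular_field R u" and v: "regular_field R v" and h: "regular_field R h" and R: "0 < R"
  shows "\<exists>C\<ge>0. \<forall>\<epsilon> \<eta> s t \<epsilon>' \<eta>' s' t' \<delta>.
       admissible R \<epsilon> \<eta> s t \<longrightarrow> s' \<le> t' \<longrightarrow> \<delta> \<le> \<epsilon> / 2 \<longrightarrow> close_below \<delta> \<epsilon> \<epsilon>' \<longrightarrow> close_below \<delta> \<eta> \<eta>' \<longrightarrow>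
       close_below \<delta> s s' \<longrightarrow> close_below \<delta> t t' \<longrightarrow>
       \<bar>integral {s..t} (\<lambda>x. u x \<epsilon> * v x \<epsilon> * h x \<eta>) - integral {s'..t'} (\<lambda>x. u x \<epsilon>' * v x \<epsilon>' * h x \<eta>')\<bar> \<le> C / \<epsilon> ^ 4 * \<delta>"
proof -
  obtain C1 where C1: "0 \<le> C1" "\<And>x y. \<bar>x\<bar> \<le> 2 * R \<Longrightarrow> 0 < y \<Longrightarrow> y \<le> 2 * R \<Longrightarrow> \<bar>u x y\<bar> \<le> C1 / y"
    "\<And>x y y'. \<bar>x\<bar> \<le> 2 * R \<Longrightarrow> 0 < y' \<Longrightarrow> y' \<le> y \<Longrightarrow> y \<le> 2 * R \<Longrightarrow> \<bar>u x y - u x y'\<bar> \<le> C1 / y'\<^sup>2 * (y - y')"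
    using u unfolding regular_field_def by (meson less_le_trans)
  obtain C2 where C2: "0 \<le> C2" "\<And>x y. \<bar>x\<bar> \<le> 2 * R \<Longrightarrow> 0 < y \<Longrightarrow> y \<le> 2 * R \<Longrightarrow> \<bar>v x y\<bar> \<le> C2 / y"
    "\<And>x y y'. \<bar>x\<bar> \<le> 2 * R \<Longrightarrow> 0 < y' \<Longrightarrow> y' \<le> y \<Longrightarrow> y \<le> 2 * R \<Longrightarrow> \<bar>v x y - v x y'\<bar> \<le> C2 / y'\<^sup>2 * (y - y')"
    using v unfolding regular_field_def by (meson less_le_trans)
  obtain C3 where C3: "0 \<le> C3" "\<And>x y. \<bar>x\<bar> \<le> 2 * R \<Longrightarrow> 0 < y \<Longrightarrow> y \<le> 2 * R \<Longrightarrow> \<bar>h x y\<bar> \<le> C3 / y"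
    "\<And>x y y'. \<bar>x\<bar> \<le> 2 * R \<Longrightarrow> 0 < y' \<Longrightarrow> y' \<le> y \<Longrightarrow> y \<le> 2 * R \<Longrightarrow> \<bar>h x y - h x y'\<bar> \<le> C3 / y'\<^sup>2 * (y - y')"
    using h unfolding regular_field_def by (meson less_le_trans)
  define C where "C = C1 + C2 + C3"
  have C0: "0 \<le> C" using C1 C2 C3 by (simp add: C_def)
  have up: "c / y \<le> C / y" "c / y\<^sup>2 * d \<le> C / y\<^sup>2 * d" if "c \<in> {C1, C2, C3}" "0 < y" "0 \<le> d" for c y d
  proof -
    have "c \<le> C" using that C1(1) C2(1) C3(1) by (auto simp: C_def)
    then show "c / y \<le> C / y" "c / y\<^sup>2 * d \<le> C / y\<^sup>2 * d" using that by (auto intro!: divide_right_mono mult_right_mono)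
  qed
  have c: "continuous_on {a..b} (\<lambda>x. u x y)" "continuous_on {a..b} (\<lambda>x. v x y)" "continuous_on {a..b} (\<lambda>x. h x y)" if "0 < y" for a b y
    using regular_field_continuous[OF u that] regular_field_continuous[OF v that] regular_field_continuous[OF h that] by simp_all
  have bd: "\<bar>u x y\<bar> \<le> C / y \<and> \<bar>v x y\<bar> \<le> C / y \<and> \<bar>h x y\<bar> \<le> C / y" if "\<bar>x\<bar> \<le> 2 * R" "0 < y" "y \<le> 2 * R" for x y
    using order.trans[OF C1(2)[OF that] up(1)[of C1 y 0]] order.trans[OF C2(2)[OF that] up(1)[of C2 y 0]]
      order.trans[OF C3(2)[OF that] up(1)[of C3 y 0]] that by auto
  have lp: "\<bar>u x y - u x y'\<bar> \<le> C / y'\<^sup>2 * (y - y') \<and> \<bar>v x y - v x y'\<bar> \<le> C / y'\<^sup>2 * (y - y') \<and> \<bar>h x y - h x y'\<bar> \<le> C / y'\<^sup>2 * (y - y')"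
    if "\<bar>x\<bar> \<le> 2 * R" "0 < y'" "y' \<le> y" "y \<le> 2 * R" for x y y'
    using order.trans[OF C1(3)[OF that] up(2)[of C1 y' "y - y'"]] order.trans[OF C2(3)[OF that] up(2)[of C2 y' "y - y'"]]
      order.trans[OF C3(3)[OF that] up(2)[of C3 y' "y - y'"]] that by auto
  show ?thesis
  proof (intro exI[of _ "128 * R * C ^ 3"] conjI allI impI)
    show "0 \<le> 128 * R * C ^ 3" using R C0 by simp
  qed (rule triple_integral_lipschitz[OF c bd lp C0]; simp add: admissible_def close_below_def)
qed

lemma field_regular:
  assumes M: "prob_space M" and X: "analytic_fbm_derivative \<alpha> M X" and \<alpha>: "1/4 < \<alpha>" "\<alpha> < 1" and R: "0 < R"
  shows "AE \<omega> in M. \<forall>c. norm c = 1 \<longrightarrow> regular_field R (\<lambda>x y. Re (c * X (Complex x y) \<omega>))"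
proof -
  have "AE \<omega> in M. \<exists>C\<ge>0. \<forall>x y. \<bar>x\<bar> \<le> 4 * R \<longrightarrow> 0 < y \<longrightarrow> y \<le> 4 * R \<longrightarrow> norm (X (Complex x y) \<omega>) \<le> C * y powr (1/4 - 1)"
    using \<alpha> R by (intro field_sup_bound[OF M X]) auto
  moreover have "AE \<omega> in M. (\<lambda>z. X z \<omega>) analytic_on upper_half_plane"
    using X by (simp add: analytic_fbm_derivative_def)
  ultimately show ?thesis
  proof eventually_elim
    case (elim \<omega>)
    obtain C where C: "0 \<le> C" "\<And>x y. \<bar>x\<bar> \<le> 4 * R \<Longrightarrow> 0 < y \<Longrightarrow> y \<le> 4 * R \<Longrightarrow> norm (X (Complex x y) \<omega>) \<le> C * y powr (1/4 - 1)"
      using elim(1) by blast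
    have hol: "(\<lambda>z. X z \<omega>) holomorphic_on upper_half_plane" using elim(2) by (rule analytic_imp_holomorphic)
    define C' where "C' = C * (4 * R) powr (1/4)"
    have C': "0 \<le> C'" using C by (simp add: C'_def)
    have b: "norm (X (Complex x y) \<omega>) \<le> C' / y" if "\<bar>x\<bar> \<le> 4 * R" "0 < y" "y \<le> 4 * R" for x y
    proof -
      have "y powr (1/4 - 1) = y powr (1/4) / y" using that powr_diff[of y "1/4" 1] by simp
      also have "\<dots> \<le> (4 * R) powr (1/4) / y" using that by (intro divide_right_mono powr_mono2) auto
      finally have "C * y powr (1/4 - 1) \<le> C * ((4 * R) powr (1/4) / y)" using C(1) by (rule mult_left_mono)
      then show ?thesis using C(2)[OF that] by (simp add: C'_def)
    qed
    have l: "norm (X (Complex x y) \<omega> - X (Complex x y') \<omega>) \<le> 4 * C' / y'\<^sup>2 * (y - y')"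
      if "\<bar>x\<bar> \<le> 2 * R" "0 < y'" "y' \<le> y" "y \<le> 2 * R" for x y y'
      using inverse_square_lipschitz[OF hol b that C'] .
    show ?case
    proof (intro allI impI)
      fix c :: complex assume c: "norm c = 1"
      have Re1: "\<bar>Re (c * z)\<bar> \<le> norm z" for z using abs_Re_le_cmod[of "c * z"] c by (simp add: norm_mult)
      have "\<bar>Re (c * X (Complex x y) \<omega>)\<bar> \<le> 4 * C' / y" if "\<bar>x\<bar> \<le> 2 * R" "0 < y" "y \<le> 2 * R" for x y
      proof -
        have "C' / y \<le> 4 * C' / y" using C' that by (intro divide_right_mono) auto
        then show ?thesis using Re1[of "X (Complex x y) \<omega>"] b[of x y] that R by linarith
      qed
      moreover have "\<bar>Re (c * X (Complex x y) \<omega>) - Re (c * X (Complex x y') \<omega>)\<bar> \<le> 4 * C' / y'\<^sup>2 * (y - y')"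
        if "\<bar>x\<bar> \<le> 2 * R" "0 < y'" "y' \<le> y" "y \<le> 2 * R" for x y y'
        using Re1[of "X (Complex x y) \<omega> - X (Complex x y') \<omega>"] l[OF that] unfolding right_diff_distrib minus_complex.sel(1) by linarith
      moreover have "continuous_on {a..b} (\<lambda>x. Re (c * X (Complex x y) \<omega>))" if "0 < y" for a b y
        using that by (intro continuous_intros continuous_on_compose2[OF holomorphic_on_imp_continuous_on[OF hol]]) auto
      ultimately show "regular_field R (\<lambda>x y. Re (c * X (Complex x y) \<omega>))"
        unfolding regular_field_def using C' by (intro conjI exI[of _ "4 * C'"]) auto
    qed
  qed
qed

text \<open>The common core of the bounds for two and for three fields; in the first case the factor \<open>h\<close> is the
constant \<open>1\<close> and \<open>p = 0\<close>.\<close>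

lemma product_sup_bound:
  fixes g :: "real \<Rightarrow> real \<Rightarrow> real \<Rightarrow> (nat \<Rightarrow> complex \<Rightarrow> complex) \<Rightarrow> real" and u h :: "real \<Rightarrow> real \<Rightarrow> 'w \<Rightarrow> real"
  assumes M: "prob_space M" and X: "independent_copies \<alpha> M {1, 2, 3} X" and \<beta>: "1/4 < \<beta>" "\<beta> < \<alpha>" "\<alpha> < 1"
    and i: "i \<in> {1, 2, 3}" and J: "J \<subseteq> {1, 2, 3}" "i \<notin> J" and c: "norm c = 1" and p: "0 \<le> p" "p \<le> 1" and R: "1 \<le> R"
    and g: "\<And>\<epsilon> \<eta> x. 0 < \<epsilon> \<Longrightarrow> 0 < \<eta> \<Longrightarrow> g \<epsilon> \<eta> x \<in> borel_measurable (path_space J)"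
    and g_eq: "\<And>\<epsilon> \<eta> x \<omega>. 0 < \<epsilon> \<Longrightarrow> 0 < \<eta> \<Longrightarrow> g \<epsilon> \<eta> x (paths X J \<omega>) = u x \<epsilon> \<omega> * h x \<eta> \<omega>"
    and mom: "\<And>m. 0 < m \<Longrightarrow> \<exists>D\<ge>0. \<forall>\<epsilon> \<eta> x. 0 < \<epsilon> \<longrightarrow> 0 < \<eta> \<longrightarrow>
       (\<integral>\<^sup>+\<omega>. ennreal ((u x \<epsilon> \<omega> * h x \<eta> \<omega>) ^ (2 * m)) \<partial>M) \<le> ennreal (D * ((\<epsilon> powr (2 * \<alpha> - 2)) ^ m * (\<eta> powr (- 2 * p)) ^ m))"
    and reg: "AE \<omega> in M. regular_field R (\<lambda>x y. u x y \<omega>)" "AE \<omega> in M. regular_field R (\<lambda>x y. h x y \<omega>)"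
  shows "AE \<omega> in M. \<exists>C\<ge>0. \<forall>\<epsilon> \<eta> s t. admissible R \<epsilon> \<eta> s t \<longrightarrow>
       \<bar>integral {s..t} (\<lambda>x. Re (c * X i (Complex x \<epsilon>) \<omega>) * u x \<epsilon> \<omega> * h x \<eta> \<omega>)\<bar> \<le> C * weight \<beta> p \<epsilon> \<eta> s t"
proof -
  have Xi: "analytic_fbm_derivative \<alpha> M (X i)" using X i unfolding independent_copies_def by blast
  define m where "m = Suc (nat \<lceil>21 / (2 * (\<alpha> - \<beta>))\<rceil>)"
  have m: "0 < m" by (simp add: m_def)
  have "21 / (2 * (\<alpha> - \<beta>)) \<le> real m" unfolding m_def by linarith
  then have m21: "21 \<le> (\<alpha> - \<beta>) * real (2 * m)" using \<beta> by (simp add: field_simps)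
  obtain D where D: "0 \<le> D" "\<And>\<epsilon> \<eta> x. 0 < \<epsilon> \<Longrightarrow> 0 < \<eta> \<Longrightarrow>
       (\<integral>\<^sup>+\<omega>. ennreal ((u x \<epsilon> \<omega> * h x \<eta> \<omega>) ^ (2 * m)) \<partial>M) \<le> ennreal (D * ((\<epsilon> powr (2 * \<alpha> - 2)) ^ m * (\<eta> powr (- 2 * p)) ^ m))"
    using mom[OF m] by blast
  define D' where "D' = gaussian_constant m * (96 * kernel_const \<alpha>) ^ m * D"
  have D': "0 \<le> D'" using D gaussian_constant_nonneg kernel_const_nonneg by (simp add: D'_def)
  have regX: "AE \<omega> in M. regular_field R (\<lambda>x y. Re (c * X i (Complex x y) \<omega>))"
    using field_regular[OF M Xi, of R] \<beta> R c by (auto elim: eventually_mono)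
  show ?thesis
  proof (rule grid_sup_bound[OF \<beta> p R m m21 D'])
    fix \<epsilon> \<eta> s t :: real assume par: "0 < \<epsilon>" "0 < \<eta>" "s \<le> t"
    let ?b = "D * ((\<epsilon> powr (2 * \<alpha> - 2)) ^ m * (\<eta> powr (- 2 * p)) ^ m)"
    have "\<exists>Z\<in>borel_measurable M. (\<integral>\<^sup>+\<omega>. Z \<omega> \<partial>M) \<le> ennreal (gaussian_constant m *
        (96 * kernel_const \<alpha> * ((t - s + \<epsilon>) powr (2 * \<alpha> + 1/2) * \<epsilon> powr (-1/2))) ^ m * ?b) \<and>
     (\<forall>\<omega>. continuous_on {s..t} (\<lambda>x. Re (c * X i (Complex x \<epsilon>) \<omega>) * g \<epsilon> \<eta> x (paths X J \<omega>)) \<longrightarrow>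
       ennreal (integral {s..t} (\<lambda>x. Re (c * X i (Complex x \<epsilon>) \<omega>) * g \<epsilon> \<eta> x (paths X J \<omega>)) ^ (2 * m)) \<le> Z \<omega>)"
    proof (rule product_integral_majorant[OF M X _ \<beta>(3) i J])
      show "(\<integral>\<^sup>+\<omega>. ennreal (g \<epsilon> \<eta> x (paths X J \<omega>) ^ (2 * m)) \<partial>M) \<le> ennreal ?b" for x
        using D(2)[OF par(1,2), of x] par by (simp add: g_eq)
    qed (use \<beta> par g D c m in auto)
    also have "gaussian_constant m * (96 * kernel_const \<alpha> * ((t - s + \<epsilon>) powr (2 * \<alpha> + 1/2) * \<epsilon> powr (-1/2))) ^ m * ?b
       = D' * weight \<alpha> p \<epsilon> \<eta> s t ^ (2 * m)"
      unfolding weight_power[OF par(3,1,2)] D'_def power_mult_distrib by (simp only: mult_ac)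
    finally obtain Z where Z: "Z \<in> borel_measurable M" "(\<integral>\<^sup>+\<omega>. Z \<omega> \<partial>M) \<le> ennreal (D' * weight \<alpha> p \<epsilon> \<eta> s t ^ (2 * m))"
      "\<And>\<omega>. continuous_on {s..t} (\<lambda>x. Re (c * X i (Complex x \<epsilon>) \<omega>) * (u x \<epsilon> \<omega> * h x \<eta> \<omega>)) \<Longrightarrow>
         ennreal (integral {s..t} (\<lambda>x. Re (c * X i (Complex x \<epsilon>) \<omega>) * (u x \<epsilon> \<omega> * h x \<eta> \<omega>)) ^ (2 * m)) \<le> Z \<omega>"
      unfolding g_eq[OF par(1,2)] by blast
    have "AE \<omega> in M. ennreal (integral {s..t} (\<lambda>x. Re (c * X i (Complex x \<epsilon>) \<omega>) * u x \<epsilon> \<omega> * h x \<eta> \<omega>) ^ (2 * m)) \<le> Z \<omega>"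
      using regX reg
    proof eventually_elim
      case (elim \<omega>)
      have "continuous_on {s..t} (\<lambda>x. Re (c * X i (Complex x \<epsilon>) \<omega>))" "continuous_on {s..t} (\<lambda>x. u x \<epsilon> \<omega>)" "continuous_on {s..t} (\<lambda>x. h x \<eta> \<omega>)"
        using regular_field_continuous[OF elim(1)] regular_field_continuous[OF elim(2)] regular_field_continuous[OF elim(3)] par by simp_all
      then show ?case using Z(3)[of \<omega>] by (simp only: mult.assoc continuous_on_mult)
    qed
    then show "\<exists>Z\<in>borel_measurable M. (\<integral>\<^sup>+\<omega>. Z \<omega> \<partial>M) \<le> ennreal (D' * weight \<alpha> p \<epsilon> \<eta> s t ^ (2 * m)) \<and>
         (AE \<omega> in M. ennreal (integral {s..t} (\<lambda>x. Re (c * X i (Complex x \<epsilon>) \<omega>) * u x \<epsilon> \<omega> * h x \<eta> \<omega>) ^ (2 * m)) \<le> Z \<omega>)"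
      using Z by blast
  next
    show "AE \<omega> in M. \<exists>C\<ge>0. \<forall>\<epsilon> \<eta> s t \<epsilon>' \<eta>' s' t' \<delta>.
       admissible R \<epsilon> \<eta> s t \<longrightarrow> s' \<le> t' \<longrightarrow> \<delta> \<le> \<epsilon> / 2 \<longrightarrow> close_below \<delta> \<epsilon> \<epsilon>' \<longrightarrow> close_below \<delta> \<eta> \<eta>' \<longrightarrow>
       close_below \<delta> s s' \<longrightarrow> close_below \<delta> t t' \<longrightarrow>
       \<bar>integral {s..t} (\<lambda>x. Re (c * X i (Complex x \<epsilon>) \<omega>) * u x \<epsilon> \<omega> * h x \<eta> \<omega>)
         - integral {s'..t'} (\<lambda>x. Re (c * X i (Complex x \<epsilon>') \<omega>) * u x \<epsilon>' \<omega> * h x \<eta>' \<omega>)\<bar> \<le> C / \<epsilon> ^ 4 * \<delta>"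
      using regX reg
    proof eventually_elim
      case (elim \<omega>)
      show ?case using R by (intro regular_triple_lipschitz[OF elim]) simp
    qed
  qed
qed

lemma re_evaluation_measurable:
  assumes "k \<in> I" "z \<in> upper_half_plane"
  shows "(\<lambda>a. Re (d * a k z)) \<in> borel_measurable (path_space I)"
  by (rule measurable_compose[OF evaluation_measurable[OF assms]]) measurable

lemma pair_sup_bound:
  assumes M: "prob_space M" and X: "independent_copies \<alpha> M {1, 2, 3} X" and \<beta>: "1/4 < \<beta>" "\<beta> < \<alpha>" "\<alpha> < 1"
    and ij: "i \<in> {1, 2, 3}" "j \<in> {1, 2, 3}" "i \<noteq> j" and c: "norm c = 1" "norm d = 1" and R: "1 \<le> R"
  shows "AE \<omega> in M. \<exists>C\<ge>0. \<forall>\<epsilon> s t. admissible R \<epsilon> \<epsilon> s t \<longrightarrow>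
       \<bar>integral {s..t} (\<lambda>x. Re (c * X i (Complex x \<epsilon>) \<omega>) * Re (d * X j (Complex x \<epsilon>) \<omega>))\<bar> \<le> C * weight \<beta> 0 \<epsilon> \<epsilon> s t"
proof -
  have Xj: "analytic_fbm_derivative \<alpha> M (X j)" using X ij unfolding independent_copies_def by blast
  have "AE \<omega> in M. \<exists>C\<ge>0. \<forall>\<epsilon> \<eta> s t. admissible R \<epsilon> \<eta> s t \<longrightarrow>
       \<bar>integral {s..t} (\<lambda>x. Re (c * X i (Complex x \<epsilon>) \<omega>) * Re (d * X j (Complex x \<epsilon>) \<omega>) * 1)\<bar> \<le> C * weight \<beta> 0 \<epsilon> \<eta> s t"
  proof (rule product_sup_bound[OF M X \<beta> ij(1), of "{j}" c 0 R "\<lambda>\<epsilon> \<eta> x b. Re (d * b j (Complex x \<epsilon>))"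
        "\<lambda>x \<epsilon> \<omega>. Re (d * X j (Complex x \<epsilon>) \<omega>)" "\<lambda>_ _ _. 1"])
    show "(\<lambda>b. Re (d * b j (Complex x \<epsilon>))) \<in> borel_measurable (path_space {j})" if "0 < \<epsilon>" for \<epsilon> x :: real
      using that by (intro re_evaluation_measurable) auto
    fix m :: nat assume m: "0 < m"
    show "\<exists>D\<ge>0. \<forall>\<epsilon> \<eta> x. 0 < \<epsilon> \<longrightarrow> 0 < \<eta> \<longrightarrow>
       (\<integral>\<^sup>+\<omega>. ennreal ((Re (d * X j (Complex x \<epsilon>) \<omega>) * 1) ^ (2 * m)) \<partial>M) \<le> ennreal (D * ((\<epsilon> powr (2 * \<alpha> - 2)) ^ m * (\<eta> powr (- 2 * 0)) ^ m))"
    proof (intro exI[of _ "gaussian_constant m * kernel_const \<alpha> ^ m"] conjI allI impI)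
      show "0 \<le> gaussian_constant m * kernel_const \<alpha> ^ m" using gaussian_constant_nonneg kernel_const_nonneg by simp
      fix \<epsilon> \<eta> x :: real assume "0 < \<epsilon>" "0 < \<eta>"
      then show "(\<integral>\<^sup>+\<omega>. ennreal ((Re (d * X j (Complex x \<epsilon>) \<omega>) * 1) ^ (2 * m)) \<partial>M)
          \<le> ennreal (gaussian_constant m * kernel_const \<alpha> ^ m * ((\<epsilon> powr (2 * \<alpha> - 2)) ^ m * (\<eta> powr (- 2 * 0)) ^ m))"
        using field_moment[OF M Xj \<beta>(3) \<open>0 < \<epsilon>\<close> c(2), where x = x and m = m]
        by (simp add: power_mult_distrib mult.assoc del: times_complex.sel)
    qed
  next
    show "AE \<omega> in M. regular_field R (\<lambda>x y. Re (d * X j (Complex x y) \<omega>))"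
      using field_regular[OF M Xj, of R] \<beta> R c by (auto elim: eventually_mono)
  qed (use ij c R in \<open>auto intro!: regular_field_const\<close>)
  then show ?thesis
  proof eventually_elim
    case (elim \<omega>)
    then show ?case by (simp del: times_complex.sel) blast
  qed
qed

text \<open>Given the fields \<open>j\<close> and \<open>l\<close> the integral is Gaussian in the field \<open>i\<close>.  The moments of the product of
the other two are again obtained by decoupling, with a single summand.\<close>

lemma triple_sup_bound:
  assumes M: "prob_space M" and X: "independent_copies \<alpha> M {1, 2, 3} X" and \<beta>: "1/4 < \<beta>" "\<beta> < \<alpha>" "\<alpha> < 1"
    and ijl: "i \<in> {1, 2, 3}" "j \<in> {1, 2, 3}" "l \<in> {1, 2, 3}" "i \<noteq> j" "i \<noteq> l" "j \<noteq> l"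
    and c: "norm c = 1" "norm d = 1" "norm e = 1" and R: "1 \<le> R"
  shows "AE \<omega> in M. \<exists>C\<ge>0. \<forall>\<epsilon> \<eta> s t. admissible R \<epsilon> \<eta> s t \<longrightarrow>
       \<bar>integral {s..t} (\<lambda>x. Re (c * X i (Complex x \<epsilon>) \<omega>) * Re (d * X j (Complex x \<epsilon>) \<omega>) * Re (e * X l (Complex x \<eta>) \<omega>))\<bar>
         \<le> C * weight \<beta> (1 - \<alpha>) \<epsilon> \<eta> s t"
proof (rule product_sup_bound[OF M X \<beta> ijl(1), of "{j, l}" c "1 - \<alpha>" R
      "\<lambda>\<epsilon> \<eta> x b. Re (d * b j (Complex x \<epsilon>)) * Re (e * b l (Complex x \<eta>))"
      "\<lambda>x \<epsilon> \<omega>. Re (d * X j (Complex x \<epsilon>) \<omega>)" "\<lambda>x \<eta> \<omega>. Re (e * X l (Complex x \<eta>) \<omega>)"])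
  have Xj: "analytic_fbm_derivative \<alpha> M (X j)" and Xl: "analytic_fbm_derivative \<alpha> M (X l)"
    using X ijl unfolding independent_copies_def by blast+
  show "(\<lambda>b. Re (d * b j (Complex x \<epsilon>)) * Re (e * b l (Complex x \<eta>))) \<in> borel_measurable (path_space {j, l})"
    if "0 < \<epsilon>" "0 < \<eta>" for \<epsilon> \<eta> x :: real
    using that by (intro borel_measurable_times re_evaluation_measurable) auto
  show "AE \<omega> in M. regular_field R (\<lambda>x y. Re (d * X j (Complex x y) \<omega>))"
    using field_regular[OF M Xj, of R] \<beta> R c by (auto elim: eventually_mono)
  show "AE \<omega> in M. regular_field R (\<lambda>x y. Re (e * X l (Complex x y) \<omega>))"
    using field_regular[OF M Xl, of R] \<beta> R c by (auto elim: eventually_mono)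
  fix m :: nat assume m: "0 < m"
  show "\<exists>D\<ge>0. \<forall>\<epsilon> \<eta> x. 0 < \<epsilon> \<longrightarrow> 0 < \<eta> \<longrightarrow>
       (\<integral>\<^sup>+\<omega>. ennreal ((Re (d * X j (Complex x \<epsilon>) \<omega>) * Re (e * X l (Complex x \<eta>) \<omega>)) ^ (2 * m)) \<partial>M)
         \<le> ennreal (D * ((\<epsilon> powr (2 * \<alpha> - 2)) ^ m * (\<eta> powr (- 2 * (1 - \<alpha>))) ^ m))"
  proof (intro exI[of _ "gaussian_constant m * kernel_const \<alpha> ^ m * (gaussian_constant m * kernel_const \<alpha> ^ m)"] conjI allI impI)
    show "0 \<le> gaussian_constant m * kernel_const \<alpha> ^ m * (gaussian_constant m * kernel_const \<alpha> ^ m)"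
      using gaussian_constant_nonneg kernel_const_nonneg by simp
    fix \<epsilon> \<eta> x :: real assume y: "0 < \<epsilon>" "0 < \<eta>"
    have z: "Complex x \<epsilon> \<in> upper_half_plane" "Complex x \<eta> \<in> upper_half_plane" using y by auto
    let ?A = "\<lambda>k \<omega>. \<lambda>k\<in>{k}. \<lambda>z\<in>upper_half_plane. X k z \<omega>"
    let ?K = "kernel_const \<alpha> * \<epsilon> powr (2 * \<alpha> - 2)"
    let ?b = "gaussian_constant m * (kernel_const \<alpha> * \<eta> powr (2 * \<alpha> - 2)) ^ m"
    have "(\<integral>\<^sup>+\<omega>. ennreal ((\<Sum>n<1::nat. Re (d * ?A j \<omega> j (Complex x \<epsilon>)) * Re (e * ?A l \<omega> l (Complex x \<eta>))) ^ (2 * m)) \<partial>M)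
      \<le> ennreal (gaussian_constant m * (\<Sum>n<1::nat. \<Sum>k<1::nat. ?K) ^ m * ?b)"
    proof (rule decoupled_moment[OF M independent_pair[OF M X, of "{j}" "{l}"],
        where u = "\<lambda>_ a. Re (d * a j (Complex x \<epsilon>))" and v = "\<lambda>_ a. Re (e * a l (Complex x \<eta>))" and n = 1 and c = "\<lambda>_ _. ?K"])
      show "(\<lambda>a. Re (d * a j (Complex x \<epsilon>))) \<in> borel_measurable (path_space {j})"
        using z by (intro re_evaluation_measurable) auto
      show "(\<lambda>a. Re (e * a l (Complex x \<eta>))) \<in> borel_measurable (path_space {l})"
        using z by (intro re_evaluation_measurable) auto
      show "centered_gaussian_rv M (\<lambda>\<omega>. \<Sum>n<1::nat. y n * Re (d * ?A j \<omega> j (Complex x \<epsilon>)))" for y :: "nat \<Rightarrow> real"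
        using field_combination_gaussian[OF Xj, of 1 "\<lambda>_. Complex x \<epsilon>" y d] z by simp
      show "\<bar>\<integral>\<omega>. Re (d * ?A j \<omega> j (Complex x \<epsilon>)) * Re (d * ?A j \<omega> j (Complex x \<epsilon>)) \<partial>M\<bar> \<le> ?K"
      proof -
        have "\<bar>\<integral>\<omega>. Re (d * X j (Complex x \<epsilon>) \<omega>) * Re (d * X j (Complex x \<epsilon>) \<omega>) \<partial>M\<bar>
           \<le> kernel_const \<alpha> * norm (Complex x \<epsilon> - cnj (Complex x \<epsilon>)) powr (2 * \<alpha> - 2)"
          by (rule field_covariance_bound[OF M Xj z(1) z(1) c(2)])
        also have "\<dots> \<le> ?K"
          using kernel_const_nonneg y \<beta> by (intro mult_left_mono powr_mono2') (auto simp: cmod_def real_sqrt_mult)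
        finally show ?thesis using z by (simp del: times_complex.sel)
      qed
      show "(\<integral>\<^sup>+\<omega>. ennreal (Re (e * ?A l \<omega> l (Complex x \<eta>)) ^ (2 * m)) \<partial>M) \<le> ennreal ?b"
        using field_moment[OF M Xl \<beta>(3) y(2) c(3), where x = x and m = m] z by (simp del: times_complex.sel)
      show "0 \<le> ?b" using gaussian_constant_nonneg kernel_const_nonneg by simp
    qed (use ijl m in auto)
    then show "(\<integral>\<^sup>+\<omega>. ennreal ((Re (d * X j (Complex x \<epsilon>) \<omega>) * Re (e * X l (Complex x \<eta>) \<omega>)) ^ (2 * m)) \<partial>M)
       \<le> ennreal (gaussian_constant m * kernel_const \<alpha> ^ m * (gaussian_constant m * kernel_const \<alpha> ^ m) * ((\<epsilon> powr (2 * \<alpha> - 2)) ^ m * (\<eta> powr (- 2 * (1 - \<alpha>))) ^ m))"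
      using z by (simp add: power_mult_distrib mult_ac del: times_complex.sel)
  qed
qed (use ijl c R \<beta> in auto)

section \<open>Convergence of the third iterated integrals\<close>

lemma finite_uniform_constant:
  fixes P :: "'i \<Rightarrow> real \<Rightarrow> bool"
  assumes S: "finite S" and ex: "\<And>\<tau>. \<tau> \<in> S \<Longrightarrow> \<exists>C\<ge>0. P \<tau> C"
    and mono: "\<And>\<tau> C C'. P \<tau> C \<Longrightarrow> C \<le> C' \<Longrightarrow> P \<tau> C'"
  shows "\<exists>C\<ge>0. \<forall>\<tau>\<in>S. P \<tau> C"
proof -
  obtain c where c: "\<And>\<tau>. \<tau> \<in> S \<Longrightarrow> 0 \<le> c \<tau> \<and> P \<tau> (c \<tau>)" using ex by metis
  have "P \<tau> (\<Sum>\<tau>\<in>S. c \<tau>)" if "\<tau> \<in> S" for \<tau>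
  proof (rule mono)
    show "P \<tau> (c \<tau>)" using c that by blast
    show "c \<tau> \<le> (\<Sum>\<tau>\<in>S. c \<tau>)" using c S that by (intro member_le_sum) auto
  qed
  moreover have "0 \<le> (\<Sum>\<tau>\<in>S. c \<tau>)" using c by (intro sum_nonneg) auto
  ultimately show ?thesis by blast
qed

definition pair_bound :: "(nat \<Rightarrow> complex \<Rightarrow> 'w \<Rightarrow> complex) \<Rightarrow> real \<Rightarrow> real \<Rightarrow> 'w \<Rightarrow> nat \<Rightarrow> nat \<Rightarrow> complex \<Rightarrow> complex \<Rightarrow> real \<Rightarrow> bool" where
  "pair_bound X R \<beta> \<omega> i j c d C \<longleftrightarrow> (\<forall>\<epsilon> s t. admissible R \<epsilon> \<epsilon> s t \<longrightarrow>
     \<bar>integral {s..t} (\<lambda>x. Re (c * X i (Complex x \<epsilon>) \<omega>) * Re (d * X j (Complex x \<epsilon>) \<omega>))\<bar> \<le> C * weight \<beta> 0 \<epsilon> \<epsilon> s t)"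

definition triple_bound :: "(nat \<Rightarrow> complex \<Rightarrow> 'w \<Rightarrow> complex) \<Rightarrow> real \<Rightarrow> real \<Rightarrow> real \<Rightarrow> 'w \<Rightarrow> nat \<Rightarrow> nat \<Rightarrow> nat \<Rightarrow> complex \<Rightarrow> complex \<Rightarrow> real \<Rightarrow> bool" where
  "triple_bound X R p \<beta> \<omega> i j l c d C \<longleftrightarrow> (\<forall>\<epsilon> \<eta> s t. admissible R \<epsilon> \<eta> s t \<longrightarrow>
     \<bar>integral {s..t} (\<lambda>x. Re (c * X i (Complex x \<epsilon>) \<omega>) * Re (d * X j (Complex x \<epsilon>) \<omega>) * Re (\<i> * X l (Complex x \<eta>) \<omega>))\<bar> \<le> C * weight \<beta> p \<epsilon> \<eta> s t)"

lemma pair_bound_mono: "pair_bound X R \<beta> \<omega> i j c d C \<Longrightarrow> C \<le> C' \<Longrightarrow> pair_bound X R \<beta> \<omega> i j c d C'"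
  unfolding pair_bound_def
  by (intro allI impI, rule order.trans[OF _ mult_right_mono[OF _ weight_nonneg, of C C']]) auto

lemma triple_bound_mono: "triple_bound X R p \<beta> \<omega> i j l c d C \<Longrightarrow> C \<le> C' \<Longrightarrow> triple_bound X R p \<beta> \<omega> i j l c d C'"
  unfolding triple_bound_def
  by (intro allI impI, rule order.trans[OF _ mult_right_mono[OF _ weight_nonneg, of C C']]) auto

text \<open>An area density is four times the difference of \<open>Re (c * f) * Re (d * g)\<close> over these two pairs.\<close>

definition phase_pairs :: "(complex \<times> complex) set" where
  "phase_pairs = {(1, \<i>), (\<i>, 1)}"

lemma area_density_eq_phases:
  "area_density f g x y = 4 * (Re (1 * f (Complex x y)) * Re (\<i> * g (Complex x y)) - Re (\<i> * f (Complex x y)) * Re (1 * g (Complex x y)))"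
  by (simp add: area_density_def re2_def im2_def)

lemma im2_eq_phase: "im2 f x y = 2 * Re (\<i> * f (Complex x y))"
  by (simp add: im2_def)

text \<open>The null set must not depend on the choice of the primitives, which is made afterwards, path by path.\<close>

lemma half_plane_fields_AE:
  assumes M: "prob_space M" and X: "independent_copies \<alpha> M {1, 2, 3} X" and \<beta>: "1/4 < \<beta>" "\<beta> < \<alpha>" "\<alpha> < 1" and R: "1 \<le> R"
  shows "AE \<omega> in M. \<exists>C. \<forall>F. (\<forall>i\<in>indices. \<forall>z\<in>upper_half_plane. (F i has_field_derivative X i z \<omega>) (at z)) \<longrightarrow>
     half_plane_fields (\<lambda>i z. X i z \<omega>) F C \<beta> R"
proof -
  have Xi: "analytic_fbm_derivative \<alpha> M (X i)" if "i \<in> indices" for i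
    using X that unfolding independent_copies_def indices_def by blast
  have fin: "finite indices" "finite (triples \<times> phase_pairs)" by (auto simp: indices_def triples_def phase_pairs_def)
  have A1: "AE \<omega> in M. \<forall>i\<in>indices. (\<lambda>z. X i z \<omega>) analytic_on upper_half_plane"
    using Xi by (intro AE_finite_allI fin) (simp add: analytic_fbm_derivative_def)
  have A2: "AE \<omega> in M. \<forall>i\<in>indices. \<exists>C\<ge>0. \<forall>x y. \<bar>x\<bar> \<le> 2 * R \<longrightarrow> 0 < y \<longrightarrow> y \<le> 2 * R \<longrightarrow>
      norm (X i (Complex x y) \<omega>) \<le> C * y powr (\<beta> - 1)"
    using \<beta> R Xi by (intro AE_finite_allI fin field_sup_bound[OF M]) auto
  have A3: "AE \<omega> in M. \<forall>\<tau>\<in>triples \<times> phase_pairs. \<exists>C\<ge>0.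
      pair_bound X R \<beta> \<omega> (fst (fst \<tau>)) (fst (snd (fst \<tau>))) (fst (snd \<tau>)) (snd (snd \<tau>)) C"
  proof (intro AE_finite_allI fin)
    fix \<tau> assume \<tau>: "\<tau> \<in> triples \<times> phase_pairs"
    show "AE \<omega> in M. \<exists>C\<ge>0. pair_bound X R \<beta> \<omega> (fst (fst \<tau>)) (fst (snd (fst \<tau>))) (fst (snd \<tau>)) (snd (snd \<tau>)) C"
      unfolding pair_bound_def
      by (rule pair_sup_bound[OF M X \<beta> _ _ _ _ _ R]) (use \<tau> in \<open>auto simp: triples_def phase_pairs_def\<close>)
  qed
  have A4: "AE \<omega> in M. \<forall>\<tau>\<in>triples \<times> phase_pairs. \<exists>C\<ge>0.
      triple_bound X R (1 - \<alpha>) \<beta> \<omega> (fst (fst \<tau>)) (fst (snd (fst \<tau>))) (snd (snd (fst \<tau>))) (fst (snd \<tau>)) (snd (snd \<tau>)) C"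
  proof (intro AE_finite_allI fin)
    fix \<tau> assume \<tau>: "\<tau> \<in> triples \<times> phase_pairs"
    show "AE \<omega> in M. \<exists>C\<ge>0. triple_bound X R (1 - \<alpha>) \<beta> \<omega> (fst (fst \<tau>)) (fst (snd (fst \<tau>))) (snd (snd (fst \<tau>))) (fst (snd \<tau>)) (snd (snd \<tau>)) C"
      unfolding triple_bound_def
      by (rule triple_sup_bound[OF M X \<beta> _ _ _ _ _ _ _ _ _ R]) (use \<tau> in \<open>auto simp: triples_def phase_pairs_def\<close>)
  qed
  show ?thesis using A1 A2 A3 A4
  proof eventually_elim
    case (elim \<omega>)
    have "\<exists>C\<ge>0. \<forall>i\<in>indices. \<forall>x y. \<bar>x\<bar> \<le> 2 * R \<longrightarrow> 0 < y \<longrightarrow> y \<le> 2 * R \<longrightarrow> norm (X i (Complex x y) \<omega>) \<le> C * y powr (\<beta> - 1)"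
    proof (rule finite_uniform_constant[OF fin(1) elim(2)[rule_format]])
      fix i C C' assume "\<forall>x y. \<bar>x\<bar> \<le> 2 * R \<longrightarrow> 0 < y \<longrightarrow> y \<le> 2 * R \<longrightarrow> norm (X i (Complex x y) \<omega>) \<le> C * y powr (\<beta> - 1)" "C \<le> C'"
      then show "\<forall>x y. \<bar>x\<bar> \<le> 2 * R \<longrightarrow> 0 < y \<longrightarrow> y \<le> 2 * R \<longrightarrow> norm (X i (Complex x y) \<omega>) \<le> C' * y powr (\<beta> - 1)"
        by (intro allI impI, intro order.trans[OF _ mult_right_mono[OF _ powr_ge_zero, of C C']]) auto
    qed
    then obtain C1 where C1: "0 \<le> C1" "\<And>i x y. i \<in> indices \<Longrightarrow> \<bar>x\<bar> \<le> 2 * R \<Longrightarrow> 0 < y \<Longrightarrow> y \<le> 2 * R \<Longrightarrow>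
        norm (X i (Complex x y) \<omega>) \<le> C1 * y powr (\<beta> - 1)" by blast
    have "\<exists>C\<ge>0. \<forall>\<tau>\<in>triples \<times> phase_pairs. pair_bound X R \<beta> \<omega> (fst (fst \<tau>)) (fst (snd (fst \<tau>))) (fst (snd \<tau>)) (snd (snd \<tau>)) C"
      using elim(3) pair_bound_mono by (intro finite_uniform_constant[OF fin(2)]) blast+
    then obtain C2 where C2: "0 \<le> C2" "\<And>i j l c d. (i, j, l) \<in> triples \<Longrightarrow> (c, d) \<in> phase_pairs \<Longrightarrow> pair_bound X R \<beta> \<omega> i j c d C2"
      by (auto simp: Ball_def)
    have "\<exists>C\<ge>0. \<forall>\<tau>\<in>triples \<times> phase_pairs. triple_bound X R (1 - \<alpha>) \<beta> \<omega> (fst (fst \<tau>)) (fst (snd (fst \<tau>))) (snd (snd (fst \<tau>))) (fst (snd \<tau>)) (snd (snd \<tau>)) C"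
      using elim(4) triple_bound_mono by (intro finite_uniform_constant[OF fin(2)]) blast+
    then obtain C3 where C3: "0 \<le> C3" "\<And>i j l c d. (i, j, l) \<in> triples \<Longrightarrow> (c, d) \<in> phase_pairs \<Longrightarrow> triple_bound X R (1 - \<alpha>) \<beta> \<omega> i j l c d C3"
      by (auto simp: Ball_def)
    \<comment> \<open>The bound for three fields carries the power \<open>\<alpha> - 1\<close> of \<open>\<eta>\<close>; \<open>r\<close> converts it to \<open>\<beta> - 1\<close>.\<close>
    define r where "r = (2 * R) powr (\<alpha> - \<beta>)"
    define C where "C = C1 + 8 * C2 + 16 * C3 * r"
    have r0: "0 \<le> r" by (simp add: r_def)
    have le: "C1 \<le> C" "8 * C2 \<le> C" "16 * C3 * r \<le> C" "0 \<le> C" using C1(1) C2(1) C3(1) r0 by (auto simp: C_def)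
    have hol: "(\<lambda>z. X i z \<omega>) holomorphic_on upper_half_plane" if "i \<in> indices" for i
      using elim(1) that analytic_imp_holomorphic by blast
    have cont: "continuous_on {s..t} (\<lambda>x. Re (c * X i (Complex x y) \<omega>))" if "i \<in> indices" "0 < y" for i c y s t
      using that by (intro continuous_intros continuous_on_compose2[OF holomorphic_on_imp_continuous_on[OF hol]]) auto
    show ?case
    proof (intro exI[of _ C] allI impI)
      fix F assume F: "\<forall>i\<in>indices. \<forall>z\<in>upper_half_plane. (F i has_field_derivative X i z \<omega>) (at z)"
      show "half_plane_fields (\<lambda>i z. X i z \<omega>) F C \<beta> R"
      proof (unfold_locales)
        show "1/4 < \<beta>" "\<beta> < 1" "0 \<le> C" "0 < R" using \<beta> le R by auto
        show "(\<lambda>z. X i z \<omega>) holomorphic_on upper_half_plane" if "i \<in> indices" for i by (rule hol[OF that])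
        show "(F i has_field_derivative X i z \<omega>) (at z)" if "i \<in> indices" "z \<in> upper_half_plane" for i z using F that by blast
        show "norm (X i (Complex x y) \<omega>) \<le> C * y powr (\<beta> - 1)" if "i \<in> indices" "\<bar>x\<bar> \<le> R" "0 < y" "y \<le> 2 * R" for i x y
        proof -
          have "norm (X i (Complex x y) \<omega>) \<le> C1 * y powr (\<beta> - 1)" using C1(2)[OF that(1)] that R by auto
          also have "\<dots> \<le> C * y powr (\<beta> - 1)" using le by (intro mult_right_mono) auto
          finally show ?thesis .
        qed
      next
        fix i j l s t \<epsilon>
        assume ijl: "(i, j, l) \<in> triples" and st: "- R \<le> s" "s \<le> t" "t \<le> R" and \<epsilon>: "0 < \<epsilon>" "\<epsilon> \<le> 2 * R"
        note idx = triples_indices[OF ijl]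
        let ?I = "\<lambda>c d. integral {s..t} (\<lambda>x. Re (c * X i (Complex x \<epsilon>) \<omega>) * Re (d * X j (Complex x \<epsilon>) \<omega>))"
        have adm: "admissible R \<epsilon> \<epsilon> s t" using st \<epsilon> by (auto simp: admissible_def)
        have b: "\<bar>?I c d\<bar> \<le> C2 * weight \<beta> 0 \<epsilon> \<epsilon> s t" if "(c, d) \<in> phase_pairs" for c d
          using C2(2)[OF ijl that] adm unfolding pair_bound_def by blast
        have int: "(\<lambda>x. Re (c * X i (Complex x \<epsilon>) \<omega>) * Re (d * X j (Complex x \<epsilon>) \<omega>)) integrable_on {s..t}" for c d
          using idx \<epsilon> by (intro integrable_continuous_interval continuous_on_mult cont) auto
        have "integral {s..t} (\<lambda>x. area_density (\<lambda>z. X i z \<omega>) (\<lambda>z. X j z \<omega>) x \<epsilon>) = 4 * (?I 1 \<i> - ?I \<i> 1)"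
          unfolding area_density_eq_phases integral_mult_right
          by (simp only: integral_diff[OF int int])
        then have "\<bar>integral {s..t} (\<lambda>x. area_density (\<lambda>z. X i z \<omega>) (\<lambda>z. X j z \<omega>) x \<epsilon>)\<bar> \<le> 8 * C2 * weight \<beta> 0 \<epsilon> \<epsilon> s t"
          using b[of 1 \<i>] b[of \<i> 1] unfolding phase_pairs_def by (simp del: times_complex.sel mult_1 mult_1_left)
        also have "\<dots> \<le> C * weight \<beta> 0 \<epsilon> \<epsilon> s t" using le by (intro mult_right_mono) (auto simp: weight_def)
        finally show "\<bar>integral {s..t} (\<lambda>x. area_density (\<lambda>z. X i z \<omega>) (\<lambda>z. X j z \<omega>) x \<epsilon>)\<bar>
            \<le> C * ((t - s + \<epsilon>) powr (\<beta> + 1/4) * \<epsilon> powr (\<beta> - 5/4))"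
          using \<epsilon> by (simp add: weight_def)
      next
        fix i j l s t \<epsilon> \<eta>
        assume ijl: "(i, j, l) \<in> triples" and st: "- R \<le> s" "s \<le> t" "t \<le> R" and \<epsilon>: "0 < \<epsilon>" "\<epsilon> \<le> \<eta>" "\<eta> \<le> 2 * R"
        note idx = triples_indices[OF ijl]
        let ?I = "\<lambda>c d. integral {s..t} (\<lambda>x. Re (c * X i (Complex x \<epsilon>) \<omega>) * Re (d * X j (Complex x \<epsilon>) \<omega>) * Re (\<i> * X l (Complex x \<eta>) \<omega>))"
        let ?w = "(t - s + \<epsilon>) powr (\<beta> + 1/4) * \<epsilon> powr (\<beta> - 5/4)"
        have adm: "admissible R \<epsilon> \<eta> s t" using st \<epsilon> by (auto simp: admissible_def)
        have b: "\<bar>?I c d\<bar> \<le> C3 * weight \<beta> (1 - \<alpha>) \<epsilon> \<eta> s t" if "(c, d) \<in> phase_pairs" for c d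
          using C3(2)[OF ijl that] adm unfolding triple_bound_def by blast
        have int: "(\<lambda>x. Re (c * X i (Complex x \<epsilon>) \<omega>) * Re (d * X j (Complex x \<epsilon>) \<omega>) * Re (\<i> * X l (Complex x \<eta>) \<omega>)) integrable_on {s..t}" for c d
          using idx \<epsilon> by (intro integrable_continuous_interval continuous_on_mult cont) auto
        have split: "(4 * (a - b)) * (2 * c) = 8 * (a * c - b * c)" for a b c :: real by (simp add: algebra_simps)
        have "integral {s..t} (\<lambda>x. area_density (\<lambda>z. X i z \<omega>) (\<lambda>z. X j z \<omega>) x \<epsilon> * im2 (\<lambda>z. X l z \<omega>) x \<eta>) = 8 * (?I 1 \<i> - ?I \<i> 1)"
          unfolding area_density_eq_phases im2_eq_phase split integral_mult_right
          by (simp only: integral_diff[OF int int])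
        then have "\<bar>integral {s..t} (\<lambda>x. area_density (\<lambda>z. X i z \<omega>) (\<lambda>z. X j z \<omega>) x \<epsilon> * im2 (\<lambda>z. X l z \<omega>) x \<eta>)\<bar> \<le> 16 * (C3 * weight \<beta> (1 - \<alpha>) \<epsilon> \<eta> s t)"
          using b[of 1 \<i>] b[of \<i> 1] unfolding phase_pairs_def by (simp del: times_complex.sel mult_1 mult_1_left)
        also have "weight \<beta> (1 - \<alpha>) \<epsilon> \<eta> s t \<le> ?w * (r * \<eta> powr (\<beta> - 1))"
        proof -
          have "\<eta> powr (- (1 - \<alpha>)) = \<eta> powr (\<alpha> - \<beta>) * \<eta> powr (\<beta> - 1)" by (simp add: powr_add[symmetric])
          also have "\<dots> \<le> r * \<eta> powr (\<beta> - 1)" unfolding r_def using \<epsilon> \<beta> by (intro mult_right_mono powr_mono2) auto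
          finally show ?thesis unfolding weight_def by (rule mult_left_mono) simp
        qed
        also have "16 * (C3 * (?w * (r * \<eta> powr (\<beta> - 1)))) = (16 * C3 * r) * ?w * \<eta> powr (\<beta> - 1)" by (simp only: mult_ac)
        also have "\<dots> \<le> C * ?w * \<eta> powr (\<beta> - 1)" using le by (intro mult_right_mono) auto
        finally show "\<bar>integral {s..t} (\<lambda>x. area_density (\<lambda>z. X i z \<omega>) (\<lambda>z. X j z \<omega>) x \<epsilon> * im2 (\<lambda>z. X l z \<omega>) x \<eta>)\<bar> \<le> C * ?w * \<eta> powr (\<beta> - 1)"
          using C3(1) by (simp add: mult_left_mono)
      qed
    qed
  qed
qed

theorem theorem4p13:
  fixes M :: "'w measure" and X :: "nat \<Rightarrow> complex \<Rightarrow> 'w \<Rightarrow> complex" and \<alpha> q :: real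
  assumes "prob_space M"
    and "0 < \<alpha>" and "\<alpha> < 1" and "\<alpha> > 1 / 4" and "\<alpha> \<noteq> 1 / 2"
    and "q > 1 / \<alpha>"
    and "independent_copies \<alpha> M {1, 2, 3} X"
  shows "AE \<omega> in M. \<exists>L :: real \<Rightarrow> real \<Rightarrow> real. \<forall>s t. s \<le> t \<longrightarrow>
           ((\<lambda>\<epsilon>. d3 q (Vol X \<epsilon> \<omega>) L s t) \<longlongrightarrow> 0) (at_right 0)"
proof -
  have q: "0 < q" "1 / q < \<alpha>"
  proof -
    show "0 < q" using assms(2,6) by (meson less_trans zero_less_divide_1_iff)
    then show "1 / q < \<alpha>" using assms(2,6) by (simp add: field_simps)
  qed
  obtain \<beta> where \<beta>: "max (1/4) (1 / q) < \<beta>" "\<beta> < \<alpha>"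
    using dense[of "max (1/4) (1 / q)" \<alpha>] assms(4) q by auto
  have \<beta>': "1/4 < \<beta>" "1 / q < \<beta>" using \<beta> by auto
  have p: "0 < 3 / q" "3 / q < 3 * \<beta>" using q \<beta>' by auto
  have "AE \<omega> in M. \<forall>n::nat. \<exists>C. \<forall>F. (\<forall>i\<in>indices. \<forall>z\<in>upper_half_plane. (F i has_field_derivative X i z \<omega>) (at z)) \<longrightarrow>
     half_plane_fields (\<lambda>i z. X i z \<omega>) F C \<beta> (real (Suc n))"
    unfolding AE_all_countable using assms \<beta> \<beta>' by (intro allI half_plane_fields_AE) auto
  moreover have "AE \<omega> in M. \<forall>i\<in>indices. (\<lambda>z. X i z \<omega>) analytic_on upper_half_plane"
    using assms(7) unfolding independent_copies_def indices_def
    by (intro AE_finite_allI) (auto simp: analytic_fbm_derivative_def)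
  ultimately show ?thesis
  proof eventually_elim
    case (elim \<omega>)
    let ?f = "\<lambda>i z. X i z \<omega>"
    obtain F where F: "\<And>i z. i \<in> indices \<Longrightarrow> z \<in> upper_half_plane \<Longrightarrow> (F i has_field_derivative ?f i z) (at z)"
      using primitives_exist[of indices ?f] elim(2) analytic_imp_holomorphic by blast
    have fields: "\<exists>C. half_plane_fields ?f F C \<beta> (real (Suc n))" for n
      using elim(1) F by blast
    obtain C1 where C1: "half_plane_fields ?f F C1 \<beta> (real (Suc 0))" using fields by blast
    interpret one: half_plane_fields ?f F C1 \<beta> "real (Suc 0)" by (rule C1)
    have deriv: "Gamma_eps_deriv (X i) \<epsilon> \<omega> x = re2 (?f i) x \<epsilon>" if "i \<in> indices" "0 < \<epsilon>" for i \<epsilon> x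
    proof (rule Gamma_eps_deriv_eq[of \<beta> "F i" "X i" \<omega> C1])
      show "0 < \<beta>" using \<beta>' by simp
      show "(F i has_field_derivative X i z \<omega>) (at z)" if "z \<in> upper_half_plane" for z using F \<open>i \<in> indices\<close> that by blast
      show "norm (X i (Complex x y) \<omega>) \<le> C1 * y powr (\<beta> - 1)" if "\<bar>x\<bar> \<le> 1" "0 < y" "y \<le> 1" for x y
        using one.field_bound[OF \<open>i \<in> indices\<close>, of x y] that by simp
    qed (use one.C that in auto)
    have deriv': "Gamma_eps_deriv (X i) \<epsilon> \<omega> = (\<lambda>x. re2 (?f i) x \<epsilon>)" if "i \<in> indices" "0 < \<epsilon>" for i \<epsilon>
      using deriv[OF that] by blast
    have Vol_eq: "Vol X \<epsilon> \<omega> u v = half_plane_fields.vol ?f F \<epsilon> u v" if "u \<le> v" "0 < \<epsilon>" for \<epsilon> u v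
      using one.vol_iterated[OF that] unfolding Vol_def by (simp add: deriv' that one.indices_members)
    show ?case
    proof (intro exI[of _ "half_plane_fields.vol_lim ?f F"] allI impI)
      fix s t :: real assume st: "s \<le> t"
      obtain n :: nat where n: "max \<bar>s\<bar> \<bar>t\<bar> \<le> real n" using real_arch_simple by blast
      obtain C where C: "half_plane_fields ?f F C \<beta> (real (Suc n))" using fields by blast
      interpret half_plane_fields ?f F C \<beta> "real (Suc n)" by (rule C)
      obtain K \<kappa> where K: "0 \<le> K" "0 < \<kappa>" and rate: "\<And>s t y. - real (Suc n) \<le> s \<Longrightarrow> s < t \<Longrightarrow> t \<le> real (Suc n) \<Longrightarrow> 0 < y \<Longrightarrow>
          y \<le> 2 * real (Suc n) \<Longrightarrow> \<bar>vol y s t - vol_lim s t\<bar> \<le> K * y powr \<kappa> * (t - s) powr (3 / q)"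
        using vol_convergence_rate[OF p] by blast
      show "((\<lambda>\<epsilon>. d3 q (Vol X \<epsilon> \<omega>) vol_lim s t) \<longlongrightarrow> 0) (at_right 0)"
      proof (rule d3_tendsto_0[OF q(1) K, of 1])
        fix \<epsilon> u v :: real assume "0 < \<epsilon>" "\<epsilon> \<le> 1" "s \<le> u" "u < v" "v \<le> t"
        moreover from this have "- real (Suc n) \<le> u" "v \<le> real (Suc n)" using n by auto
        ultimately show "\<bar>Vol X \<epsilon> \<omega> u v - vol_lim u v\<bar> \<le> K * \<epsilon> powr \<kappa> * (v - u) powr (3 / q)"
          using rate[of u v \<epsilon>] by (simp add: Vol_eq)
      qed simp
    qed
  qed
qed

end
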